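(* Let $\mathbb K$ be a number field with ring of integers $\mathbb Z_{\mathbb K}$, let $m\in\mathbb Z_{\ge1}$ and $\lambda_0,\lambda_1,\ldots,\lambda_m\in\mathbb Z_{\mathbb K}$ with $\lambda_j\neq0$ for at least one $j$, and let $\alpha_1,\ldots,\alpha_m\in\mathbb Z_{\mathbb K}\setminus\{0\}$ be pairwise distinct. Let $n\in\mathbb Z_{\ge3}$ and let $R$ be the set of primes lying in the union of $r$ residue classes of the reduced residue system modulo $n$, where $r>\frac{m\varphi(n)}{m+1}$. Let $V=\{v\in V_0:\ v\mid p\text{ for some }p\in R\}$. Then there exists a place $v'\in V$ such that $$\lambda_0+\lambda_1F_{v'}(\alpha_1)+\cdots+\lambda_mF_{v'}(\alpha_m)\neq0.$$
   Context: $\varphi$ is Euler's totient function. $V_0$ is the set of non-Archimedean places of $\mathbb K$; $v\mid p$ means $v$ extends the $p$-adic absolute value, with completion $\mathbb K_v$. For $v\in V_0$ and $\alpha\in\mathbb Z_{\mathbb K}$, $F_v(\alpha)$ denotes the sum in $\mathbb K_v$ of the convergent series $\sum_{k=0}^\infty k!\,\alpha^k$. *)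

theory Defs
  imports
    Complex_Main
    "HOL-Computational_Algebra.Polynomial"
    "HOL-Number_Theory.Totient"
    "HOL-Algebra.QuotRing"
begin

section \<open>Number fields\<close>

text \<open>
  The number field is the whole of a type of characteristic 0 that is finite-dimensional over
  the rationals; \<^const>\<open>of_rat\<close> is the embedding of its prime field.
\<close>

definition number_field :: "'k::field_char_0 itself \<Rightarrow> bool" where
  "number_field T \<longleftrightarrow>
     (\<exists>B :: 'k set. finite_dimensional_vector_space (\<lambda>q x. of_rat q * x) B)"

definition ring_of_integers :: "'k::field_char_0 set" where
  "ring_of_integers = {x. algebraic_int x}"


section \<open>Non-Archimedean places\<close>

definition nonarch_absolute_value :: "('k::field \<Rightarrow> real) \<Rightarrow> bool" where
  "nonarch_absolute_value v \<longleftrightarrow>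
     (\<forall>x. 0 \<le> v x) \<and> (\<forall>x. v x = 0 \<longleftrightarrow> x = 0) \<and>
     (\<forall>x y. v (x * y) = v x * v y) \<and> (\<forall>x y. v (x + y) \<le> max (v x) (v y))"

definition padic_abs :: "nat \<Rightarrow> rat \<Rightarrow> real" where
  "padic_abs p q =
     (if q = 0 then 0
      else real p powi (int (multiplicity (int p) (snd (quotient_of q)))
                        - int (multiplicity (int p) (fst (quotient_of q)))))"

definition lies_over :: "('k::field_char_0 \<Rightarrow> real) \<Rightarrow> nat \<Rightarrow> bool" where
  "lies_over v p \<longleftrightarrow> (\<forall>q. v (of_rat q) = padic_abs p q)"

text \<open>
  A non-Archimedean place of a number field is an equivalence class of non-trivial
  non-Archimedean absolute values. Each class has exactly one member that extends a \<open>p\<close>-adic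
  absolute value of the rationals (for exactly one prime \<open>p\<close>), and that member stands
  for the place.
\<close>

definition nonarch_places :: "('k::field_char_0 \<Rightarrow> real) set" where
  "nonarch_places = {v. nonarch_absolute_value v \<and> (\<exists>p. prime p \<and> lies_over v p)}"


section \<open>The completion at a place\<close>

definition cauchy_seqs :: "('k::field \<Rightarrow> real) \<Rightarrow> (nat \<Rightarrow> 'k) set" where
  "cauchy_seqs v = {x. \<forall>e>0. \<exists>N. \<forall>i\<ge>N. \<forall>j\<ge>N. v (x i - x j) < e}"

definition null_seqs :: "('k::field \<Rightarrow> real) \<Rightarrow> (nat \<Rightarrow> 'k) set" where
  "null_seqs v = {x. (\<lambda>i. v (x i)) \<longlonglongrightarrow> 0}"

definition cauchy_ring :: "('k::field \<Rightarrow> real) \<Rightarrow> (nat \<Rightarrow> 'k) ring" where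
  "cauchy_ring v =
     \<lparr>carrier = cauchy_seqs v,
      mult = (\<lambda>x y i. x i * y i), one = (\<lambda>i. 1),
      zero = (\<lambda>i. 0), add = (\<lambda>x y i. x i + y i)\<rparr>"

definition completion :: "('k::field \<Rightarrow> real) \<Rightarrow> (nat \<Rightarrow> 'k) set ring" where
  "completion v = cauchy_ring v Quot null_seqs v"

definition to_completion :: "('k::field \<Rightarrow> real) \<Rightarrow> 'k \<Rightarrow> (nat \<Rightarrow> 'k) set" where
  "to_completion v a = null_seqs v +>\<^bsub>cauchy_ring v\<^esub> (\<lambda>i. a)"

text \<open>
  The continuous extension of \<open>v\<close>: the limit does not depend on the sequence chosen
  from the coset \<open>X\<close>.
\<close>

definition completion_abs :: "('k::field \<Rightarrow> real) \<Rightarrow> (nat \<Rightarrow> 'k) set \<Rightarrow> real" where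
  "completion_abs v X = (THE l. \<forall>x\<in>X. (\<lambda>i. v (x i)) \<longlonglongrightarrow> l)"

definition completion_sums ::
  "('k::field \<Rightarrow> real) \<Rightarrow> (nat \<Rightarrow> (nat \<Rightarrow> 'k) set) \<Rightarrow> (nat \<Rightarrow> 'k) set \<Rightarrow> bool" where
  "completion_sums v f s \<longleftrightarrow>
     s \<in> carrier (completion v) \<and>
     (\<lambda>N. completion_abs v
        ((\<Oplus>\<^bsub>completion v\<^esub>k\<in>{..<N}. f k) \<ominus>\<^bsub>completion v\<^esub> s)) \<longlonglongrightarrow> 0"

definition euler_F :: "('k::field_char_0 \<Rightarrow> real) \<Rightarrow> 'k \<Rightarrow> (nat \<Rightarrow> 'k) set" where
  "euler_F v \<alpha> = (THE s. completion_sums v (\<lambda>k. to_completion v (fact k * \<alpha> ^ k)) s)"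

end

theory Submission
  imports
    Defs
    "HOL-Number_Theory.Number_Theory"
    "HOL-Real_Asymp.Real_Asymp"
    "HOL-Computational_Algebra.Squarefree"
begin

text \<open>
  Put \<open>G = \<Prod>\<^sub>j (w - \<alpha>\<^sub>j)\<close> and let \<open>S\<^sub>i\<close> be the linear form with every \<open>F(\<alpha>\<^sub>j)\<close> replaced by the partial sum
  \<open>\<Sum>\<^sub>h\<^sub><\<^sub>i h! \<alpha>\<^sub>j\<^sup>h\<close>. The functional \<open>w\<^sup>i \<mapsto> S\<^sub>i / i!\<close> sends \<open>w\<^sup>\<mu> G\<^sup>l\<close>, up to the factor \<open>M!\<close> with
  \<open>M = m l + \<mu>\<close>, to an algebraic integer \<open>\<Lambda>\<close> of archimedean size \<open>M! e\<^bsup>O(l)\<^esup>\<close>. If the linear form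
  vanishes at a place \<open>v\<close>, then \<open>|\<Lambda>|\<^sub>v \<le> |M! l!|\<^sub>v\<close>, because \<open>G\<^sup>l\<close> vanishes to order \<open>l\<close> at every \<open>\<alpha>\<^sub>j\<close>.
  Integration by parts shows that \<open>\<Lambda> \<noteq> 0\<close> for some \<open>\<mu> \<le> m\<close>. If the form vanished at all places above
  \<open>R\<close>, then \<open>\<Lambda>\<close> divided by the \<open>R\<close>-part of \<open>M! l!\<close> would be a non-zero algebraic integer. By Mertens'
  theorem in residue classes the logarithm of that \<open>R\<close>-part is at least
  \<open>(m + 1) (r / \<phi>(n)) l ln l - O(l)\<close>, which exceeds \<open>ln M! + O(l) = m l ln l + O(l)\<close> for large \<open>l\<close>.
\<close>

section \<open>Characters modulo n\<close>

text \<open>If the form vanishes at \<open>v\<close>, then \<open>S\<^sub>i\<close> is minus the sum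
  of \<open>lam j\<close> times the tail of \<open>F(\<alpha>\<^sub>j)\<close> from index
  \<open>i\<close> on, so the functional sends a polynomial \<open>C\<close> to minus the sum over
  \<open>j\<close> and \<open>u\<close> of \<open>lam j\<close> times the \<open>u\<close>-th
  derivative of \<open>w\<^sup>u C\<close> at \<open>\<alpha>\<^sub>j\<close>. If
  \<open>G\<^sup>l\<close> divides \<open>C\<close>, these terms vanish for \<open>u < l\<close>;
  for \<open>u \<ge> l\<close> the coefficients \<open>(i + u)! / i!\<close> are divisible by
  \<open>l!\<close>. This is the origin of \<open>l!\<close>, while \<open>M!\<close> clears the
  denominators \<open>i!\<close>. Since \<open>M!\<close> also enters the archimedean size, the
  comparison is between the \<open>R\<close>-part of \<open>M! l!\<close> and the whole of
  \<open>M!\<close>, whence the threshold \<open>m / (m + 1)\<close>. The competing logarithms may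
  carry errors of order \<open>l\<close> only. So the sum of \<open>ln p / p\<close> over the chosen
  residue classes is needed up to a bounded error, for which non-vanishing of
  \<open>L(1, \<chi>)\<close> suffices. Integrality after division by the \<open>R\<close>-part is a
  statement about all places at once, including those not above \<open>R\<close>. It is settled by
  the criterion that an element which is not an algebraic integer has absolute value above 1 at some
  non-Archimedean place; that place is built from a maximal subring.\<close>

definition dchars :: "nat \<Rightarrow> (nat \<Rightarrow> complex) set" where
  "dchars n = {\<chi>. (\<forall>a b. \<chi> (a * b) = \<chi> a * \<chi> b) \<and> (\<forall>a. \<chi> (a mod n) = \<chi> a) \<and>
     (\<forall>a. \<chi> a \<noteq> 0 \<longleftrightarrow> coprime a n)}"

lemma dchars_mult: "\<chi> \<in> dchars n \<Longrightarrow> \<chi> (a * b) = \<chi> a * \<chi> b"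
  and dchars_mod: "\<chi> \<in> dchars n \<Longrightarrow> \<chi> (a mod n) = \<chi> a"
  and dchars_nonzero_iff: "\<chi> \<in> dchars n \<Longrightarrow> \<chi> a \<noteq> 0 \<longleftrightarrow> coprime a n"
  by (auto simp: dchars_def)

lemma dchars_cong: "\<chi> \<in> dchars n \<Longrightarrow> [a = b] (mod n) \<Longrightarrow> \<chi> a = \<chi> b"
  by (metis unique_euclidean_semiring_class.cong_def dchars_mod)

lemma dchars_one: assumes "\<chi> \<in> dchars n" shows "\<chi> 1 = 1"
proof -
  have "\<chi> 1 * \<chi> 1 = \<chi> 1" using dchars_mult[OF assms, of 1 1] by simp
  moreover have "\<chi> 1 \<noteq> 0" using dchars_nonzero_iff[OF assms, of 1] by simp
  ultimately show ?thesis by simp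
qed

lemma dchars_power: assumes "\<chi> \<in> dchars n" shows "\<chi> (a ^ k) = \<chi> a ^ k"
  by (induction k) (use dchars_one[OF assms] in \<open>auto simp: dchars_mult[OF assms]\<close>)

lemma dchars_root_of_unity:
  assumes "\<chi> \<in> dchars n" "coprime a n" shows "\<chi> a ^ totient n = 1"
  using dchars_cong[OF assms(1) euler_theorem[OF assms(2)]] dchars_one[OF assms(1)]
  by (simp add: dchars_power[OF assms(1)])

lemma norm_dchars:
  assumes "\<chi> \<in> dchars n" "n > 0" shows "norm (\<chi> a) = (if coprime a n then 1 else 0)"
proof (cases "coprime a n")
  case True
  have "norm (\<chi> a) = 1"
    using power_eq_1_iff[OF dchars_root_of_unity[OF assms(1) True]] assms(2) by simp
  then show ?thesis using True by simp
next
  case False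
  then show ?thesis using dchars_nonzero_iff[OF assms(1)] by auto
qed

lemma norm_dchars_le:
  assumes "\<chi> \<in> dchars n" "n > 0" shows "norm (\<chi> a) \<le> 1"
  using norm_dchars[OF assms] by simp

text \<open>By periodicity a character is determined on \<open>{..<n}\<close>, where its values are
  0 or \<open>totient n\<close>-th roots of unity.\<close>

lemma finite_dchars: assumes "n > 0" shows "finite (dchars n)"
proof -
  let ?Z = "insert 0 {z::complex. z ^ totient n = 1}"
  have fin: "finite ?Z" using assms by (auto intro!: finite_roots_unity simp: Suc_le_eq)
  have "inj_on (\<lambda>\<chi>. restrict \<chi> {..<n}) (dchars n)"
  proof (rule inj_onI, rule ext)
    fix f g :: "nat \<Rightarrow> complex" and x
    assume f: "f \<in> dchars n" and g: "g \<in> dchars n" and e: "restrict f {..<n} = restrict g {..<n}"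
    have "f (x mod n) = g (x mod n)" using fun_cong[OF e, of "x mod n"] assms by simp
    then show "f x = g x" using dchars_mod f g by metis
  qed
  moreover have "(\<lambda>\<chi>. restrict \<chi> {..<n}) ` dchars n \<subseteq> PiE {..<n} (\<lambda>_. ?Z)"
  proof
    fix h assume "h \<in> (\<lambda>\<chi>. restrict \<chi> {..<n}) ` dchars n"
    then obtain \<chi> where c: "\<chi> \<in> dchars n" "h = restrict \<chi> {..<n}" by blast
    have "\<chi> x \<in> ?Z" for x
      using dchars_root_of_unity[OF c(1), of x] dchars_nonzero_iff[OF c(1), of x] by blast
    then show "h \<in> PiE {..<n} (\<lambda>_. ?Z)" unfolding c(2) by (intro PiE_I) auto
  qed
  ultimately show ?thesis
    using finite_PiE[OF finite_lessThan, of n "\<lambda>_. ?Z"] fin finite_imageD finite_subset by blast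
qed

text \<open>Characters arise as common eigenfunctions of the translations \<open>f \<mapsto> f (b \<cdot>)\<close>: averaging over the
  powers of \<open>b\<close> against roots of unity produces eigenfunctions without leaving the space of \<open>f\<close>
  whose average along the powers of \<open>a\<close> is 0, and there \<open>\<chi> a = 1\<close> is impossible.\<close>
lemma dchars_exists_nontrivial_at:
  assumes n: "n > 0" and a: "coprime a n" "\<not> [a = 1] (mod n)"
  shows "\<exists>\<chi>\<in>dchars n. \<chi> a \<noteq> 1"
proof -
  define N where "N = totient n"
  have Npos: "N > 0" using n by (simp add: N_def)
  \<comment> \<open>The space to work in: non-zero periodic functions supported on the residues
    coprime to \<open>n\<close> whose sums along the powers of \<open>a\<close> vanish. The last
    condition survives all averaging below and is what finally rules out
    \<open>\<chi> a = 1\<close>.\<close>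
  define Q where "Q = (\<lambda>f :: nat \<Rightarrow> complex. (\<forall>x. f (x mod n) = f x) \<and>
    (\<forall>x. \<not> coprime x n \<longrightarrow> f x = 0) \<and> (\<forall>x. (\<Sum>i<N. f (a ^ i * x)) = 0) \<and> (\<exists>x. f x \<noteq> 0))"
  have Qmod: "f (x mod n) = f x" and Qnc: "\<not> coprime x n \<Longrightarrow> f x = 0"
    and Qsum: "(\<Sum>i<N. f (a ^ i * x)) = 0" and Qne: "\<exists>x. f x \<noteq> 0" if "Q f" for f x
    using that unfolding Q_def by auto
  have Qcong: "f x = f y" if "Q f" "[x = y] (mod n)" for f x y
    using Qmod[OF that(1), of x] Qmod[OF that(1), of y] that(2) by (simp add: unique_euclidean_semiring_class.cong_def)
  have Qpow: "f (b ^ N * x) = f x" if "Q f" "coprime b n" for f b x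
  proof -
    have "[b ^ N * x = 1 * x] (mod n)"
      unfolding N_def by (rule cong_mult[OF euler_theorem[OF that(2)] cong_refl])
    from Qcong[OF that(1) this] show ?thesis by simp
  qed
  have start: "\<exists>f. Q f"
  proof -
    \<comment> \<open>The difference of the indicator of the class of 1 and its translate by
      \<open>a\<close> telescopes to 0 along the powers of \<open>a\<close>, since
      \<open>a ^ N\<close> is 1 modulo \<open>n\<close>; it is non-zero at 1 because
      \<open>a\<close> is not 1 modulo \<open>n\<close>.\<close>
    define g :: "nat \<Rightarrow> complex" where "g = (\<lambda>x. if [x = 1] (mod n) then 1 else 0)"
    define f where "f = (\<lambda>x. g x - g (a * x))"
    have gc: "g x = g y" if "[x = y] (mod n)" for x y
      using that unfolding g_def unique_euclidean_semiring_class.cong_def by simp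
    have "f (x mod n) = f x" for x
      unfolding f_def using gc[of "x mod n" x] gc[of "a * (x mod n)" "a * x"]
      by (simp add: unique_euclidean_semiring_class.cong_def mod_mult_right_eq)
    moreover have "f x = 0" if "\<not> coprime x n" for x
    proof -
      have "\<not> [x = 1] (mod n)" using that
        by (metis coprime_1_left cong_imp_coprime cong_sym)
      moreover have "\<not> [a * x = 1] (mod n)" using that
        by (metis coprime_1_left cong_imp_coprime cong_sym coprime_mult_left_iff)
      ultimately show ?thesis by (simp add: f_def g_def)
    qed
    moreover have "(\<Sum>i<N. f (a ^ i * x)) = 0" for x
    proof -
      have "(\<Sum>i<N. f (a ^ i * x)) = (\<Sum>i<N. g (a ^ i * x) - g (a ^ Suc i * x))"
        by (simp add: f_def mult.assoc)
      also have "\<dots> = g (a ^ 0 * x) - g (a ^ N * x)"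
        by (rule sum_lessThan_telescope')
      also have "g (a ^ N * x) = g (1 * x)"
        by (rule gc, rule cong_mult) (use euler_theorem[OF a(1)] in \<open>auto simp: N_def\<close>)
      finally show ?thesis by simp
    qed
    moreover have "f 1 \<noteq> 0" using a by (simp add: f_def g_def)
    ultimately show ?thesis unfolding Q_def by blast
  qed
  define \<omega> where "\<omega> = cis (2 * pi / real N)"
  have \<omega>0: "\<omega> \<noteq> 0" by (simp add: \<omega>_def)
  have \<omega>N: "\<omega> ^ N = 1" using Npos by (simp add: \<omega>_def DeMoivre)
  have \<omega>sum: "(\<Sum>j<N. \<omega> ^ (i * j)) = (if i = 0 then of_nat N else 0)" if "i < N" for i
  proof (cases "i = 0")
    case False
    have ne: "\<omega> ^ i \<noteq> 1"
    proof
      assume "\<omega> ^ i = 1"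
      then have "cis (2 * pi * real i / real N) = 1" by (simp add: \<omega>_def DeMoivre mult_ac)
      then have "cos (2 * pi * real i / real N) = 1" by (simp add: complex_eq_iff)
      then obtain k :: int where "2 * pi * real i / real N = of_int k * 2 * pi"
        using cos_one_2pi_int by blast
      then have "(2 * pi) * (real i / real N) = (2 * pi) * of_int k" by (simp add: mult_ac)
      then have "real i / real N = of_int k"
        by (subst (asm) mult_left_cancel) auto
      moreover have "0 < real i / real N" "real i / real N < 1" using False that by auto
      ultimately show False by (simp add: of_int_0_less_iff)
    qed
    have "(\<Sum>j<N. \<omega> ^ (i * j)) = (\<Sum>j<N. (\<omega> ^ i) ^ j)" by (simp add: power_mult)
    also have "\<dots> = ((\<omega> ^ i) ^ N - 1) / (\<omega> ^ i - 1)" using geometric_sum[OF ne] by simp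
    also have "(\<omega> ^ i) ^ N = 1" using \<omega>N by (metis power_mult mult.commute power_one)
    finally show ?thesis using False by simp
  qed simp
  have ex: "\<exists>f. Q f \<and> (\<forall>b\<in>S. \<exists>\<zeta>. \<forall>x. f (b * x) = \<zeta> * f x)"
    if "finite S" "\<forall>b\<in>S. coprime b n" for S
    using that
  proof (induction S)
    case empty
    then show ?case using start by simp
  next
    case (insert b S)
    then obtain f where f: "Q f" "\<forall>c\<in>S. \<exists>\<zeta>. \<forall>x. f (c * x) = \<zeta> * f x" by auto
    have b: "coprime b n" using insert by simp
    \<comment> \<open>Up to the factor \<open>N\<close>, \<open>F j\<close> is the projection of
      \<open>f\<close> onto the eigenspace of translation by \<open>b\<close> with eigenvalue
      \<open>inverse (\<omega> ^ j)\<close>. The projections add up to \<open>N * f\<close>, so one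
      of them is non-zero; it remains an eigenfunction for the translations already treated.\<close>
    define F where "F = (\<lambda>j x. \<Sum>i<N. \<omega> ^ (i * j) * f (b ^ i * x))"
    have sumF: "(\<Sum>j<N. F j x) = of_nat N * f x" for x
    proof -
      have "(\<Sum>j<N. F j x) = (\<Sum>i<N. (\<Sum>j<N. \<omega> ^ (i * j)) * f (b ^ i * x))"
        unfolding F_def by (subst sum.swap) (simp add: sum_distrib_right)
      also have "\<dots> = (\<Sum>i<N. if i = 0 then of_nat N * f x else 0)"
        by (rule sum.cong) (auto simp: \<omega>sum)
      also have "\<dots> = of_nat N * f x" using Npos by simp
      finally show ?thesis .
    qed
    obtain x0 where "f x0 \<noteq> 0" using Qne[OF f(1)] by blast
    then have "(\<Sum>j<N. F j x0) \<noteq> 0" using Npos sumF by simp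
    then obtain j where j: "F j x0 \<noteq> 0" by (meson sum.not_neutral_contains_not_neutral)
    have "F j (x mod n) = F j x" for x
      unfolding F_def by (intro sum.cong refl arg_cong2[where f="(*)"] Qcong[OF f(1)])
        (simp add: unique_euclidean_semiring_class.cong_def mod_mult_right_eq)
    moreover have "F j x = 0" if "\<not> coprime x n" for x
    proof -
      have "f (b ^ i * x) = 0" for i
        using Qnc[OF f(1), of "b ^ i * x"] that by auto
      then show ?thesis by (simp add: F_def)
    qed
    moreover have "(\<Sum>i<N. F j (a ^ i * x)) = 0" for x
    proof -
      have "(\<Sum>i<N. F j (a ^ i * x)) = (\<Sum>k<N. \<omega> ^ (k * j) * (\<Sum>i<N. f (a ^ i * (b ^ k * x))))"
        unfolding F_def by (subst sum.swap) (simp add: sum_distrib_left mult_ac)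
      also have "\<dots> = 0" using Qsum[OF f(1)] by simp
      finally show ?thesis .
    qed
    ultimately have QF: "Q (F j)" using j unfolding Q_def by blast
    have eb: "F j (b * x) = inverse (\<omega> ^ j) * F j x" for x
    proof -
      have "\<omega> ^ j * F j (b * x) = (\<Sum>i<N. \<omega> ^ (Suc i * j) * f (b ^ Suc i * x))"
        by (simp add: F_def sum_distrib_left power_add mult_ac)
      also have "\<dots> = (\<Sum>i<Suc N. \<omega> ^ (i * j) * f (b ^ i * x)) - f x"
        by (subst sum.lessThan_Suc_shift) simp
      also have "\<dots> = F j x + \<omega> ^ (N * j) * f (b ^ N * x) - f x"
        by (simp add: F_def)
      also have "\<omega> ^ (N * j) = 1" using \<omega>N by (simp add: power_mult)
      also have "f (b ^ N * x) = f x" by (rule Qpow[OF f(1) b])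
      finally show ?thesis using \<omega>0 by (simp add: field_simps)
    qed
    have "\<exists>\<zeta>. \<forall>x. F j (c * x) = \<zeta> * F j x" if c: "c \<in> S" for c
    proof -
      obtain \<zeta> where z: "\<forall>x. f (c * x) = \<zeta> * f x" using f(2) c by blast
      have "F j (c * x) = \<zeta> * F j x" for x
      proof -
        have "f (b ^ i * (c * x)) = \<zeta> * f (b ^ i * x)" for i
          using z by (metis mult.left_commute)
        then show ?thesis by (simp add: F_def sum_distrib_left mult_ac)
      qed
      then show ?thesis by blast
    qed
    then show ?case using QF eb by (intro exI[of _ "F j"]) blast
  qed
  define S where "S = {b\<in>{..<n}. coprime b n}"
  have "finite S" "\<forall>b\<in>S. coprime b n" by (auto simp: S_def)
  from ex[OF this] obtain f where f: "Q f"
    and fe: "\<forall>b\<in>S. \<exists>\<zeta>. \<forall>x. f (b * x) = \<zeta> * f x" by (elim exE conjE)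
  have eig: "\<exists>\<zeta>. \<forall>x. f (b * x) = \<zeta> * f x" if "coprime b n" for b
  proof -
    have "b mod n \<in> S" using n that by (simp add: S_def)
    then obtain \<zeta> where z: "\<forall>x. f (b mod n * x) = \<zeta> * f x" using fe by blast
    have "f (b * x) = f (b mod n * x)" for x
      by (rule Qcong[OF f]) (simp add: unique_euclidean_semiring_class.cong_def mod_mult_left_eq)
    then show ?thesis using z by metis
  qed
  \<comment> \<open>A common eigenfunction satisfies \<open>f x = \<zeta> * f 1\<close> for
    \<open>x\<close> coprime to \<open>n\<close>, so \<open>f 1\<close> controls \<open>f\<close>
    entirely, and dividing by it gives a multiplicative function.\<close>
  have f1: "f 1 \<noteq> 0"
  proof
    assume "f 1 = 0"
    have "f x = 0" for x
    proof (cases "coprime x n")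
      case True
      then show ?thesis using eig[OF True] \<open>f 1 = 0\<close> by (metis mult.right_neutral mult_zero_right)
    next
      case False
      then show ?thesis using Qnc[OF f] by blast
    qed
    then show False using Qne[OF f] by blast
  qed
  define \<chi> where "\<chi> = (\<lambda>x. f x / f 1)"
  have mult: "\<chi> (x * y) = \<chi> x * \<chi> y" for x y
  proof (cases "coprime x n")
    case True
    then obtain \<zeta> where z: "\<forall>y. f (x * y) = \<zeta> * f y" using eig by blast
    have "f x = \<zeta> * f 1" using z by (metis mult.right_neutral)
    then show ?thesis using z f1 by (simp add: \<chi>_def)
  next
    case False
    then have "f x = 0" "f (x * y) = 0" using Qnc[OF f, of x] Qnc[OF f, of "x * y"] by auto
    then show ?thesis by (simp add: \<chi>_def)
  qed
  have chi1: "\<chi> 1 = 1" using f1 by (simp add: \<chi>_def)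
  have pow: "\<chi> (x ^ k) = \<chi> x ^ k" for x k
    by (induction k) (use chi1 mult in auto)
  have "\<chi> x \<noteq> 0 \<longleftrightarrow> coprime x n" for x
  proof
    assume "coprime x n"
    then have "f (x ^ N) = f 1" using Qpow[OF f, of x 1] by simp
    then have "\<chi> x ^ N = 1" unfolding pow[symmetric] using f1 by (simp add: \<chi>_def)
    then show "\<chi> x \<noteq> 0" using Npos by (metis power_eq_0_iff zero_neq_one)
  next
    assume "\<chi> x \<noteq> 0"
    then show "coprime x n" using Qnc[OF f, of x] unfolding \<chi>_def by auto
  qed
  moreover have "\<chi> (x mod n) = \<chi> x" for x using Qmod[OF f] unfolding \<chi>_def by simp
  ultimately have "\<chi> \<in> dchars n" using mult by (simp add: dchars_def)
  moreover have "\<chi> a \<noteq> 1"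
  proof
    assume "\<chi> a = 1"
    then have "f (a ^ i * 1) = f 1" for i using pow[of a i] f1 by (simp add: \<chi>_def field_simps)
    then have "of_nat N * f 1 = 0" using Qsum[OF f, of 1] by simp
    then show False using f1 Npos by simp
  qed
  ultimately show ?thesis by blast
qed

definition trivial_char :: "nat \<Rightarrow> nat \<Rightarrow> complex" where
  "trivial_char n = (\<lambda>a. if coprime a n then 1 else 0)"

lemma trivial_char_in_dchars: "n > 0 \<Longrightarrow> trivial_char n \<in> dchars n"
  by (auto simp: dchars_def trivial_char_def)

lemma dchars_nontrivial_ex:
  assumes "\<chi> \<in> dchars n" "\<chi> \<noteq> trivial_char n"
  shows "\<exists>b. coprime b n \<and> \<chi> b \<noteq> 1"
proof (rule ccontr)
  assume "\<nexists>b. coprime b n \<and> \<chi> b \<noteq> 1"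
  then have "\<chi> b = trivial_char n b" for b
    using dchars_nonzero_iff[OF assms(1), of b] by (auto simp: trivial_char_def)
  then show False using assms(2) by blast
qed

text \<open>Multiplication by a \<open>b\<close> with \<open>\<chi> b \<noteq> 1\<close> permutes
  the residues and multiplies the sum by \<open>\<chi> b\<close>.\<close>

lemma sum_dchars_residues:
  assumes "n > 0" "\<chi> \<in> dchars n" "\<chi> \<noteq> trivial_char n"
  shows "(\<Sum>x<n. \<chi> x) = 0"
proof -
  obtain b where b: "coprime b n" "\<chi> b \<noteq> 1" using dchars_nontrivial_ex assms by blast
  have inj: "inj_on (\<lambda>x. b * x mod n) {..<n}"
  proof (rule inj_onI)
    fix x y assume xy: "x \<in> {..<n}" "y \<in> {..<n}" "b * x mod n = b * y mod n"
    then have "[b * x = b * y] (mod n)" unfolding unique_euclidean_semiring_class.cong_def by blast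
    then have "[x = y] (mod n)" using b(1) cong_mult_lcancel_nat by blast
    then show "x = y" using xy by (simp add: unique_euclidean_semiring_class.cong_def)
  qed
  have "(\<lambda>x. b * x mod n) ` {..<n} = {..<n}"
    by (rule endo_inj_surj[OF _ _ inj]) (use assms(1) in auto)
  then have "(\<Sum>x<n. \<chi> x) = (\<Sum>x<n. \<chi> (b * x mod n))"
    using sum.reindex[OF inj, of \<chi>] by simp
  also have "\<dots> = \<chi> b * (\<Sum>x<n. \<chi> x)"
    by (simp add: dchars_mod[OF assms(2)] dchars_mult[OF assms(2)] sum_distrib_left)
  finally have "(\<chi> b - 1) * (\<Sum>x<n. \<chi> x) = 0" by (simp add: algebra_simps)
  then show ?thesis using b by simp
qed

lemma sum_trivial_char: "n > 0 \<Longrightarrow> (\<Sum>x<n. trivial_char n x) = of_nat (totient n)"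
proof -
  assume n: "n > 0"
  have "(\<Sum>x<n. trivial_char n x) = of_nat (card {x\<in>{..<n}. coprime x n})"
    by (simp add: trivial_char_def sum.If_cases Int_def)
  also have "card {x\<in>{..<n}. coprime x n} = totient n"
  proof (cases "n = 1")
    case False
    have "{x\<in>{..<n}. coprime x n} = totatives n"
      using False n by (auto simp: totatives_def order.order_iff_strict intro!: Nat.gr0I)
    then show ?thesis by (simp add: totient_def)
  qed (auto simp: lessThan_Suc)
  finally show ?thesis .
qed

lemma dchars_times:
  "\<chi> \<in> dchars n \<Longrightarrow> \<psi> \<in> dchars n \<Longrightarrow> (\<lambda>x. \<chi> x * \<psi> x) \<in> dchars n"
  by (auto simp: dchars_def)

lemma cnj_dchars: "\<chi> \<in> dchars n \<Longrightarrow> (\<lambda>x. cnj (\<chi> x)) \<in> dchars n"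
  by (auto simp: dchars_def)

lemma sum_over_dchars_eq_0:
  assumes n: "n > 0" and a: "coprime a n" "\<not> [a = 1] (mod n)"
  shows "(\<Sum>\<chi>\<in>dchars n. \<chi> a) = 0"
proof -
  obtain \<psi> where p: "\<psi> \<in> dchars n" "\<psi> a \<noteq> 1" using dchars_exists_nontrivial_at assms by blast
  have inj: "inj_on (\<lambda>\<chi> x. \<psi> x * \<chi> x) (dchars n)"
  proof (rule inj_onI, rule ext)
    fix f g :: "nat \<Rightarrow> complex" and x
    assume f: "f \<in> dchars n" and g: "g \<in> dchars n" and e: "(\<lambda>x. \<psi> x * f x) = (\<lambda>x. \<psi> x * g x)"
    show "f x = g x"
      using fun_cong[OF e, of x] dchars_nonzero_iff[OF f, of x] dchars_nonzero_iff[OF g, of x]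
        dchars_nonzero_iff[OF p(1), of x] by auto
  qed
  have "(\<lambda>\<chi> x. \<psi> x * \<chi> x) ` dchars n = dchars n"
    by (rule endo_inj_surj[OF _ _ inj]) (use finite_dchars n p dchars_times in auto)
  then have "(\<Sum>\<chi>\<in>dchars n. \<chi> a) = (\<Sum>\<chi>\<in>dchars n. \<psi> a * \<chi> a)"
    using sum.reindex[OF inj, of "\<lambda>\<chi>. \<chi> a"] by simp
  then have "(\<psi> a - 1) * (\<Sum>\<chi>\<in>dchars n. \<chi> a) = 0"
    by (simp add: left_diff_distrib sum_distrib_left[symmetric])
  then show ?thesis using p by simp
qed

text \<open>Double counting of the sum of all \<open>\<chi> x\<close>: summed over \<open>x\<close>
  first, only the trivial character survives; summed over \<open>\<chi>\<close> first, only
  \<open>x = 1\<close> does.\<close>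

lemma card_dchars: assumes n: "n > 1" shows "card (dchars n) = totient n"
proof -
  have "(\<Sum>\<chi>\<in>dchars n. \<Sum>x<n. \<chi> x) = (\<Sum>\<chi>\<in>dchars n. if \<chi> = trivial_char n then of_nat (totient n) else 0)"
    by (rule sum.cong) (use n sum_dchars_residues sum_trivial_char in auto)
  also have "\<dots> = of_nat (totient n)"
    using n trivial_char_in_dchars[of n] finite_dchars[of n] by simp
  finally have 1: "(\<Sum>\<chi>\<in>dchars n. \<Sum>x<n. \<chi> x) = of_nat (totient n)" .
  have "(\<Sum>\<chi>\<in>dchars n. \<Sum>x<n. \<chi> x) = (\<Sum>x<n. \<Sum>\<chi>\<in>dchars n. \<chi> x)" by (rule sum.swap)
  also have "\<dots> = (\<Sum>x<n. if x = 1 then of_nat (card (dchars n)) else 0)"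
  proof (rule sum.cong[OF refl])
    fix x assume x: "x \<in> {..<n}"
    show "(\<Sum>\<chi>\<in>dchars n. \<chi> x) = (if x = 1 then of_nat (card (dchars n)) else 0)"
    proof (cases "x = 1")
      case True
      then have "(\<Sum>\<chi>\<in>dchars n. \<chi> x) = (\<Sum>\<chi>\<in>dchars n. 1)"
        by (intro sum.cong) (auto simp: dchars_one[unfolded One_nat_def])
      then show ?thesis using True by simp
    next
      case False
      show ?thesis
      proof (cases "coprime x n")
        case True
        have "\<not> [x = 1] (mod n)" using False x n by (simp add: unique_euclidean_semiring_class.cong_def)
        then show ?thesis using sum_over_dchars_eq_0 True n False by simp
      next
        case nc: False
        then have "(\<Sum>\<chi>\<in>dchars n. \<chi> x) = 0"
          by (intro sum.neutral) (use dchars_nonzero_iff in auto)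
        then show ?thesis using False by simp
      qed
    qed
  qed
  also have "\<dots> = of_nat (card (dchars n))" using n by simp
  finally have "of_nat (card (dchars n)) = (of_nat (totient n) :: complex)" using 1 by simp
  then show ?thesis by (simp only: of_nat_eq_iff)
qed

text \<open>For \<open>b\<close> inverse to \<open>a\<close> modulo \<open>n\<close>,
  \<open>cnj (\<chi> a)\<close> is \<open>\<chi> b\<close>, so the sum is that of the
  \<open>\<chi> (b * k)\<close>, which is non-zero only if \<open>b * k\<close> is 1 modulo
  \<open>n\<close>.\<close>

lemma dchars_orthogonality:
  assumes n: "n > 1" and a: "coprime a n"
  shows "(\<Sum>\<chi>\<in>dchars n. cnj (\<chi> a) * \<chi> k) = (if [k = a] (mod n) then of_nat (totient n) else 0)"
proof (cases "coprime k n")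
  case True
  obtain b where b: "[a * b = 1] (mod n)" using a cong_solve_coprime_nat by auto
  have bc: "coprime b n" using b by (metis coprime_1_left cong_imp_coprime cong_sym coprime_mult_left_iff)
  have cb: "cnj (\<chi> a) = \<chi> b" if "\<chi> \<in> dchars n" for \<chi>
  proof -
    have "\<chi> a * \<chi> b = 1"
      using dchars_cong[OF that b] dchars_one[OF that] dchars_mult[OF that] by simp
    moreover have "\<chi> a * cnj (\<chi> a) = 1"
      using norm_dchars[OF that, of a] n a by (simp add: complex_norm_square[symmetric])
    ultimately show ?thesis by (metis mult_cancel_left mult_zero_left zero_neq_one)
  qed
  have s: "(\<Sum>\<chi>\<in>dchars n. cnj (\<chi> a) * \<chi> k) = (\<Sum>\<chi>\<in>dchars n. \<chi> (b * k))"
    by (rule sum.cong) (auto simp: cb dchars_mult)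
  have iff: "[b * k = 1] (mod n) \<longleftrightarrow> [k = a] (mod n)"
  proof -
    have "[b * k = 1] (mod n) \<longleftrightarrow> [b * k = b * a] (mod n)"
      using b by (metis cong_sym cong_trans mult.commute)
    also have "\<dots> \<longleftrightarrow> [k = a] (mod n)" using bc cong_mult_lcancel_nat by blast
    finally show ?thesis .
  qed
  show ?thesis
  proof (cases "[k = a] (mod n)")
    case T: True
    then have "\<chi> (b * k) = 1" if "\<chi> \<in> dchars n" for \<chi>
      using dchars_cong[OF that] iff dchars_one[OF that] by metis
    then have "(\<Sum>\<chi>\<in>dchars n. \<chi> (b * k)) = (\<Sum>\<chi>\<in>dchars n. 1)" by (intro sum.cong) auto
    then show ?thesis using T s card_dchars[OF n] by simp
  next
    case False
    have "coprime (b * k) n" using True bc by simp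
    then show ?thesis using s sum_over_dchars_eq_0[of n "b * k"] False iff n by simp
  qed
next
  case False
  then have "\<not> [k = a] (mod n)" using a by (metis cong_imp_coprime cong_sym)
  moreover have "(\<Sum>\<chi>\<in>dchars n. cnj (\<chi> a) * \<chi> k) = 0"
    by (rule sum.neutral) (use dchars_nonzero_iff False in auto)
  ultimately show ?thesis by simp
qed


section \<open>Estimates of Chebyshev and Mertens\<close>

text \<open>Substituting \<open>k = d * j\<close>. Every Dirichlet convolution below is rearranged
  in this form.\<close>

lemma sum_divisors_swap:
  fixes f :: "nat \<Rightarrow> nat \<Rightarrow> 'a::comm_monoid_add"
  shows "(\<Sum>k=1..N. \<Sum>d | d dvd k. f d k) = (\<Sum>d=1..N. \<Sum>j=1..N div d. f d (d * j))"
proof -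
  have "(\<Sum>k=1..N. \<Sum>d | d dvd k. f d k) = (\<Sum>(k,d)\<in>(SIGMA k:{1..N}. {d. d dvd k}). f d k)"
    by (subst sum.Sigma) auto
  also have "\<dots> = (\<Sum>(d,j)\<in>(SIGMA d:{1..N}. {1..N div d}). f d (d * j))"
  proof (rule sum.reindex_bij_witness[where i="\<lambda>(d,j). (d * j, d)" and j="\<lambda>(k,d). (d, k div d)"])
    fix x assume "x \<in> (SIGMA k:{1..N}. {d. d dvd k})"
    then obtain k d where x: "x = (k, d)" "1 \<le> k" "k \<le> N" "d dvd k" by auto
    then have "0 < d" "d \<le> k" "1 \<le> k div d" "k div d \<le> N div d"
      by (auto simp: dvd_imp_le dvd_pos_nat Suc_le_eq div_greater_zero_iff div_le_mono)
    then show "(case x of (k, d) \<Rightarrow> (d, k div d)) \<in> (SIGMA d:{1..N}. {1..N div d})"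
      using x by auto
  next
    fix x assume "x \<in> (SIGMA d:{1..N}. {1..N div d})"
    then obtain d j where x: "x = (d, j)" "1 \<le> d" "d \<le> N" "1 \<le> j" "j \<le> N div d" by auto
    then have "d * j \<le> N" by (metis mult.commute div_times_less_eq_dividend le_trans mult_le_mono1)
    then show "(case x of (d, j) \<Rightarrow> (d * j, d)) \<in> (SIGMA k:{1..N}. {d. d dvd k})"
      using x by auto
  qed auto
  also have "\<dots> = (\<Sum>d=1..N. \<Sum>j=1..N div d. f d (d * j))"
    by (subst sum.Sigma) auto
  finally show ?thesis .
qed

lemma ln_fact_eq_sum_ln: "ln (fact N :: real) = (\<Sum>k=1..N. ln (real k))"
proof -
  have "ln (fact N :: real) = ln (\<Prod>k=1..N. real k)" unfolding fact_prod of_nat_prod by simp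
  also have "\<dots> = (\<Sum>k=1..N. ln (real k))" by (rule ln_prod) auto
  finally show ?thesis .
qed

text \<open>Legendre's formula in logarithmic form: each \<open>ln k\<close> is split over the
  divisors of \<open>k\<close>, and \<open>d\<close> has \<open>N div d\<close> multiples up to
  \<open>N\<close>.\<close>

lemma ln_fact_eq_sum_mangoldt:
  "ln (fact N :: real) = (\<Sum>d=1..N. mangoldt d * real (N div d))"
proof -
  have "ln (fact N :: real) = (\<Sum>k=1..N. ln (real k))"
    by (rule ln_fact_eq_sum_ln)
  also have "\<dots> = (\<Sum>k=1..N. \<Sum>d | d dvd k. mangoldt d)"
    by (intro sum.cong refl) (simp add: mangoldt_sum)
  also have "\<dots> = (\<Sum>d=1..N. \<Sum>j=1..N div d. mangoldt d)"
    by (rule sum_divisors_swap)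
  finally show ?thesis by (simp add: mult.commute)
qed

lemma ln_fact_ge: "N > 0 \<Longrightarrow> ln (fact N :: real) \<ge> real N * ln (real N) - real N"
proof (induction N)
  case (Suc N)
  show ?case
  proof (cases "N = 0")
    case False
    have "ln (1 + 1 / real N) \<le> 1 / real N" by (rule ln_add_one_self_le_self) auto
    also have "1 + 1 / real N = real (Suc N) / real N" using False by (simp add: field_simps)
    finally have "real N * (ln (real (Suc N)) - ln (real N)) \<le> 1"
      using False by (simp add: ln_div field_simps)
    moreover have "ln (fact (Suc N) :: real) = ln (real (Suc N)) + ln (fact N)"
      by (simp add: ln_mult)
    ultimately show ?thesis using Suc False by (simp add: algebra_simps)
  qed auto
qed simp

lemma ln_fact_le: "ln (fact N :: real) \<le> real N * ln (real N)"
proof (cases "N = 0")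
  case False
  have "(fact N :: real) \<le> real N ^ N" using fact_le_power[of N, where 'a=real] by simp
  then have "ln (fact N :: real) \<le> ln (real N ^ N)" using False by simp
  also have "\<dots> = real N * ln (real N)" using False by (simp add: ln_realpow)
  finally show ?thesis .
qed simp

text \<open>The logarithm of the central binomial coefficient is the sum of
  \<open>mangoldt d\<close> with weights \<open>2 * M div d - 2 * (M div d)\<close>. These are
  non-negative, and equal to 1 for \<open>M < d \<le> 2 * M\<close>. The coefficient itself is at
  most \<open>2 ^ (2 * M)\<close>.\<close>

lemma sum_mangoldt_dyadic: "(\<Sum>d\<in>{M<..2*M}. mangoldt d) \<le> 2 * real M"
proof -
  have "ln (fact (2 * M) :: real) - 2 * ln (fact M) =
      (\<Sum>d=1..2*M. mangoldt d * (real (2 * M div d) - 2 * real (M div d)))"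
  proof -
    have "(\<Sum>d=1..M. mangoldt d * real (M div d)) = (\<Sum>d=1..2*M. mangoldt d * real (M div d))"
      by (rule sum.mono_neutral_left) auto
    then show ?thesis
      unfolding ln_fact_eq_sum_mangoldt
      by (simp add: sum_subtractf sum_distrib_left algebra_simps)
  qed
  also have "\<dots> \<ge> (\<Sum>d\<in>{M<..2*M}. mangoldt d * (real (2 * M div d) - 2 * real (M div d)))"
  proof (rule sum_mono2)
    fix d assume "d \<in> {1..2 * M} - {M<..2 * M}"
    have "2 * (M div d) \<le> 2 * M div d"
      by (metis div_mult2_eq mult.commute nonzero_mult_div_cancel_left div_le_mono div_times_less_eq_dividend div_mult_self_is_m gr0I less_eq_div_iff_mult_less_eq div_by_0 mult_0_right mult_le_mono2 order_refl mult.assoc)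
    then have "2 * real (M div d) \<le> real (2 * M div d)" by linarith
    then show "0 \<le> mangoldt d * (real (2 * M div d) - 2 * real (M div d))"
      by (simp add: mangoldt_nonneg)
  qed auto
  also have "(\<Sum>d\<in>{M<..2*M}. mangoldt d * (real (2 * M div d) - 2 * real (M div d))) =
      (\<Sum>d\<in>{M<..2*M}. mangoldt d)"
  proof (rule sum.cong[OF refl])
    fix d assume d: "d \<in> {M<..2*M}"
    then have "M div d = 0" "2 * M div d = 1"
      by (auto intro!: div_nat_eqI)
    then show "mangoldt d * (real (2 * M div d) - 2 * real (M div d)) = mangoldt d" by simp
  qed
  finally have "(\<Sum>d\<in>{M<..2*M}. mangoldt d) \<le> ln (fact (2 * M) :: real) - 2 * ln (fact M)" .
  also have "fact (2 * M) = (fact M * fact M * real (2 * M choose M) :: real)"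
    using binomial_fact_lemma[of M "2 * M"]
    by (metis (no_types, lifting) add_diff_cancel_left' le_add1 mult_2 of_nat_fact of_nat_mult)
  also have "ln \<dots> = 2 * ln (fact M :: real) + ln (real (2 * M choose M))"
    by (simp add: ln_mult)
  finally have "(\<Sum>d\<in>{M<..2*M}. mangoldt d) \<le> ln (real (2 * M choose M))" by simp
  also have "\<dots> \<le> ln (2 ^ (2 * M))"
  proof -
    have "real (2 * M choose M) \<le> real (2 ^ (2 * M))"
      by (simp only: of_nat_le_iff binomial_le_pow2)
    then show ?thesis by simp
  qed
  also have "\<dots> = 2 * real M * ln 2" by (simp add: ln_realpow)
  also have "\<dots> \<le> 2 * real M" using ln_2_less_1 by (simp add: mult_left_le)
  finally show ?thesis .
qed

lemma mangoldt_le_ln: "d > 0 \<Longrightarrow> mangoldt d \<le> ln (real d)"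
proof -
  assume d: "d > 0"
  have "mangoldt d \<le> (\<Sum>e | e dvd d. mangoldt e :: real)"
    by (rule member_le_sum) (use d mangoldt_nonneg in auto)
  then show ?thesis using mangoldt_sum[of d, where 'a=real] d by simp
qed

text \<open>Halving induction: the lower half costs \<open>6 * M\<close>, the dyadic block
  \<open>2 * M\<close>, and for odd \<open>N\<close> the last term \<open>ln N \<le> N - 1\<close>
  another \<open>2 * M\<close>; the total \<open>10 * M\<close> stays below
  \<open>6 * N\<close>.\<close>

lemma chebyshev_psi_le: "(\<Sum>d=1..N. mangoldt d) \<le> 6 * real N"
proof (induction N rule: less_induct)
  case (less N)
  define M where "M = N div 2"
  show ?case
  proof (cases "N = 0")
    case False
    have "M < N" using False by (simp add: M_def)
    have disj: "{1..M} \<inter> {M<..2*M} = {}" by auto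
    have "{1..2*M} = {1..M} \<union> {M<..2*M}" by auto
    then have "(\<Sum>d=1..2*M. mangoldt d) = (\<Sum>d=1..M. mangoldt d) + (\<Sum>d\<in>{M<..2*M}. mangoldt d :: real)"
      by (metis (no_types, lifting) disj finite_atLeastAtMost finite_greaterThanAtMost sum.union_disjoint)
    also have "\<dots> \<le> 6 * real M + 2 * real M"
      using less[OF \<open>M < N\<close>] sum_mangoldt_dyadic[of M] by linarith
    finally have 1: "(\<Sum>d=1..2*M. mangoldt d) \<le> 8 * real M" by simp
    consider "N = 2 * M" | "N = Suc (2 * M)" unfolding M_def by linarith
    then show ?thesis
    proof cases
      case 2
      have "mangoldt N \<le> ln (real N)" using mangoldt_le_ln False by simp
      also have "\<dots> \<le> real N - 1" using ln_le_minus_one[of "real N"] False by simp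
      finally have "mangoldt N \<le> 2 * real M" using 2 by simp
      then show ?thesis using 1 2 by simp
    qed (use 1 in simp)
  qed simp
qed

text \<open>Replacing \<open>N div d\<close> by \<open>N / d\<close> in Legendre's formula changes
  \<open>ln (fact N)\<close> by at most the Chebyshev sum, hence by at most \<open>6 * N\<close>;
  then divide by \<open>N\<close>.\<close>

lemma mertens_first:
  assumes "N > 0"
  shows "\<bar>(\<Sum>d=1..N. mangoldt d / real d) - ln (real N)\<bar> \<le> 6"
proof -
  let ?S = "\<Sum>d=1..N. mangoldt d / real d"
  have "real N * ?S - ln (fact N) = (\<Sum>d=1..N. mangoldt d * (real N / real d - real (N div d)))"
    unfolding ln_fact_eq_sum_mangoldt
    by (simp add: sum_subtractf sum_distrib_left algebra_simps)
  moreover have "0 \<le> real N / real d - real (N div d)" "real N / real d - real (N div d) \<le> 1" for d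
  proof -
    have "real N / real d - real (N div d) = real (N mod d) / real d" if "d > 0"
    proof -
      have "real N = real (N div d) * real d + real (N mod d)"
        by (metis div_mult_mod_eq of_nat_add of_nat_mult)
      then show ?thesis using that by (simp add: field_simps)
    qed
    moreover have "real (N mod d) \<le> real d" if "d > 0"
      using that by (simp add: less_imp_le)
    ultimately show "0 \<le> real N / real d - real (N div d)" "real N / real d - real (N div d) \<le> 1"
      by (cases "d = 0"; auto simp: field_simps)+
  qed
  then have "0 \<le> (\<Sum>d=1..N. mangoldt d * (real N / real d - real (N div d)))"
    "(\<Sum>d=1..N. mangoldt d * (real N / real d - real (N div d))) \<le> (\<Sum>d=1..N. mangoldt d * 1)"
    by (auto intro!: sum_nonneg mult_nonneg_nonneg sum_mono mult_left_mono simp: mangoldt_nonneg simp del: mult_1_right)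
  ultimately have "0 \<le> real N * ?S - ln (fact N)" "real N * ?S - ln (fact N) \<le> 6 * real N"
    using chebyshev_psi_le[of N] by simp_all
  then have "real N * ?S \<le> real N * (ln (real N) + 6)" "real N * (ln (real N) - 1) \<le> real N * ?S"
    using ln_fact_ge[OF assms] ln_fact_le[of N] by (simp_all add: algebra_simps)
  then show ?thesis using assms by (simp add: abs_le_iff) 
qed

lemma sum_ln_quotient_le:
  assumes "N > 0"
  shows "(\<Sum>d=1..N. ln (real N) - ln (real d)) \<le> real N"
proof -
  have "(\<Sum>d=1..N. ln (real N) - ln (real d)) = real N * ln (real N) - ln (fact N)"
    unfolding ln_fact_eq_sum_ln by (simp add: sum_subtractf)
  then show ?thesis using ln_fact_ge[OF assms] by simp
qed

text \<open>Only the powers \<open>p ^ j\<close> with \<open>j \<ge> 2\<close> contribute, and for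
  fixed \<open>p\<close> they form a geometric series bounded by \<open>2 * ln p / p ^ 2\<close>.
  This allows passing between sums of \<open>mangoldt\<close> and sums over primes at bounded
  cost.\<close>

lemma prime_powers_bound:
  "\<exists>C. \<forall>N. (\<Sum>k | k \<in> {1..N} \<and> \<not> prime k. mangoldt k / real k) \<le> C"
proof -
  \<comment> \<open>The telescoping majorant has size of order \<open>p\<close> to the power
    \<open>-3/2\<close>, which dominates \<open>ln p / p ^ 2\<close>; summability comes without
    evaluating any series.\<close>
  have "eventually (\<lambda>p. 2 * ln (real p) / real p ^ 2 \<le> 1 / sqrt (real p) - 1 / sqrt (real (Suc p))) at_top"
    by real_asymp
  then have ev: "eventually (\<lambda>p. norm (2 * ln (real p) / real p ^ 2)
      \<le> 1 / sqrt (real p) - 1 / sqrt (real (Suc p))) at_top"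
    using eventually_gt_at_top[of 0] by eventually_elim simp
  have "(\<lambda>p. 1 / sqrt (real p)) \<longlonglongrightarrow> 0" by real_asymp
  then have "summable (\<lambda>p. 1 / sqrt (real p) - 1 / sqrt (real (Suc p)))"
    by (rule telescope_summable')
  then have sm: "summable (\<lambda>p. 2 * ln (real p) / real p ^ 2)"
    by (rule summable_comparison_test_ev[OF ev])
  have "(\<Sum>k | k \<in> {1..N} \<and> \<not> prime k. mangoldt k / real k) \<le> (\<Sum>p. 2 * ln (real p) / real p ^ 2)" for N
  proof -
    let ?K = "{k. k \<in> {1..N} \<and> \<not> prime k \<and> primepow k}"
    let ?P = "{p. prime p \<and> p \<le> N}"
    have fP: "finite ?P" by (rule finite_subset[of _ "{..N}"]) auto
    have "(\<Sum>k | k \<in> {1..N} \<and> \<not> prime k. mangoldt k / real k) = (\<Sum>k\<in>?K. mangoldt k / real k)"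
      by (rule sum.mono_neutral_right) (auto simp: mangoldt_def)
    also have "\<dots> \<le> (\<Sum>k\<in>(\<lambda>(p,j). p ^ j) ` (?P \<times> {2..N}). mangoldt k / real k)"
    proof (rule sum_mono2)
      show "finite ((\<lambda>(p,j). p ^ j) ` (?P \<times> {2..N}))" using fP by auto
      show "?K \<subseteq> (\<lambda>(p,j). p ^ j) ` (?P \<times> {2..N})"
      proof
        fix k assume k: "k \<in> ?K"
        then obtain p j where pj: "prime p" "j > 0" "k = p ^ j" by (auto simp: primepow_def)
        have "j \<noteq> 1" using k pj by auto
        moreover have "j < p ^ j" using pj(1) by (intro power_gt_expt prime_gt_Suc_0_nat)
        moreover have "p \<le> p ^ j" using pj by (simp add: self_le_power prime_gt_0_nat Suc_le_eq)
        ultimately show "k \<in> (\<lambda>(p,j). p ^ j) ` (?P \<times> {2..N})" using pj k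
          by (intro image_eqI[of _ _ "(p, j)"]) auto
      qed
    qed (simp add: mangoldt_nonneg)
    also have "\<dots> = (\<Sum>(p,j)\<in>?P \<times> {2..N}. mangoldt (p ^ j) / real (p ^ j))"
      by (subst sum.reindex)
        (auto simp: inj_on_def prime_power_inj'' case_prod_unfold intro!: sum.cong)
    also have "\<dots> = (\<Sum>p\<in>?P. \<Sum>j\<in>{2..N}. mangoldt (p ^ j) / real (p ^ j))"
      by (rule sum.cartesian_product[symmetric])
    also have "\<dots> \<le> (\<Sum>p\<in>?P. 2 * ln (real p) / real p ^ 2)"
    proof (rule sum_mono)
      fix p assume "p \<in> ?P"
      then have p: "prime p" by simp
      then have p2: "real p \<ge> 2" using prime_ge_2_nat by force
      define x where "x = 1 / real p"
      have x: "0 < x" "x \<le> 1/2" using p2 by (auto simp: x_def field_simps)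
      have "(\<Sum>j\<in>{2..N}. x ^ j) \<le> 2 * x ^ 2"
      proof -
        have "(\<Sum>j\<in>{2..N}. x ^ j) \<le> (\<Sum>j\<in>{2..<Suc (Suc N)}. x ^ j)"
          by (rule sum_mono2) (use x in auto)
        also have "\<dots> = (\<Sum>j<N. x ^ (j + 2))"
        proof -
          have "{2..<Suc (Suc N)} = {0 + 2..<N + 2}" by auto
          then show ?thesis
            by (simp only: sum.shift_bounds_nat_ivl[of "\<lambda>j. x ^ j" 0 2 N] atLeast0LessThan)
        qed
        also have "\<dots> = x ^ 2 * (\<Sum>j<N. x ^ j)" by (simp add: sum_distrib_left power2_eq_square mult_ac)
        also have "(\<Sum>j<N. x ^ j) = (1 - x ^ N) / (1 - x)" using x by (simp add: sum_gp_strict)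
        also have "\<dots> \<le> 2"
        proof -
          have "(1 - x ^ N) / (1 - x) \<le> 1 / (1 - x)" using x by (intro divide_right_mono) auto
          also have "\<dots> \<le> 2" using x by (simp add: field_simps)
          finally show ?thesis .
        qed
        finally show ?thesis using x by (simp add: mult.commute)
      qed
      then have "ln (real p) * (\<Sum>j\<in>{2..N}. x ^ j) \<le> ln (real p) * (2 * x ^ 2)"
        using p2 by (intro mult_left_mono) auto
      moreover have "(\<Sum>j\<in>{2..N}. mangoldt (p ^ j) / real (p ^ j)) = ln (real p) * (\<Sum>j\<in>{2..N}. x ^ j)"
        unfolding sum_distrib_left
        by (rule sum.cong) (use p in \<open>auto simp: x_def power_divide field_simps\<close>)
      ultimately show "(\<Sum>j\<in>{2..N}. mangoldt (p ^ j) / real (p ^ j)) \<le> 2 * ln (real p) / real p ^ 2"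
        by (simp add: x_def power_divide mult.commute)
    qed
    also have "\<dots> \<le> (\<Sum>p. 2 * ln (real p) / real p ^ 2)"
    proof (rule sum_le_suminf[OF sm fP])
      fix p :: nat
      show "0 \<le> 2 * ln (real p) / real p ^ 2"
        by (cases "p = 0") auto
    qed
    finally show ?thesis .
  qed
  then show ?thesis by blast
qed


section \<open>Sums over a non-trivial character\<close>

text \<open>Partial summation. The bound \<open>B\<close> concerns sums starting at 1, so a boundary
  term arises at both ends, whence the factor 2. The cut \<open>M\<close> admits weights that
  decrease only from some point on.\<close>

lemma abel_summation_bound:
  fixes a :: "nat \<Rightarrow> complex" and w :: "nat \<Rightarrow> real"
  assumes B: "\<And>N. norm (\<Sum>k=1..N. a k) \<le> B"
    and w0: "\<And>k. k > M \<Longrightarrow> 0 \<le> w k" and dec: "\<And>k. k > M \<Longrightarrow> w (Suc k) \<le> w k"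
  shows "norm (\<Sum>k\<in>{M<..N}. a k * of_real (w k)) \<le> 2 * B * w (Suc M)"
proof (cases "M \<le> N")
  case True
  define A where "A = (\<lambda>N. \<Sum>k=1..N. a k)"
  have A: "norm (A k) \<le> B" for k using B by (simp add: A_def)
  have split: "{M<..Suc N} = insert (Suc N) {M<..N}" if "M \<le> N" for N using that by auto
  have "(\<Sum>k\<in>{M<..N}. a k * of_real (w k)) =
      A N * of_real (w (Suc N)) - A M * of_real (w (Suc M)) + (\<Sum>k\<in>{M<..N}. A k * of_real (w k - w (Suc k)))"
    using True
  proof (induction N rule: dec_induct)
    case (step N)
    have "A (Suc N) = A N + a (Suc N)" by (simp add: A_def)
    then show ?case using step by (simp add: split algebra_simps)
  qed simp
  also have "norm \<dots> \<le> norm (A N * of_real (w (Suc N))) + norm (A M * of_real (w (Suc M)))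
      + norm (\<Sum>k\<in>{M<..N}. A k * of_real (w k - w (Suc k)))"
    by (rule order.trans[OF norm_triangle_ineq]) (intro add_right_mono norm_triangle_ineq4)
  also have "norm (A N * of_real (w (Suc N))) \<le> B * w (Suc N)"
    using w0[of "Suc N"] True A by (simp add: norm_mult mult_right_mono)
  also have "norm (A M * of_real (w (Suc M))) \<le> B * w (Suc M)"
    using w0[of "Suc M"] A by (simp add: norm_mult mult_right_mono)
  also have "norm (\<Sum>k\<in>{M<..N}. A k * of_real (w k - w (Suc k))) \<le> (\<Sum>k\<in>{M<..N}. B * (w k - w (Suc k)))"
  proof (rule sum_norm_le)
    fix k assume "k \<in> {M<..N}"
    then have "0 \<le> w k - w (Suc k)" using dec by simp
    then have "norm (of_real (w k - w (Suc k)) :: complex) = w k - w (Suc k)"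
      by (simp only: norm_of_real abs_of_nonneg)
    then show "norm (A k * of_real (w k - w (Suc k))) \<le> B * (w k - w (Suc k))"
      using A[of k] \<open>0 \<le> w k - w (Suc k)\<close> by (simp only: norm_mult mult_right_mono)
  qed
  also have "(\<Sum>k\<in>{M<..N}. B * (w k - w (Suc k))) = B * (w (Suc M) - w (Suc N))"
    using True by (induction N rule: dec_induct) (auto simp: split algebra_simps)
  finally show ?thesis by (simp add: algebra_simps)
next
  case False
  have "0 \<le> B" using B[of 0] by simp
  then show ?thesis using False w0[of "Suc M"] by simp
qed

lemma abel_limit:
  fixes a :: "nat \<Rightarrow> complex" and w :: "nat \<Rightarrow> real"
  assumes B: "\<And>N. norm (\<Sum>k=1..N. a k) \<le> B"
    and w0: "\<And>k. k > M \<Longrightarrow> 0 \<le> w k" and dec: "\<And>k. k > M \<Longrightarrow> w (Suc k) \<le> w k"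
    and lim: "w \<longlonglongrightarrow> 0"
  shows "convergent (\<lambda>N. \<Sum>k=1..N. a k * of_real (w k))"
    and "N \<ge> M \<Longrightarrow> norm ((\<Sum>k=1..N. a k * of_real (w k)) - lim (\<lambda>N. \<Sum>k=1..N. a k * of_real (w k)))
           \<le> 2 * B * w (Suc N)"
proof -
  define S where "S = (\<lambda>N. \<Sum>k=1..N. a k * of_real (w k))"
  have diff: "norm (S N' - S N) \<le> 2 * B * w (Suc N)" if "M \<le> N" "N \<le> N'" for N N'
  proof -
    have "{1..N'} = {1..N} \<union> {N<..N'}" "{1..N} \<inter> {N<..N'} = {}" using that by auto
    then have "S N' - S N = (\<Sum>k\<in>{N<..N'}. a k * of_real (w k))"
      unfolding S_def by (simp add: sum.union_disjoint del: One_nat_def)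
    also have "norm \<dots> \<le> 2 * B * w (Suc N)"
      by (rule abel_summation_bound[OF B]) (use that w0 dec in auto)
    finally show ?thesis .
  qed
  have wl: "(\<lambda>N. 2 * B * w (Suc N)) \<longlonglongrightarrow> 0"
    using tendsto_mult_right_zero[OF LIMSEQ_Suc[OF lim]] by blast
  have "Cauchy S"
  proof (rule CauchyI')
    fix e :: real assume "e > 0"
    then have "eventually (\<lambda>N. 2 * B * w (Suc N) < e) sequentially"
      using order_tendstoD(2)[OF wl] by simp
    then obtain N0 where N0: "\<And>N. N \<ge> N0 \<Longrightarrow> 2 * B * w (Suc N) < e"
      by (auto simp: eventually_sequentially)
    show "\<exists>M0. \<forall>m\<ge>M0. \<forall>n>m. dist (S m) (S n) < e"
    proof (intro exI[of _ "max M N0"] allI impI)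
      fix m n assume "max M N0 \<le> m" "m < n"
      then show "dist (S m) (S n) < e"
        using diff[of m n] N0[of m] by (simp add: dist_norm norm_minus_commute)
    qed
  qed
  then show conv: "convergent (\<lambda>N. \<Sum>k=1..N. a k * of_real (w k))"
    unfolding S_def[symmetric] by (rule Cauchy_convergent)
  assume "N \<ge> M"
  have "S \<longlonglongrightarrow> lim S" using conv unfolding S_def by (simp add: convergent_LIMSEQ_iff)
  then have "(\<lambda>N'. norm (S N' - S N)) \<longlonglongrightarrow> norm (lim S - S N)"
    by (intro tendsto_norm tendsto_diff tendsto_const)
  then have "norm (lim S - S N) \<le> 2 * B * w (Suc N)"
    by (rule LIMSEQ_le_const2) (use diff \<open>N \<ge> M\<close> in blast)
  then show "norm ((\<Sum>k=1..N. a k * of_real (w k)) - lim (\<lambda>N. \<Sum>k=1..N. a k * of_real (w k)))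
           \<le> 2 * B * w (Suc N)"
    unfolding S_def by (simp add: norm_minus_commute)
qed

text \<open>Complete periods contribute 0, and fewer than \<open>n\<close> terms of modulus at most
  1 remain.\<close>

lemma norm_sum_dchars_le:
  assumes n: "n > 1" and c: "\<chi> \<in> dchars n" "\<chi> \<noteq> trivial_char n"
  shows "norm (\<Sum>k=1..N. \<chi> k) \<le> real n"
proof -
  have per: "\<chi> (n + k) = \<chi> k" for k
    by (rule dchars_cong[OF c(1)]) (simp add: unique_euclidean_semiring_class.cong_def)
  have red: "(\<Sum>k<q * n + r. \<chi> k) = (\<Sum>k<r. \<chi> k)" for q r
  proof (induction q)
    case (Suc q)
    have "(\<Sum>k<n + m. \<chi> k) = (\<Sum>k<m. \<chi> k)" for m
    proof -
      have "(\<Sum>k<n + m. \<chi> k) = (\<Sum>k<n. \<chi> k) + (\<Sum>k<m. \<chi> (n + k))"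
        by (induction m) (auto simp: add.assoc)
      then show ?thesis using sum_dchars_residues[OF _ c] n per by simp
    qed
    from this[of "q * n + r"] show ?case using Suc by (simp add: add.assoc)
  qed simp
  have "\<chi> 0 = 0" using dchars_nonzero_iff[OF c(1), of 0] n by auto
  then have "(\<Sum>k=1..N. \<chi> k) = (\<Sum>k\<in>{0..N}. \<chi> k)"
    by (simp add: sum.atLeast_Suc_atMost)
  also have "\<dots> = (\<Sum>k<Suc N. \<chi> k)" by (simp add: atLeast0AtMost lessThan_Suc_atMost)
  also have "\<dots> = (\<Sum>k<Suc N mod n. \<chi> k)"
    using red[of "Suc N div n" "Suc N mod n"] by simp
  also have "norm \<dots> \<le> (\<Sum>k<Suc N mod n. 1)"
    by (rule sum_norm_le) (use norm_dchars_le[OF c(1)] n in simp)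
  also have "\<dots> \<le> real n"
  proof -
    have "Suc N mod n < n" using n by simp
    then show ?thesis by (simp only: sum_constant card_lessThan mult_1_right of_nat_le_iff less_imp_le)
  qed
  finally show ?thesis .
qed

definition L1 :: "(nat \<Rightarrow> complex) \<Rightarrow> complex" where
  "L1 \<chi> = lim (\<lambda>N. \<Sum>k=1..N. \<chi> k / of_nat k)"

lemma L1_sum_tail:
  assumes "n > 1" "\<chi> \<in> dchars n" "\<chi> \<noteq> trivial_char n"
  shows "convergent (\<lambda>N. \<Sum>k=1..N. \<chi> k / of_nat k)"
    and "norm ((\<Sum>k=1..N. \<chi> k / of_nat k) - L1 \<chi>) \<le> 2 * real n / real (Suc N)"
proof -
  have l: "(\<lambda>k. 1 / real k) \<longlonglongrightarrow> 0" by (rule lim_1_over_n)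
  have eq: "\<chi> k / of_nat k = \<chi> k * of_real (1 / real k)" for k by simp
  show "convergent (\<lambda>N. \<Sum>k=1..N. \<chi> k / of_nat k)"
    unfolding eq by (rule abel_limit(1)[OF norm_sum_dchars_le[OF assms] _ _ l, of 0])
      (auto simp: field_simps)
  show "norm ((\<Sum>k=1..N. \<chi> k / of_nat k) - L1 \<chi>) \<le> 2 * real n / real (Suc N)"
    unfolding eq L1_def
    using abel_limit(2)[OF norm_sum_dchars_le[OF assms] _ _ l, of 0 N] by (auto simp: field_simps)
qed

text \<open>The bound on \<open>k\<close> reflects that \<open>ln x / x\<close> decreases only
  beyond \<open>exp 1\<close>; the step from \<open>k\<close> to \<open>k + 1\<close> needs
  \<open>1 \<le> ln k\<close>.\<close>

lemma ln_over_decreasing: "k > 2 \<Longrightarrow> ln (real (Suc k)) / real (Suc k) \<le> ln (real k) / real k"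
proof -
  assume k: "k > 2"
  have "exp 1 \<le> (3::real)" using exp_le by simp
  then have "1 \<le> ln (real k)" using k by (subst ln_ge_iff) auto
  have "ln (1 + 1 / real k) \<le> 1 / real k" by (rule ln_add_one_self_le_self) auto
  also have "1 + 1 / real k = real (Suc k) / real k" using k by (simp add: field_simps)
  finally have "real k * (ln (real (Suc k)) - ln (real k)) \<le> 1"
    using k by (simp add: ln_div field_simps)
  then have "real k * ln (real (Suc k)) \<le> real (Suc k) * ln (real k)"
    using \<open>1 \<le> ln (real k)\<close> by (simp add: algebra_simps)
  then show ?thesis using k by (simp add: field_simps)
qed

lemma sum_dchars_ln_bounded:
  assumes "n > 1" "\<chi> \<in> dchars n" "\<chi> \<noteq> trivial_char n"
  shows "\<exists>C. \<forall>N. norm (\<Sum>k=1..N. \<chi> k * of_real (ln (real k) / real k)) \<le> C"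
proof -
  have l: "(\<lambda>k. ln (real k) / real k) \<longlonglongrightarrow> 0" by real_asymp
  have "convergent (\<lambda>N. \<Sum>k=1..N. \<chi> k * of_real (ln (real k) / real k))"
    by (rule abel_limit(1)[OF norm_sum_dchars_le[OF assms] _ _ l, of 2])
      (use ln_over_decreasing in auto)
  then have "Bseq (\<lambda>N. \<Sum>k=1..N. \<chi> k * of_real (ln (real k) / real k))"
    by (simp add: convergent_imp_Bseq)
  then show ?thesis unfolding Bseq_def by blast
qed

definition mangoldt_sum_at :: "(nat \<Rightarrow> complex) \<Rightarrow> nat \<Rightarrow> complex" where
  "mangoldt_sum_at \<chi> N = (\<Sum>k=1..N. \<chi> k * of_real (mangoldt k / real k))"

text \<open>Turns the tail error of an L-series cut at \<open>N div d\<close> into a multiple of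
  \<open>d / N\<close>; the factor \<open>d\<close> then cancels the weight \<open>1 / d\<close> of
  the outer sum.\<close>

lemma inverse_Suc_div_le: "0 < N \<Longrightarrow> 0 < d \<Longrightarrow> 1 / real (Suc (N div d)) \<le> real d / real N"
proof -
  assume "0 < N" "0 < d"
  have "N < d * Suc (N div d)" using dividend_less_times_div[OF \<open>0 < d\<close>, of N] by simp
  then have "real N \<le> real d * real (Suc (N div d))"
    by (metis less_imp_le of_nat_le_iff of_nat_mult)
  then show ?thesis using \<open>0 < N\<close> by (simp add: field_simps)
qed

lemma sum_dchars_ln_convolution:
  assumes "\<chi> \<in> dchars n"
  shows "(\<Sum>k=1..N. \<chi> k * of_real (ln (real k) / real k)) =
    (\<Sum>d=1..N. \<chi> d * of_real (mangoldt d / real d) * (\<Sum>j=1..N div d. \<chi> j / of_nat j))"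
proof -
  have "(\<Sum>k=1..N. \<chi> k * of_real (ln (real k) / real k)) =
     (\<Sum>k=1..N. \<Sum>d | d dvd k. \<chi> k / of_nat k * of_real (mangoldt d))"
  proof (rule sum.cong[OF refl])
    fix k assume "k \<in> {1..N}"
    then have "ln (real k) = (\<Sum>d | d dvd k. mangoldt d)" by (simp add: mangoldt_sum)
    then show "\<chi> k * of_real (ln (real k) / real k) = (\<Sum>d | d dvd k. \<chi> k / of_nat k * of_real (mangoldt d))"
      unfolding sum_distrib_left[symmetric] of_real_sum[symmetric] by simp
  qed
  also have "\<dots> = (\<Sum>d=1..N. \<Sum>j=1..N div d. \<chi> (d * j) / of_nat (d * j) * of_real (mangoldt d))"
    by (rule sum_divisors_swap)
  also have "\<dots> = (\<Sum>d=1..N. \<chi> d * of_real (mangoldt d / real d) * (\<Sum>j=1..N div d. \<chi> j / of_nat j))"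
    by (simp add: sum_distrib_left dchars_mult[OF assms] mult_ac)
  finally show ?thesis .
qed

text \<open>In the convolution of \<open>mangoldt\<close> with 1, each inner sum may be replaced by
  \<open>L1 \<chi>\<close>. The total error is a Chebyshev sum times \<open>2 * n / N\<close>, hence
  at most \<open>12 * n\<close>. As the convolved sum is bounded, division by
  \<open>L1 \<chi>\<close> gives the claim.\<close>

lemma mangoldt_sum_at_bounded:
  assumes n: "n > 1" "\<chi> \<in> dchars n" "\<chi> \<noteq> trivial_char n" and L: "L1 \<chi> \<noteq> 0"
  shows "\<exists>C. \<forall>N. norm (mangoldt_sum_at \<chi> N) \<le> C"
proof -
  obtain C where C: "\<And>N. norm (\<Sum>k=1..N. \<chi> k * of_real (ln (real k) / real k)) \<le> C"
    using sum_dchars_ln_bounded[OF n] by blast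
  have "norm (mangoldt_sum_at \<chi> N) \<le> (C + 12 * real n) / norm (L1 \<chi>)" if N: "N > 0" for N
  proof -
    let ?T = "\<lambda>m. \<Sum>j=1..m. \<chi> j / of_nat j"
    have "L1 \<chi> * mangoldt_sum_at \<chi> N = (\<Sum>k=1..N. \<chi> k * of_real (ln (real k) / real k))
       - (\<Sum>d=1..N. \<chi> d * of_real (mangoldt d / real d) * (?T (N div d) - L1 \<chi>))"
    proof -
      have "L * (\<Sum>d=1..N. c d) = (\<Sum>d=1..N. c d * T d) - (\<Sum>d=1..N. c d * (T d - L))"
        for c T :: "nat \<Rightarrow> complex" and L
        by (simp add: sum_distrib_left sum_subtractf[symmetric] algebra_simps)
      then show ?thesis
        unfolding sum_dchars_ln_convolution[OF n(2)] mangoldt_sum_at_def .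
    qed
    also have "norm \<dots> \<le> C + norm (\<Sum>d=1..N. \<chi> d * of_real (mangoldt d / real d) * (?T (N div d) - L1 \<chi>))"
      by (rule order.trans[OF norm_triangle_ineq4]) (use C in simp)
    also have "norm (\<Sum>d=1..N. \<chi> d * of_real (mangoldt d / real d) * (?T (N div d) - L1 \<chi>))
       \<le> (\<Sum>d=1..N. mangoldt d * (2 * real n / real N))"
    proof (rule sum_norm_le)
      fix d assume d: "d \<in> {1..N}"
      have "norm (?T (N div d) - L1 \<chi>) \<le> 2 * real n * (1 / real (Suc (N div d)))"
        using L1_sum_tail(2)[OF n] by simp
      also have "\<dots> \<le> 2 * real n * (real d / real N)"
        by (rule mult_left_mono[OF inverse_Suc_div_le]) (use N d in auto)
      finally have 1: "norm (?T (N div d) - L1 \<chi>) \<le> 2 * real n * (real d / real N)" .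
      have 2: "norm (\<chi> d * of_real (mangoldt d / real d)) \<le> mangoldt d / real d"
        using norm_dchars_le[OF n(2), of d] n(1) mangoldt_nonneg[of d]
        by (simp add: norm_mult norm_divide mult_left_le_one_le divide_right_mono)
      have "norm (\<chi> d * of_real (mangoldt d / real d) * (?T (N div d) - L1 \<chi>))
          \<le> mangoldt d / real d * (2 * real n * (real d / real N))"
        unfolding norm_mult[of "\<chi> d * of_real (mangoldt d / real d)"]
        by (rule mult_mono[OF 2 1]) (auto simp: mangoldt_nonneg)
      also have "\<dots> = mangoldt d * (2 * real n / real N)" using d by simp
      finally show "norm (\<chi> d * of_real (mangoldt d / real d) * (?T (N div d) - L1 \<chi>))
          \<le> mangoldt d * (2 * real n / real N)" .
    qed
    also have "\<dots> = (\<Sum>d=1..N. mangoldt d) * (2 * real n / real N)"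
      by (rule sum_distrib_right[symmetric])
    also have "\<dots> \<le> (6 * real N) * (2 * real n / real N)"
      by (rule mult_right_mono[OF chebyshev_psi_le]) simp
    also have "\<dots> = 12 * real n" using N by simp
    finally have "norm (L1 \<chi>) * norm (mangoldt_sum_at \<chi> N) \<le> C + 12 * real n"
      by (simp add: norm_mult)
    then show ?thesis using L by (simp add: field_simps)
  qed
  moreover have "norm (mangoldt_sum_at \<chi> 0) \<le> max 0 ((C + 12 * real n) / norm (L1 \<chi>))"
    by (simp add: mangoldt_sum_at_def)
  ultimately show ?thesis by (metis max.coboundedI2 not_gr_zero)
qed


section \<open>Moebius inversion and the effect of a zero of the L-series\<close>

definition moebius :: "nat \<Rightarrow> real" where
  "moebius d = (if squarefree d then (-1) ^ card (prime_factors d) else 0)"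

lemma abs_moebius_le: "\<bar>moebius d\<bar> \<le> 1"
  by (simp add: moebius_def power_abs)

text \<open>For a prime \<open>p\<close> dividing \<open>k\<close>, multiplication by
  \<open>p\<close> pairs the squarefree divisors prime to \<open>p\<close> with those divisible by
  \<open>p\<close>, and reverses the sign.\<close>

lemma sum_moebius:
  assumes "k > 0" shows "(\<Sum>d | d dvd k. moebius d) = (if k = 1 then 1 else 0)"
proof (cases "k = 1")
  case True
  then show ?thesis by (simp add: moebius_def)
next
  case False
  then obtain p where p: "prime p" "p dvd k" using prime_factor_nat by blast
  let ?D = "{d. d dvd k \<and> squarefree d \<and> \<not> p dvd d}"
  let ?E = "{d. d dvd k \<and> squarefree d \<and> p dvd d}"
  have fin: "finite {d. d dvd k}" using assms by simp
  have "(\<Sum>d | d dvd k. moebius d) = (\<Sum>d\<in>?D \<union> ?E. moebius d)"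
    by (rule sum.mono_neutral_right[OF fin]) (auto simp: moebius_def)
  also have "\<dots> = (\<Sum>d\<in>?D. moebius d) + (\<Sum>d\<in>?E. moebius d)"
    by (rule sum.union_disjoint) (use fin in \<open>auto intro: finite_subset\<close>)
  also have "(\<Sum>d\<in>?E. moebius d) = (\<Sum>d\<in>?D. - moebius d)"
  proof (rule sum.reindex_bij_witness[where i="\<lambda>d. p * d" and j="\<lambda>d. d div p"])
    fix d assume "d \<in> ?E"
    then obtain e where e: "d = p * e" "d dvd k" "squarefree d" by (auto elim: dvdE)
    then have "\<not> p dvd e"
      using p(1) by (metis mult.commute mult_dvd_mono dvd_refl not_prime_unit power2_eq_square squarefree_def)
    moreover have "squarefree e" using e by (metis dvd_triv_right squarefree_mono)
    ultimately show "d div p \<in> ?D" using e p(1) by (auto dest: dvd_mult_right)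
    show "p * (d div p) = d" using e p(1) by simp
    have "e > 0" using e assms by (auto intro!: Nat.gr0I)
    have "prime_factors d = insert p (prime_factors e)" "p \<notin> prime_factors e"
      using e p(1) \<open>e > 0\<close> \<open>\<not> p dvd e\<close>
      by (auto simp: prime_factors_product prime_prime_factors prime_factors_dvd prime_dvd_mult_iff primes_dvd_imp_eq)
    then show "- moebius (d div p) = moebius d"
      using e p(1) \<open>squarefree e\<close> by (simp add: moebius_def)
  next
    fix d assume d: "d \<in> ?D"
    then have "coprime p d" using p(1) by (simp add: prime_imp_coprime)
    then show "p * d \<in> ?E"
      using d p by (auto intro: squarefree_mult_coprime squarefree_prime divides_mult)
    show "p * d div p = d" using p(1) by simp
  qed
  finally show ?thesis using False by (simp add: sum_negf)
qed

text \<open>Moebius inversion of \<open>ln k\<close> as the divisor sum of \<open>mangoldt\<close>: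
  writing \<open>ln (k / d)\<close> as such a sum and exchanging the order leaves only the divisor
  \<open>e = k\<close>.\<close>

lemma sum_moebius_ln:
  assumes "k > 0" shows "(\<Sum>d | d dvd k. moebius d * (ln (real k) - ln (real d))) = mangoldt k"
proof -
  let ?A = "{d. d dvd k}"
  have fin: "finite ?A" using assms by simp
  have set: "{e\<in>?A. d * e dvd k} = {e. e dvd k div d}" if "d dvd k" for d
  proof -
    have "e dvd k div d \<longleftrightarrow> d * e dvd k" for e
      using that assms by (metis dvd_div_iff_mult dvd_0_left mult.commute not_gr_zero)
    then show ?thesis by (auto dest: dvd_mult_right)
  qed
  have "(\<Sum>d\<in>?A. moebius d * (ln (real k) - ln (real d))) =
      (\<Sum>d\<in>?A. \<Sum>e\<in>{e\<in>?A. d * e dvd k}. moebius d * mangoldt e)"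
  proof (rule sum.cong[OF refl])
    fix d assume "d \<in> ?A"
    then obtain e where e: "k = d * e" by blast
    have pos: "d > 0" "e > 0" using assms e by auto
    have "(\<Sum>e\<in>{e\<in>?A. d * e dvd k}. moebius d * mangoldt e) = moebius d * ln (real e)"
      unfolding set[OF \<open>d \<in> ?A\<close>[simplified]] sum_distrib_left[symmetric]
      using mangoldt_sum[of e, where 'a=real] e pos by simp
    also have "ln (real e) = ln (real k) - ln (real d)" using e pos by (simp add: ln_mult)
    finally show "moebius d * (ln (real k) - ln (real d)) =
        (\<Sum>e\<in>{e\<in>?A. d * e dvd k}. moebius d * mangoldt e)" by simp
  qed
  also have "\<dots> = (\<Sum>e\<in>?A. \<Sum>d\<in>{d\<in>?A. d * e dvd k}. moebius d * mangoldt e)"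
    by (rule sum.swap_restrict[OF fin fin])
  also have "\<dots> = (\<Sum>e\<in>?A. if e = k then mangoldt k else 0)"
  proof (rule sum.cong[OF refl])
    fix e assume e: "e \<in> ?A"
    have "{d\<in>?A. d * e dvd k} = {d. d dvd k div e}"
      using set[of e] e by (simp add: mult.commute)
    moreover have "k div e > 0" using e assms by (auto simp: dvd_imp_le div_greater_zero_iff dvd_pos_nat)
    moreover have "k div e = 1 \<longleftrightarrow> e = k" using e assms by auto
    ultimately show "(\<Sum>d\<in>{d\<in>?A. d * e dvd k}. moebius d * mangoldt e) = (if e = k then mangoldt k else 0)"
      by (simp add: sum_distrib_right[symmetric] sum_moebius)
  qed
  also have "\<dots> = mangoldt k" using fin by simp
  finally show ?thesis .
qed

text \<open>A zero of \<open>L1\<close> forces \<open>- ln N\<close> here, while the sum over all characters of these quantities is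
  non-negative; so at most one character can be a zero.\<close>
lemma mangoldt_sum_at_L1_zero:
  assumes n: "n > 1" "\<chi> \<in> dchars n" "\<chi> \<noteq> trivial_char n" and L: "L1 \<chi> = 0" and N: "N > 0"
  shows "norm (mangoldt_sum_at \<chi> N + of_real (ln (real N))) \<le> 2 * real n"
proof -
  let ?T = "\<lambda>m. \<Sum>j=1..m. \<chi> j / of_nat j"
  have "mangoldt_sum_at \<chi> N + of_real (ln (real N)) =
      (\<Sum>k=1..N. \<Sum>d | d dvd k. \<chi> k / of_nat k * of_real (moebius d * (ln (real N) - ln (real d))))"
  proof -
    \<comment> \<open>With \<open>ln N\<close> in place of \<open>ln k\<close>, the inversion
      formula picks up the additional term \<open>ln N\<close> at \<open>k = 1\<close> only; this
      produces the \<open>ln N\<close> of the claim.\<close>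
    have "(\<Sum>d | d dvd k. moebius d * (ln (real N) - ln (real d))) =
        mangoldt k + (if k = 1 then ln (real N) else 0)" if "k \<in> {1..N}" for k
    proof -
      have "(\<Sum>d | d dvd k. moebius d * (ln (real N) - ln (real d))) =
          (\<Sum>d | d dvd k. moebius d * (ln (real k) - ln (real d)))
          + (\<Sum>d | d dvd k. moebius d) * (ln (real N) - ln (real k))"
        unfolding sum_distrib_right sum.distrib[symmetric] by (intro sum.cong) (simp_all add: algebra_simps)
      then show ?thesis using that by (simp add: sum_moebius_ln sum_moebius)
    qed
    then have "(\<Sum>k=1..N. \<Sum>d | d dvd k. \<chi> k / of_nat k * of_real (moebius d * (ln (real N) - ln (real d)))) =
      (\<Sum>k=1..N. \<chi> k / of_nat k * of_real (mangoldt k + (if k = 1 then ln (real N) else 0)))"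
      unfolding sum_distrib_left[symmetric] of_real_sum[symmetric] by (intro sum.cong) auto
    also have "\<dots> = mangoldt_sum_at \<chi> N + (\<Sum>k=1..N. if k = 1 then of_real (ln (real N)) else 0)"
      unfolding mangoldt_sum_at_def sum.distrib[symmetric]
      by (intro sum.cong) (use dchars_one[OF n(2)] in \<open>auto simp: field_simps\<close>)
    also have "(\<Sum>k=1..N. if k = 1 then of_real (ln (real N)) else 0) = (of_real (ln (real N)) :: complex)"
      using N by simp
    finally show ?thesis by simp
  qed
  also have "\<dots> = (\<Sum>d=1..N. \<Sum>j=1..N div d. \<chi> (d * j) / of_nat (d * j) * of_real (moebius d * (ln (real N) - ln (real d))))"
    by (rule sum_divisors_swap)
  also have "\<dots> = (\<Sum>d=1..N. \<chi> d / of_nat d * of_real (moebius d * (ln (real N) - ln (real d))) * ?T (N div d))"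
    by (simp only: sum_distrib_left) (simp add: dchars_mult[OF n(2)] mult_ac)
  also have "norm \<dots> \<le> (\<Sum>d=1..N. (ln (real N) - ln (real d)) * (2 * real n / real N))"
  proof (rule sum_norm_le)
    fix d assume d: "d \<in> {1..N}"
    \<comment> \<open>As \<open>L1 \<chi> = 0\<close>, the inner partial sum is itself a tail of the
      series and thus small.\<close>
    have "norm (?T (N div d)) \<le> 2 * real n * (1 / real (Suc (N div d)))"
      using L1_sum_tail(2)[OF n, of "N div d"] L by simp
    also have "\<dots> \<le> 2 * real n * (real d / real N)"
      by (rule mult_left_mono[OF inverse_Suc_div_le]) (use N d in auto)
    finally have 1: "norm (?T (N div d)) \<le> 2 * real n * (real d / real N)" .
    have ge: "0 \<le> ln (real N) - ln (real d)" using d by simp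
    have "norm (\<chi> d) * \<bar>moebius d\<bar> \<le> 1 * 1"
      by (rule mult_mono) (use norm_dchars_le[OF n(2)] n(1) abs_moebius_le in auto)
    then have "(norm (\<chi> d) * \<bar>moebius d\<bar>) * ((ln (real N) - ln (real d)) / real d) \<le> 1 * ((ln (real N) - ln (real d)) / real d)"
      by (intro mult_right_mono) (use ge in auto)
    then have 2: "norm (\<chi> d / of_nat d * of_real (moebius d * (ln (real N) - ln (real d)))) \<le> (ln (real N) - ln (real d)) / real d"
      using ge by (simp add: norm_mult norm_divide abs_mult mult_ac del: of_real_mult of_real_diff)
    have "norm (\<chi> d / of_nat d * of_real (moebius d * (ln (real N) - ln (real d))) * ?T (N div d))
       \<le> (ln (real N) - ln (real d)) / real d * (2 * real n * (real d / real N))"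
      unfolding norm_mult[of "\<chi> d / of_nat d * of_real (moebius d * (ln (real N) - ln (real d)))"]
      by (rule mult_mono[OF 2 1]) (use ge in auto)
    also have "\<dots> = (ln (real N) - ln (real d)) * (2 * real n / real N)" using d by simp
    finally show "norm (\<chi> d / of_nat d * of_real (moebius d * (ln (real N) - ln (real d))) * ?T (N div d))
       \<le> (ln (real N) - ln (real d)) * (2 * real n / real N)" .
  qed
  also have "\<dots> = (\<Sum>d=1..N. ln (real N) - ln (real d)) * (2 * real n / real N)"
    by (rule sum_distrib_right[symmetric])
  also have "\<dots> \<le> real N * (2 * real n / real N)"
    by (rule mult_right_mono[OF sum_ln_quotient_le]) (use N in auto)
  also have "\<dots> = 2 * real n" using N by simp
  finally show ?thesis .
qed


section \<open>Non-vanishing of the L-series at 1\<close>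

lemma sum_dvd_mult_coprime:
  fixes f :: "nat \<Rightarrow> 'a::comm_semiring_1"
  assumes "coprime A B" and f: "\<And>x y. f (x * y) = f x * f y"
  shows "(\<Sum>d | d dvd A * B. f d) = (\<Sum>a | a dvd A. f a) * (\<Sum>b | b dvd B. f b)"
proof -
  let ?P = "{a. a dvd A} \<times> {b. b dvd B}"
  have img: "{d. d dvd A * B} = (\<lambda>(a,b). a * b) ` ?P"
  proof
    show "{d. d dvd A * B} \<subseteq> (\<lambda>(a,b). a * b) ` ?P"
    proof
      fix d assume "d \<in> {d. d dvd A * B}"
      then obtain a b where "d = a * b" "a dvd A" "b dvd B" using division_decomp by blast
      then show "d \<in> (\<lambda>(a,b). a * b) ` ?P" by (intro image_eqI[of _ _ "(a, b)"]) auto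
    qed
  qed (auto intro: mult_dvd_mono)
  have inj: "inj_on (\<lambda>(a,b). a * b) ?P"
  proof (rule inj_onI, clarsimp)
    fix a b a' b' assume *: "a dvd A" "b dvd B" "a' dvd A" "b' dvd B" "a * b = a' * b'"
    then have "coprime a b'" "coprime a' b" using assms(1) by (meson coprime_divisors)+
    then show "a = a' \<and> b = b'" using * coprime_crossproduct_nat[of a b' a' b] by simp
  qed
  have "(\<Sum>d | d dvd A * B. f d) = (\<Sum>(a,b)\<in>?P. f (a * b))"
    unfolding img by (subst sum.reindex[OF inj]) (simp add: case_prod_unfold)
  also have "\<dots> = (\<Sum>(a,b)\<in>?P. f a * f b)" by (simp only: f)
  also have "\<dots> = (\<Sum>a | a dvd A. f a) * (\<Sum>b | b dvd B. f b)"
    by (simp add: sum_product sum.cartesian_product)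
  finally show ?thesis .
qed

lemma sum_dvd_prime_power:
  fixes x :: "nat \<Rightarrow> real"
  assumes p: "prime p" and x: "\<And>a b. x (a * b) = x a * x b" "x 1 = 1"
  shows "(\<Sum>d | d dvd p ^ k. x d) = (\<Sum>i\<le>k. x p ^ i)"
proof -
  have pow: "x (a ^ i) = x a ^ i" for a i by (induction i) (use x in auto)
  have "{d. d dvd p ^ k} = (\<lambda>i. p ^ i) ` {..k}" using divides_primepow_nat[OF p] by auto
  moreover have "inj_on (\<lambda>i. p ^ i) {..k}"
    using prime_gt_1_nat[OF p] by (auto simp: inj_on_def power_inject_exp)
  ultimately show ?thesis by (simp add: sum.reindex pow)
qed

lemma sum_minus_one_powers: "(\<Sum>i\<le>k. (-1::real) ^ i) = (if even k then 1 else 0)"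
  by (induction k) auto

lemma sum_powers_sign_nonneg:
  fixes y :: real assumes "y \<in> {-1, 0, 1}"
  shows "(\<Sum>i\<le>k. y ^ i) \<ge> 0" and "even k \<Longrightarrow> (\<Sum>i\<le>k. y ^ i) \<ge> 1"
proof -
  have 0: "(\<Sum>i\<le>k. (0::real) ^ i) = 1" by (induction k) auto
  show "(\<Sum>i\<le>k. y ^ i) \<ge> 0" "even k \<Longrightarrow> (\<Sum>i\<le>k. y ^ i) \<ge> 1"
    using assms 0 by (auto simp: sum_minus_one_powers)
qed

text \<open>The divisor sum is multiplicative, so it suffices to look at \<open>p ^ a\<close>, where
  it is a sum of powers of \<open>x p\<close>. For \<open>x p = -1\<close> this is 0 or 1 according
  to the parity of \<open>a\<close>, and otherwise at least 1; in a square all exponents are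
  even.\<close>

lemma sum_dvd_real_char_nonneg:
  fixes x :: "nat \<Rightarrow> real"
  assumes x: "\<And>a b. x (a * b) = x a * x b" "x 1 = 1" "\<And>a. x a \<in> {-1, 0, 1}"
  shows "k > 0 \<Longrightarrow> (\<Sum>d | d dvd k. x d) \<ge> 0"
    and "k > 0 \<Longrightarrow> (\<Sum>d | d dvd k ^ 2. x d) \<ge> 1"
proof (induction k rule: less_induct)
  case (less k)
  { case 1
    show ?case
    proof (cases "k = 1")
      case False
      then obtain p where p: "prime p" "p dvd k" using prime_factor_nat by blast
      obtain m where m: "k = p ^ multiplicity p k * m" "\<not> p dvd m"
        by (rule multiplicity_decompose'[of k p]) (use 1 p(1) not_prime_unit in auto)
      define a where "a = multiplicity p k"
      have "a > 0" using p 1 unfolding a_def by (simp add: prime_multiplicity_gt_zero_iff prime_imp_prime_elem)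
      have cop: "coprime (p ^ a) m" using p m by (simp add: prime_imp_coprime)
      have "m > 0" using 1 m(1) by (auto intro!: Nat.gr0I)
      moreover have "1 < p ^ a" using \<open>a > 0\<close> prime_gt_1_nat[OF p(1)] one_less_power by blast
      ultimately have "m > 0" "m < k"
        using n_less_m_mult_n[of m "p ^ a"] m(1)[folded a_def] by simp_all
      then show ?thesis using less(1)[of m] sum_powers_sign_nonneg(1)[OF x(3)]
        unfolding m(1)[folded a_def] sum_dvd_mult_coprime[OF cop x(1)] sum_dvd_prime_power[OF p(1) x(1,2)]
        by (intro mult_nonneg_nonneg) auto
    qed (use x in simp)
  next
    case 2
    show ?case
    proof (cases "k = 1")
      case False
      then obtain p where p: "prime p" "p dvd k" using prime_factor_nat by blast
      obtain m where m: "k = p ^ multiplicity p k * m" "\<not> p dvd m"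
        by (rule multiplicity_decompose'[of k p]) (use 2 p(1) not_prime_unit in auto)
      define a where "a = multiplicity p k"
      have "a > 0" using p 2 unfolding a_def by (simp add: prime_multiplicity_gt_zero_iff prime_imp_prime_elem)
      have cop: "coprime (p ^ (2 * a)) (m ^ 2)" using p m by (simp add: prime_imp_coprime)
      have "m > 0" using 2 m(1) by (auto intro!: Nat.gr0I)
      moreover have "1 < p ^ a" using \<open>a > 0\<close> prime_gt_1_nat[OF p(1)] one_less_power by blast
      ultimately have "m > 0" "m < k"
        using n_less_m_mult_n[of m "p ^ a"] m(1)[folded a_def] by simp_all
      moreover have "k ^ 2 = p ^ (2 * a) * m ^ 2"
        using m(1)[folded a_def] by (simp add: power_mult_distrib power_mult[symmetric] mult.commute)
      moreover have "1 * 1 \<le> (\<Sum>i\<le>2 * a. x p ^ i) * (\<Sum>d | d dvd m ^ 2. x d)"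
        using less(2)[OF \<open>m < k\<close> \<open>m > 0\<close>] sum_powers_sign_nonneg(2)[OF x(3), of "2 * a" p]
        by (intro mult_mono) auto
      ultimately show ?thesis
        by (simp only: sum_dvd_mult_coprime[OF cop x(1)] sum_dvd_prime_power[OF p(1) x(1,2)] mult_1)
    qed (use x in simp) }
qed

text \<open>AM-GM applied to the pairs of terms \<open>i\<close>, \<open>d - 1 - i\<close>; the parameter \<open>t\<close> below is \<open>s\<^sup>2\<close>.\<close>
lemma geometric_sum_ge:
  fixes s :: real assumes "0 \<le> s"
  shows "real (Suc d) * s ^ d \<le> (\<Sum>i<Suc d. s ^ (2 * i))"
proof -
  have "(\<Sum>i<Suc d. 2 * s ^ d) \<le> (\<Sum>i<Suc d. s ^ (2 * i) + s ^ (2 * (d - i)))"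
  proof (rule sum_mono)
    fix i assume "i \<in> {..<Suc d}"
    then have "s ^ d = s ^ i * s ^ (d - i)" by (simp add: power_add[symmetric])
    moreover have "s ^ (2 * j) = (s ^ j) ^ 2" for j by (simp add: power_mult[symmetric] mult.commute)
    moreover have "2 * (s ^ i * s ^ (d - i)) \<le> (s ^ i) ^ 2 + (s ^ (d - i)) ^ 2"
      using sum_squares_bound[of "s ^ i" "s ^ (d - i)"] by (simp add: mult.assoc)
    ultimately show "2 * s ^ d \<le> s ^ (2 * i) + s ^ (2 * (d - i))" by simp
  qed
  also have "\<dots> = (\<Sum>i<Suc d. s ^ (2 * i)) + (\<Sum>i<Suc d. s ^ (2 * (d - i)))" by (rule sum.distrib)
  also have "(\<Sum>i<Suc d. s ^ (2 * (d - i))) = (\<Sum>i<Suc d. s ^ (2 * i))"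
    using sum.nat_diff_reindex[of "\<lambda>i. s ^ (2 * i)" "Suc d"] by simp
  finally show ?thesis by (simp add: algebra_simps)
qed

text \<open>The weight \<open>b d\<close> is the gap between \<open>t ^ d / (1 - t ^ d)\<close> and
  its leading behaviour \<open>1 / (d * (1 - t))\<close> as \<open>t\<close> tends to 1.
  Monotonicity reduces to \<open>d * (d + 1) * t ^ d \<le> \<sigma> d * \<sigma> (d + 1)\<close>
  with \<open>\<sigma> d\<close> the geometric sum of length \<open>d\<close>. This follows from the
  AM-GM bound for both factors, and writing \<open>t = s ^ 2\<close> avoids half-integral
  powers.\<close>

lemma monsky_weights:
  fixes s :: real assumes s: "0 < s" "s < 1"
  defines "t \<equiv> s ^ 2"
  defines "b \<equiv> \<lambda>d. 1 / (real d * (1 - t)) - t ^ d / (1 - t ^ d)"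
  shows "d > 0 \<Longrightarrow> b (Suc d) \<le> b d" and "d > 0 \<Longrightarrow> 0 \<le> b d" and "b 1 = 1"
proof -
  have t: "0 < t" "t < 1" using s by (auto simp: t_def power_less_one_iff)
  define \<sigma> where "\<sigma> = (\<lambda>d. \<Sum>i<d. t ^ i)"
  have sig: "(1 - t) * \<sigma> d = 1 - t ^ d" for d
    using t by (simp add: \<sigma>_def sum_gp_strict)
  have sigpos: "\<sigma> d > 0" if "d > 0" for d
    unfolding \<sigma>_def by (rule sum_pos) (use that t in auto)
  have sigge: "real d * s ^ (d - 1) \<le> \<sigma> d" if "d > 0" for d
    using geometric_sum_ge[of s "d - 1"] s that by (simp add: \<sigma>_def t_def power_mult[symmetric])
  have bs: "b d = (1 / real d - t ^ d / \<sigma> d) / (1 - t)" if "d > 0" for d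
  proof -
    have "1 / (real d * (1 - t)) - t ^ d / ((1 - t) * \<sigma> d) = (1 / real d - t ^ d / \<sigma> d) / (1 - t)"
      by (simp add: diff_divide_distrib mult.commute)
    then show ?thesis unfolding sig b_def .
  qed
  show "b (Suc d) \<le> b d" if d: "d > 0" for d
  proof -
    have prod: "real d * real (Suc d) * t ^ d \<le> \<sigma> d * \<sigma> (Suc d)"
    proof -
      have "real d * real (Suc d) * t ^ d = real d * s ^ d * (real (Suc d) * s ^ d)"
        by (simp add: t_def power2_eq_square power_mult_distrib mult_ac)
      also have "\<dots> \<le> \<sigma> d * \<sigma> (Suc d)"
      proof (rule mult_mono)
        have "s ^ d \<le> s ^ (d - 1)" by (rule power_decreasing) (use s in auto)
        then show "real d * s ^ d \<le> \<sigma> d"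
          using sigge[OF d] by (meson mult_left_mono of_nat_0_le_iff order.trans)
        show "real (Suc d) * s ^ d \<le> \<sigma> (Suc d)" using sigge[of "Suc d"] by simp
      qed (use s sigpos[OF d] in auto)
      finally show ?thesis .
    qed
    have "t ^ d / (\<sigma> d * \<sigma> (Suc d)) \<le> 1 / (real d * real (Suc d))"
    proof -
      have "T / S \<le> 1 / D" if "D * T \<le> S" "0 < S" "0 < D" for T S D :: real
        using that by (simp add: field_simps)
      then show ?thesis
        using prod sigpos[of d] sigpos[of "Suc d"] d by simp
    qed
    \<comment> \<open>This identity collapses the difference of two consecutive quotients
      \<open>t ^ d / \<sigma> d\<close> into a single quotient, to be compared with
      \<open>1 / d - 1 / (d + 1)\<close>.\<close>
    moreover have "\<sigma> (Suc d) - t * \<sigma> d = 1"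
    proof -
      have "(1 - t) * (\<sigma> (Suc d) - t * \<sigma> d) = (1 - t) * \<sigma> (Suc d) - t * ((1 - t) * \<sigma> d)"
        by (simp add: algebra_simps)
      also have "\<dots> = (1 - t) * 1" unfolding sig by (simp add: algebra_simps)
      finally show ?thesis using t by (simp only: mult_cancel_left) auto
    qed
    then have "t ^ d / \<sigma> d - t ^ Suc d / \<sigma> (Suc d) = t ^ d / (\<sigma> d * \<sigma> (Suc d))"
    proof -
      have "t ^ d / \<sigma> d - t ^ Suc d / \<sigma> (Suc d) = t ^ d * (\<sigma> (Suc d) - t * \<sigma> d) / (\<sigma> d * \<sigma> (Suc d))"
        using sigpos[of d] sigpos[of "Suc d"] d by (simp add: field_simps)
      then show ?thesis using \<open>\<sigma> (Suc d) - t * \<sigma> d = 1\<close> by simp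
    qed
    moreover have "1 / real d - 1 / real (Suc d) = 1 / (real d * real (Suc d))"
      using d by (simp add: field_simps)
    ultimately have "1 / real (Suc d) - t ^ Suc d / \<sigma> (Suc d) \<le> 1 / real d - t ^ d / \<sigma> d"
      by linarith
    then show ?thesis unfolding bs[OF d] bs[OF zero_less_Suc]
      using t by (intro divide_right_mono) auto
  qed
  show "0 \<le> b d" if d: "d > 0" for d
  proof -
    have "(\<Sum>i<d. t ^ d) \<le> \<sigma> d"
      unfolding \<sigma>_def by (rule sum_mono) (use t in \<open>auto intro!: power_decreasing\<close>)
    then have "t ^ d / \<sigma> d \<le> 1 / real d" using sigpos[OF d] d by (simp add: field_simps)
    then show ?thesis unfolding bs[OF d] using t by simp
  qed
  show "b 1 = 1" using t unfolding b_def by (simp add: field_simps)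
qed

text \<open>Monsky's argument with finite sums: \<open>\<Sum>\<^sub>k c\<^sub>k t\<^sup>k\<close> with \<open>c\<^sub>k = \<Sum>\<^sub>d\<^sub>|\<^sub>k \<chi> d\<close> would stay bounded as \<open>t \<rightarrow> 1\<close>,
  although \<open>c\<^sub>k \<ge> 0\<close> and \<open>c\<^sub>k \<ge> 1\<close> at squares.\<close>
lemma L1_nonzero_real:
  assumes n: "n > 1" "\<chi> \<in> dchars n" "\<chi> \<noteq> trivial_char n" and re: "\<And>k. cnj (\<chi> k) = \<chi> k"
  shows "L1 \<chi> \<noteq> 0"
proof
  assume L: "L1 \<chi> = 0"
  define x where "x = (\<lambda>k. Re (\<chi> k))"
  have chi: "\<chi> k = of_real (x k)" for k using re[of k] by (simp add: x_def complex_eq_iff)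
  have x1: "x (a * b) = x a * x b" for a b
    using dchars_mult[OF n(2), of a b] unfolding chi by (metis of_real_eq_iff of_real_mult)
  have x2: "x 1 = 1" using dchars_one[OF n(2)] by (simp add: x_def)
  have x3: "x a \<in> {-1, 0, 1}" for a
    using norm_dchars[OF n(2), of a] n(1) unfolding chi by (auto split: if_splits)
  define c where "c = (\<lambda>k. \<Sum>d | d dvd k. x d)"
  have squares: "(\<Sum>j=1..J. (s ^ 2) ^ (j ^ 2)) \<le> 2 * real n" if s: "0 < s" "s < 1" for s :: real and J
  proof -
    define t where "t = s ^ 2"
    have t: "0 < t" "t < 1" using s by (auto simp: t_def power_less_one_iff)
    define b where "b = (\<lambda>d. 1 / (real d * (1 - t)) - t ^ d / (1 - t ^ d))"
    have w: "d > 0 \<Longrightarrow> b (Suc d) \<le> b d" "d > 0 \<Longrightarrow> 0 \<le> b d" "b 1 = 1" for d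
      unfolding b_def t_def by (fact monsky_weights[OF s])+
    \<comment> \<open>A truncated Lambert series. The first term comes from the sum of
      \<open>x d / d\<close>, which is small since \<open>L1 \<chi> = 0\<close>; the last comes from
      cutting the geometric series. Both vanish as \<open>N\<close> grows. The middle term
      \<open>2 * n\<close>, independent of \<open>t\<close>, is Abel summation against the weights
      \<open>b\<close> with \<open>b 1 = 1\<close>.\<close>
    have bound: "(\<Sum>k=1..N. c k * t ^ k) \<le> 2 * real n / real (Suc N) / (1 - t) + 2 * real n + real N * t ^ N / (1 - t)" for N
    proof -
      have "(\<Sum>k=1..N. c k * t ^ k) = (\<Sum>k=1..N. \<Sum>d | d dvd k. x d * t ^ k)"
        by (simp add: c_def sum_distrib_right)
      also have "\<dots> = (\<Sum>d=1..N. \<Sum>j=1..N div d. x d * t ^ (d * j))" by (rule sum_divisors_swap)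
      also have "\<dots> \<le> (\<Sum>d=1..N. x d * (t ^ d / (1 - t ^ d)) + t ^ N / (1 - t))"
      proof (rule sum_mono)
        fix d assume d: "d \<in> {1..N}"
        have td: "t ^ d < 1" using t d by (simp add: power_less_one_iff)
        have tdle: "t ^ d \<le> t" using power_decreasing[of 1 d t] t d by simp
        have "(\<Sum>j=1..N div d. t ^ (d * j)) = t ^ d / (1 - t ^ d) - t ^ (d * Suc (N div d)) / (1 - t ^ d)"
        proof -
          have "(1 - t ^ d) * (\<Sum>j=1..q. t ^ (d * j)) = t ^ d - t ^ (d * Suc q)" for q
          proof (induction q)
            case (Suc q)
            have "(1 - t ^ d) * (\<Sum>j=1..Suc q. t ^ (d * j)) =
                (1 - t ^ d) * (\<Sum>j=1..q. t ^ (d * j)) + (1 - t ^ d) * t ^ (d * Suc q)"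
              by (simp add: distrib_left)
            also have "\<dots> = t ^ d - t ^ d * t ^ (d * Suc q)" unfolding Suc by (simp add: algebra_simps)
            finally show ?case by (simp add: power_add)
          qed simp
          from this[of "N div d"] show ?thesis using td
            by (metis diff_divide_distrib diff_gt_0_iff_gt less_irrefl nonzero_mult_div_cancel_left)
        qed
        moreover have "t ^ (d * Suc (N div d)) / (1 - t ^ d) \<le> t ^ N / (1 - t)"
        proof (rule frac_le)
          show "t ^ (d * Suc (N div d)) \<le> t ^ N"
            by (rule power_decreasing) (use t d dividend_less_times_div[of d N] in auto)
        qed (use t tdle in auto)
        moreover have "0 \<le> t ^ (d * Suc (N div d)) / (1 - t ^ d)" using t td by simp
        \<comment> \<open>The cut-off part of the geometric series enters with the unknown sign of
          \<open>x d\<close>, hence the two-sided control of it; \<open>x d\<close> takes only the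
          values -1, 0 and 1.\<close>
        ultimately have "x d * (\<Sum>j=1..N div d. t ^ (d * j)) \<le> x d * (t ^ d / (1 - t ^ d)) + t ^ N / (1 - t)"
          using x3[of d] by auto
        then show "(\<Sum>j=1..N div d. x d * t ^ (d * j)) \<le> x d * (t ^ d / (1 - t ^ d)) + t ^ N / (1 - t)"
          by (simp add: sum_distrib_left)
      qed
      also have "\<dots> = (\<Sum>d=1..N. x d * (t ^ d / (1 - t ^ d))) + real N * t ^ N / (1 - t)"
        by (simp add: sum.distrib)
      also have "(\<Sum>d=1..N. x d * (t ^ d / (1 - t ^ d))) = (\<Sum>d=1..N. x d / real d) / (1 - t) - (\<Sum>d=1..N. x d * b d)"
        by (simp add: b_def sum_divide_distrib sum_subtractf[symmetric] algebra_simps)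
      also have "\<dots> \<le> 2 * real n / real (Suc N) / (1 - t) + 2 * real n"
      proof -
        have "(\<Sum>d=1..N. \<chi> d / of_nat d) = of_real (\<Sum>d=1..N. x d / real d)" by (simp add: chi)
        then have "\<bar>\<Sum>d=1..N. x d / real d\<bar> \<le> 2 * real n / real (Suc N)"
          using L1_sum_tail(2)[OF n, of N] L by (metis diff_zero norm_of_real)
        then have 1: "(\<Sum>d=1..N. x d / real d) / (1 - t) \<le> 2 * real n / real (Suc N) / (1 - t)"
          using t by (intro divide_right_mono) auto
        have "{0<..N} = {1..N}" by auto
        then have "norm (\<Sum>d=1..N. \<chi> d * of_real (b d)) \<le> 2 * real n * b (Suc 0)"
          using abel_summation_bound[OF norm_sum_dchars_le[OF n], of 0 b N] w(1,2) by simp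
        moreover have "(\<Sum>d=1..N. \<chi> d * of_real (b d)) = of_real (\<Sum>d=1..N. x d * b d)" by (simp add: chi)
        ultimately have "\<bar>\<Sum>d=1..N. x d * b d\<bar> \<le> 2 * real n"
          using w(3) by (metis One_nat_def mult_1_right norm_of_real)
        then show ?thesis using 1 by linarith
      qed
      finally show ?thesis by linarith
    qed
    have lim: "(\<lambda>N. 2 * real n / real (Suc N) / (1 - t) + 2 * real n + real N * t ^ N / (1 - t)) \<longlonglongrightarrow> 0 / (1 - t) + 2 * real n + 0 / (1 - t)"
    proof (intro tendsto_intros)
      show "(\<lambda>N. 2 * real n / real (Suc N)) \<longlonglongrightarrow> 0"
        by real_asymp
      show "(\<lambda>N. real N * t ^ N) \<longlonglongrightarrow> 0"
        using powser_times_n_limit_0[of t] t by simp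
    qed (use t in auto)
    have lower: "(\<Sum>j=1..J. t ^ (j ^ 2)) \<le> (\<Sum>k=1..N. c k * t ^ k)" if "N \<ge> J ^ 2" for N
    proof -
      have "(\<Sum>j=1..J. t ^ (j ^ 2)) \<le> (\<Sum>j=1..J. c (j ^ 2) * t ^ (j ^ 2))"
        using sum_dvd_real_char_nonneg(2)[OF x1 x2 x3] t
        by (intro sum_mono) (auto simp: c_def intro!: mult_right_le_one_le order.trans[OF _ mult_right_mono[of 1]])
      also have "\<dots> = (\<Sum>k\<in>(\<lambda>j. j ^ 2) ` {1..J}. c k * t ^ k)"
        by (subst sum.reindex) (auto simp: inj_on_def)
      also have "\<dots> \<le> (\<Sum>k=1..N. c k * t ^ k)"
      proof (rule sum_mono2)
        show "(\<lambda>j. j ^ 2) ` {1..J} \<subseteq> {1..N}"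
        proof
          fix k assume "k \<in> (\<lambda>j. j ^ 2) ` {1..J}"
          then obtain j where j: "k = j ^ 2" "1 \<le> j" "j \<le> J" by auto
          then have "j ^ 2 \<le> N" using power_mono[of j J 2] that by linarith
          moreover have "0 < j ^ 2" using j by simp
          ultimately show "k \<in> {1..N}" using j(1) by simp
        qed
      qed (use sum_dvd_real_char_nonneg(1)[OF x1 x2 x3] t in \<open>auto simp: c_def\<close>)
      finally show ?thesis .
    qed
    have "(\<Sum>j=1..J. t ^ (j ^ 2)) \<le> 2 * real n"
    proof -
      have "(\<Sum>j=1..J. t ^ (j ^ 2)) \<le> 0 / (1 - t) + 2 * real n + 0 / (1 - t)"
        by (rule LIMSEQ_le_const[OF lim], rule exI[of _ "J ^ 2"])
          (use lower bound in \<open>blast intro: order.trans\<close>)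
      then show ?thesis by simp
    qed
    then show ?thesis by (simp add: t_def)
  qed
  \<comment> \<open>As \<open>s\<close> tends to 1 the sum over \<open>J\<close> squares tends to
    \<open>J\<close>, so any \<open>J\<close> above \<open>2 * n\<close> gives the
    contradiction.\<close>
  define J where "J = 2 * n + 1"
  have "((\<lambda>s::real. \<Sum>j=1..J. (s ^ 2) ^ (j ^ 2)) \<longlongrightarrow> (\<Sum>j=1..J. (1 ^ 2) ^ (j ^ 2))) (at_left 1)"
    by (intro tendsto_intros)
  moreover have "eventually (\<lambda>s. (\<Sum>j=1..J. (s ^ 2) ^ (j ^ 2)) \<le> 2 * real n) (at_left (1::real))"
    using eventually_at_left_real[of 0 1] squares by (auto elim!: eventually_mono)
  ultimately have "(\<Sum>j=1..J. ((1::real) ^ 2) ^ (j ^ 2)) \<le> 2 * real n"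
    by (rule tendsto_upperbound) simp
  then show False by (simp add: J_def)
qed


section \<open>Mertens' theorem in residue classes\<close>

lemma mangoldt_sum_at_trivial:
  assumes n: "n > 0"
  shows "\<exists>C. \<forall>N>0. norm (mangoldt_sum_at (trivial_char n) N - of_real (ln (real N))) \<le> C"
proof -
  obtain C where C: "\<And>N. (\<Sum>k | k \<in> {1..N} \<and> \<not> prime k. mangoldt k / real k) \<le> C"
    using prime_powers_bound by blast
  \<comment> \<open>The trivial character drops the terms not coprime to \<open>n\<close>. Such a
    term is either at a non-prime, covered by \<open>C\<close>, or at a prime factor of
    \<open>n\<close>, covered by \<open>D\<close>.\<close>
  define D where "D = (\<Sum>p\<in>prime_factors n. mangoldt p / real p :: real)"
  have "norm (mangoldt_sum_at (trivial_char n) N - of_real (ln (real N))) \<le> 6 + (C + D)" if N: "N > 0" for N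
  proof -
    let ?f = "\<lambda>k. mangoldt k / real k :: real"
    have nn: "0 \<le> ?f k" for k using mangoldt_nonneg by simp
    define E where "E = (\<Sum>k | k \<in> {1..N} \<and> \<not> coprime k n. ?f k)"
    have "mangoldt_sum_at (trivial_char n) N = of_real (\<Sum>k=1..N. if coprime k n then ?f k else 0)"
      unfolding mangoldt_sum_at_def of_real_sum
      by (intro sum.cong) (auto simp: trivial_char_def)
    also have "(\<Sum>k=1..N. if coprime k n then ?f k else 0) = (\<Sum>k=1..N. ?f k) - E"
    proof -
      have "E = (\<Sum>k=1..N. if \<not> coprime k n then ?f k else 0)"
        unfolding E_def by (rule sum.inter_filter) simp
      then show ?thesis by (simp add: sum_subtractf[symmetric]) (intro sum.cong, auto)
    qed
    finally have "norm (mangoldt_sum_at (trivial_char n) N - of_real (ln (real N))) =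
        \<bar>(\<Sum>k=1..N. ?f k) - E - ln (real N)\<bar>"
      by (metis norm_of_real of_real_diff)
    moreover have "E \<ge> 0" unfolding E_def by (intro sum_nonneg nn)
    moreover have "E \<le> C + D"
    proof -
      let ?A = "{k. k \<in> {1..N} \<and> \<not> prime k}"
      have "E \<le> (\<Sum>k\<in>?A \<union> prime_factors n. ?f k)"
        unfolding E_def
      proof (rule sum_mono2)
        show "{k. k \<in> {1..N} \<and> \<not> coprime k n} \<subseteq> ?A \<union> prime_factors n"
          using n by (auto simp: prime_factors_dvd prime_imp_coprime)
      qed (use nn in auto)
      also have "\<dots> \<le> (\<Sum>k\<in>?A. ?f k) + D"
        unfolding D_def by (rule order.trans[OF _ order.refl], subst sum.union_disjoint) auto
      also have "\<dots> \<le> C + D" using C[of N] by simp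
      finally show ?thesis .
    qed
    moreover note mertens_first[OF N]
    ultimately show ?thesis by linarith
  qed
  then show ?thesis by blast
qed

text \<open>The coefficient of \<open>ln N\<close> in \<open>mangoldt_sum_at \<chi> N\<close>. The
  value -1 belongs to a hypothetical zero and is kept until such zeros are excluded.\<close>

definition main_coeff :: "nat \<Rightarrow> (nat \<Rightarrow> complex) \<Rightarrow> real" where
  "main_coeff n \<chi> = (if \<chi> = trivial_char n then 1 else if L1 \<chi> = 0 then -1 else 0)"

lemma mangoldt_sum_at_asymp:
  assumes n: "n > 1" and c: "\<chi> \<in> dchars n"
  shows "\<exists>C. \<forall>N>0. norm (mangoldt_sum_at \<chi> N -
    of_real (main_coeff n \<chi>) * of_real (ln (real N))) \<le> C"
proof -
  consider "\<chi> = trivial_char n" | "\<chi> \<noteq> trivial_char n" "L1 \<chi> = 0" | "\<chi> \<noteq> trivial_char n" "L1 \<chi> \<noteq> 0" by blast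
  then show ?thesis
  proof cases
    case 1
    then show ?thesis using mangoldt_sum_at_trivial[of n] n by (simp add: main_coeff_def)
  next
    case 2
    then show ?thesis using mangoldt_sum_at_L1_zero[OF n c 2] by (intro exI[of _ "2 * real n"]) (simp add: main_coeff_def)
  next
    case 3
    then show ?thesis using mangoldt_sum_at_bounded[OF n c 3] by (auto simp: main_coeff_def)
  qed
qed

lemma sum_cnj_dchars_mangoldt:
  assumes "n > 1" "coprime a n"
  shows "(\<Sum>\<chi>\<in>dchars n. cnj (\<chi> a) * mangoldt_sum_at \<chi> N) =
    of_real (real (totient n) * (\<Sum>k | k \<in> {1..N} \<and> [k = a] (mod n). mangoldt k / real k))"
proof -
  have "(\<Sum>\<chi>\<in>dchars n. cnj (\<chi> a) * mangoldt_sum_at \<chi> N) =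
      (\<Sum>k=1..N. (\<Sum>\<chi>\<in>dchars n. cnj (\<chi> a) * \<chi> k) * of_real (mangoldt k / real k))"
    unfolding mangoldt_sum_at_def sum_distrib_left sum_distrib_right
    by (subst sum.swap) (simp add: mult_ac)
  also have "\<dots> = (\<Sum>k=1..N. of_real (if [k = a] (mod n) then real (totient n) * (mangoldt k / real k) else 0))"
    by (rule sum.cong) (auto simp: dchars_orthogonality[OF assms])
  also have "\<dots> = of_real (real (totient n) * (\<Sum>k | k \<in> {1..N} \<and> [k = a] (mod n). mangoldt k / real k))"
    unfolding of_real_sum[symmetric] sum_distrib_left by (subst sum.inter_filter) auto
  finally show ?thesis .
qed

lemma choose_dchars_bounds:
  assumes n: "n > 1"
  obtains C :: "(nat \<Rightarrow> complex) \<Rightarrow> real" where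
    "\<And>\<chi> N. \<chi> \<in> dchars n \<Longrightarrow> N > 0 \<Longrightarrow>
      norm (mangoldt_sum_at \<chi> N - of_real (main_coeff n \<chi>) * of_real (ln (real N))) \<le> C \<chi>"
proof -
  have "\<forall>\<chi>\<in>dchars n. \<exists>C. \<forall>N>0.
      norm (mangoldt_sum_at \<chi> N - of_real (main_coeff n \<chi>) * of_real (ln (real N))) \<le> C"
    using mangoldt_sum_at_asymp[OF n] by (rule ballI)
  then obtain C where "\<forall>\<chi>\<in>dchars n. \<forall>N>0.
      norm (mangoldt_sum_at \<chi> N - of_real (main_coeff n \<chi>) * of_real (ln (real N))) \<le> C \<chi>"
    by (rule bchoice[THEN exE])
  then show ?thesis using that by blast
qed

text \<open>Real characters are settled already. For a complex one the conjugate is a second zero,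
  so the coefficients of \<open>ln N\<close> over all characters sum to at most 1 - 1 - 1 = -1. By
  orthogonality at \<open>a = 1\<close>, however, the sum over all characters is a non-negative sum
  of \<open>mangoldt k / k\<close>; this fails for large \<open>N\<close>.\<close>

lemma L1_nonzero:
  assumes n: "n > 1" and c: "\<chi> \<in> dchars n" "\<chi> \<noteq> trivial_char n"
  shows "L1 \<chi> \<noteq> 0"
proof
  assume L: "L1 \<chi> = 0"
  define \<chi>' where "\<chi>' = (\<lambda>k. cnj (\<chi> k))"
  have c': "\<chi>' \<in> dchars n" using cnj_dchars[OF c(1)] by (simp add: \<chi>'_def)
  have t': "\<chi>' \<noteq> trivial_char n"
  proof
    assume e: "\<chi>' = trivial_char n"
    have "\<chi> k = trivial_char n k" for k
      using fun_cong[OF e, of k] by (auto simp: \<chi>'_def trivial_char_def complex_cnj_cancel_iff split: if_splits)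
    then show False using c(2) by blast
  qed
  have ne: "\<chi>' \<noteq> \<chi>"
  proof
    assume "\<chi>' = \<chi>"
    then have "cnj (\<chi> k) = \<chi> k" for k unfolding \<chi>'_def by metis
    then show False using L1_nonzero_real[OF n c] L by blast
  qed
  have L': "L1 \<chi>' = 0"
  proof -
    have "(\<lambda>N. \<Sum>k=1..N. \<chi> k / of_nat k) \<longlonglongrightarrow> 0"
      using L1_sum_tail(1)[OF n c] L unfolding L1_def by (simp add: convergent_LIMSEQ_iff)
    then have "(\<lambda>N. cnj (\<Sum>k=1..N. \<chi> k / of_nat k)) \<longlonglongrightarrow> cnj 0" by (rule tendsto_cnj)
    then show ?thesis unfolding L1_def \<chi>'_def by (intro limI) simp
  qed
  obtain C where C: "\<And>\<psi> N. \<psi> \<in> dchars n \<Longrightarrow> N > 0 \<Longrightarrow> norm (mangoldt_sum_at \<psi> N -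
      of_real (main_coeff n \<psi>) * of_real (ln (real N))) \<le> C \<psi>"
    using choose_dchars_bounds[OF n] by blast
  let ?e = "main_coeff n"
  have fin: "finite (dchars n)" using finite_dchars n by simp
  have e: "(\<Sum>\<psi>\<in>dchars n. ?e \<psi>) \<le> -1"
  proof -
    have "(\<Sum>\<psi>\<in>dchars n. ?e \<psi>) \<le> (\<Sum>\<psi>\<in>dchars n. if \<psi> \<in> {trivial_char n, \<chi>, \<chi>'} then ?e \<psi> else 0)"
      by (rule sum_mono) (auto simp: main_coeff_def)
    also have "\<dots> = (\<Sum>\<psi>\<in>dchars n \<inter> {trivial_char n, \<chi>, \<chi>'}. ?e \<psi>)"
      using fin by (simp add: sum.If_cases Int_def)
    also have "dchars n \<inter> {trivial_char n, \<chi>, \<chi>'} = {trivial_char n, \<chi>, \<chi>'}"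
      using c c' trivial_char_in_dchars[of n] n by auto
    also have "(\<Sum>\<psi>\<in>\<dots>. ?e \<psi>) = -1" using c t' ne L L' by (simp add: main_coeff_def)
    finally show ?thesis .
  qed
  have le: "ln (real N) \<le> (\<Sum>\<psi>\<in>dchars n. C \<psi>)" if N: "N > 0" for N
  proof -
    have lnN: "0 \<le> ln (real N)" using N by simp
    have "0 \<le> Re (\<Sum>\<psi>\<in>dchars n. cnj (\<psi> 1) * mangoldt_sum_at \<psi> N)"
      unfolding sum_cnj_dchars_mangoldt[OF n coprime_1_left]
      by (simp add: sum_nonneg mangoldt_nonneg)
    also have "(\<Sum>\<psi>\<in>dchars n. cnj (\<psi> 1) * mangoldt_sum_at \<psi> N) = (\<Sum>\<psi>\<in>dchars n. mangoldt_sum_at \<psi> N)"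
      by (rule sum.cong) (simp_all add: dchars_one[unfolded One_nat_def])
    also have "Re \<dots> \<le> (\<Sum>\<psi>\<in>dchars n. C \<psi> + ?e \<psi> * ln (real N))"
      unfolding Re_sum
    proof (rule sum_mono)
      fix \<psi> assume "\<psi> \<in> dchars n"
      from C[OF this N] have "Re (mangoldt_sum_at \<psi> N - of_real (?e \<psi>) * of_real (ln (real N))) \<le> C \<psi>"
        using complex_Re_le_cmod order.trans by blast
      then show "Re (mangoldt_sum_at \<psi> N) \<le> C \<psi> + ?e \<psi> * ln (real N)"
        by (simp only: of_real_mult[symmetric] minus_complex.sel Re_complex_of_real)
    qed
    also have "\<dots> = (\<Sum>\<psi>\<in>dchars n. C \<psi>) + (\<Sum>\<psi>\<in>dchars n. ?e \<psi>) * ln (real N)"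
      unfolding sum.distrib sum_distrib_right ..
    also have "\<dots> \<le> (\<Sum>\<psi>\<in>dchars n. C \<psi>) + (-1) * ln (real N)"
      by (intro add_left_mono mult_right_mono e lnN)
    finally show ?thesis by simp
  qed
  have "filterlim (\<lambda>N::nat. ln (real N)) at_top at_top" by real_asymp
  then have "eventually (\<lambda>N::nat. ln (real N) > (\<Sum>\<psi>\<in>dchars n. C \<psi>)) at_top"
    by (simp add: filterlim_at_top_dense)
  then obtain N :: nat where "N > 0" "ln (real N) > (\<Sum>\<psi>\<in>dchars n. C \<psi>)"
    using eventually_happens'[OF sequentially_bot eventually_conj[OF eventually_gt_at_top[of 0]]] by blast
  then show False using le[of N] by linarith
qed

text \<open>Orthogonality expresses the class sum through the characters; as no L-series vanishes at
  1, only the trivial character contributes a logarithm.\<close>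

lemma mangoldt_sum_residue_class_ge:
  assumes n: "n > 1" and a: "coprime a n"
  shows "\<exists>C. \<forall>N>0. real (totient n) * (\<Sum>k | k \<in> {1..N} \<and> [k = a] (mod n). mangoldt k / real k) \<ge> ln (real N) - C"
proof -
  obtain C where C: "\<And>\<psi> N. \<psi> \<in> dchars n \<Longrightarrow> N > 0 \<Longrightarrow> norm (mangoldt_sum_at \<psi> N -
      of_real (main_coeff n \<psi>) * of_real (ln (real N))) \<le> C \<psi>"
    using choose_dchars_bounds[OF n] by blast
  have fin: "finite (dchars n)" using finite_dchars n by simp
  have tr: "trivial_char n \<in> dchars n" using trivial_char_in_dchars n by simp
  have "real (totient n) * (\<Sum>k | k \<in> {1..N} \<and> [k = a] (mod n). mangoldt k / real k)
      \<ge> ln (real N) - (\<Sum>\<psi>\<in>dchars n. C \<psi>)" if N: "N > 0" for N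
  proof -
    let ?m = "\<lambda>\<psi>. (if \<psi> = trivial_char n then 1 else 0) * complex_of_real (ln (real N))"
    have "(\<Sum>\<psi>\<in>dchars n. cnj (\<psi> a) * mangoldt_sum_at \<psi> N) - of_real (ln (real N)) =
        (\<Sum>\<psi>\<in>dchars n. cnj (\<psi> a) * (mangoldt_sum_at \<psi> N - ?m \<psi>))"
    proof -
      have "(\<Sum>\<psi>\<in>dchars n. cnj (\<psi> a) * ?m \<psi>) = (\<Sum>\<psi>\<in>dchars n. if \<psi> = trivial_char n then of_real (ln (real N)) else 0)"
        by (rule sum.cong) (use a in \<open>auto simp: trivial_char_def\<close>)
      also have "\<dots> = of_real (ln (real N))" using fin tr by simp
      finally show ?thesis by (simp only: right_diff_distrib sum_subtractf)
    qed
    also have "norm \<dots> \<le> (\<Sum>\<psi>\<in>dchars n. C \<psi>)"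
    proof (rule sum_norm_le)
      fix \<psi> assume p: "\<psi> \<in> dchars n"
      have "norm (mangoldt_sum_at \<psi> N - ?m \<psi>) \<le> C \<psi>"
        using C[OF p N] L1_nonzero[OF n p] by (cases "\<psi> = trivial_char n") (simp_all add: main_coeff_def)
      then have "norm (cnj (\<psi> a)) * norm (mangoldt_sum_at \<psi> N - ?m \<psi>) \<le> 1 * C \<psi>"
        by (intro mult_mono) (use norm_dchars_le[OF p] n in auto)
      then show "norm (cnj (\<psi> a) * (mangoldt_sum_at \<psi> N - ?m \<psi>)) \<le> C \<psi>"
        by (simp only: norm_mult mult_1)
    qed
    finally have "\<bar>real (totient n) * (\<Sum>k | k \<in> {1..N} \<and> [k = a] (mod n). mangoldt k / real k) - ln (real N)\<bar>
        \<le> (\<Sum>\<psi>\<in>dchars n. C \<psi>)"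
      unfolding sum_cnj_dchars_mangoldt[OF n a] by (simp only: of_real_diff[symmetric] norm_of_real)
    then show ?thesis by linarith
  qed
  then show ?thesis by blast
qed

text \<open>The classes in \<open>A\<close> are disjoint, so their lower bounds add up; discarding
  the non-prime terms costs a bounded amount. Only the lower bound matters, since the aim is a large
  divisor of a factorial.\<close>

theorem mertens_residue_classes:
  assumes n: "n > 1" and A: "A \<subseteq> totatives n"
  shows "\<exists>C. \<forall>N>0. (\<Sum>p | prime p \<and> p \<le> N \<and> p mod n \<in> A. ln (real p) / real p)
    \<ge> real (card A) / real (totient n) * ln (real N) - C"
proof -
  have fA: "finite A" using A finite_subset finite_totatives by blast
  have cop: "coprime a n" "a < n" if "a \<in> A" for a
    using A that n by (auto simp: totatives_def order.order_iff_strict)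
  have "\<forall>a\<in>A. \<exists>C. \<forall>N>0. real (totient n) * (\<Sum>k | k \<in> {1..N} \<and> [k = a] (mod n). mangoldt k / real k) \<ge> ln (real N) - C"
    using mangoldt_sum_residue_class_ge[OF n] cop by blast
  then obtain C where C: "\<And>a N. a \<in> A \<Longrightarrow> N > 0 \<Longrightarrow>
      real (totient n) * (\<Sum>k | k \<in> {1..N} \<and> [k = a] (mod n). mangoldt k / real k) \<ge> ln (real N) - C a"
    by metis
  obtain D where D: "\<And>N. (\<Sum>k | k \<in> {1..N} \<and> \<not> prime k. mangoldt k / real k) \<le> D"
    using prime_powers_bound by blast
  define t where "t = real (totient n)"
  have t: "t > 0" using n by (simp add: t_def)
  have "(\<Sum>p | prime p \<and> p \<le> N \<and> p mod n \<in> A. ln (real p) / real p)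
      \<ge> real (card A) / t * ln (real N) - ((\<Sum>a\<in>A. C a) / t + D)" if N: "N > 0" for N
  proof -
    let ?f = "\<lambda>k. mangoldt k / real k :: real"
    have nn: "0 \<le> ?f k" for k using mangoldt_nonneg by simp
    have "(\<Sum>a\<in>A. ln (real N) - C a) \<le> (\<Sum>a\<in>A. t * (\<Sum>k | k \<in> {1..N} \<and> [k = a] (mod n). ?f k))"
      unfolding t_def by (intro sum_mono C N)
    also have "\<dots> = t * (\<Sum>a\<in>A. \<Sum>k | k \<in> {1..N} \<and> [k = a] (mod n). ?f k)"
      by (rule sum_distrib_left[symmetric])
    also have "(\<Sum>a\<in>A. \<Sum>k | k \<in> {1..N} \<and> [k = a] (mod n). ?f k) = (\<Sum>k\<in>(\<Union>a\<in>A. {k. k \<in> {1..N} \<and> [k = a] (mod n)}). ?f k)"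
    proof (rule sum.UNION_disjoint[symmetric, OF fA])
      show "\<forall>a\<in>A. \<forall>b\<in>A. a \<noteq> b \<longrightarrow> {k. k \<in> {1..N} \<and> [k = a] (mod n)} \<inter> {k. k \<in> {1..N} \<and> [k = b] (mod n)} = {}"
        using cop by (auto simp: unique_euclidean_semiring_class.cong_def)
    qed auto
    also have "\<dots> \<le> (\<Sum>k\<in>{p. prime p \<and> p \<le> N \<and> p mod n \<in> A} \<union> {k. k \<in> {1..N} \<and> \<not> prime k}. ?f k)"
    proof (rule sum_mono2)
      show "(\<Union>a\<in>A. {k. k \<in> {1..N} \<and> [k = a] (mod n)}) \<subseteq>
          {p. prime p \<and> p \<le> N \<and> p mod n \<in> A} \<union> {k. k \<in> {1..N} \<and> \<not> prime k}"
        using cop by (auto simp: unique_euclidean_semiring_class.cong_def)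
    qed (use nn in auto)
    also have "\<dots> = (\<Sum>k | prime k \<and> k \<le> N \<and> k mod n \<in> A. ?f k) + (\<Sum>k | k \<in> {1..N} \<and> \<not> prime k. ?f k)"
      by (rule sum.union_disjoint) auto
    also have "(\<Sum>k | prime k \<and> k \<le> N \<and> k mod n \<in> A. ?f k) = (\<Sum>p | prime p \<and> p \<le> N \<and> p mod n \<in> A. ln (real p) / real p)"
      by (rule sum.cong) auto
    finally have "(\<Sum>a\<in>A. ln (real N) - C a) \<le>
        t * ((\<Sum>p | prime p \<and> p \<le> N \<and> p mod n \<in> A. ln (real p) / real p) + (\<Sum>k | k \<in> {1..N} \<and> \<not> prime k. ?f k))"
      using t by simp
    also have "\<dots> \<le> t * ((\<Sum>p | prime p \<and> p \<le> N \<and> p mod n \<in> A. ln (real p) / real p) + D)"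
      using t D[of N] by (intro mult_left_mono add_left_mono) auto
    finally show ?thesis using t by (simp add: sum_subtractf field_simps)
  qed
  then show ?thesis unfolding t_def by blast
qed


section \<open>Valuations detecting algebraic integers\<close>

text \<open>With \<open>d\<close> the dimension, the powers of \<open>y\<close> up to
  \<open>d\<close> are dependent. Linear algebra speaks about the set of these powers, so a
  coincidence of two powers is treated apart and yields a relation directly.\<close>

lemma number_field_relation:
  fixes y :: "'k::field_char_0"
  assumes "number_field TYPE('k)"
  shows "\<exists>d (q::nat \<Rightarrow> rat). (\<exists>i\<le>d. q i \<noteq> 0) \<and> (\<Sum>i\<le>d. of_rat (q i) * y ^ i) = 0"
proof -
  obtain B :: "'k set" where B: "finite_dimensional_vector_space (\<lambda>q x. of_rat q * x) B"
    using assms by (auto simp: number_field_def)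
  interpret vs: finite_dimensional_vector_space "\<lambda>q x. of_rat q * x :: 'k" B by (rule B)
  define d where "d = card B"
  show ?thesis
  proof (cases "inj_on (\<lambda>i. y ^ i) {..d}")
    case False
    then obtain i j where ij: "i \<le> d" "j \<le> d" "i \<noteq> j" "y ^ i = y ^ j" by (auto simp: inj_on_def)
    define q :: "nat \<Rightarrow> rat" where "q = (\<lambda>l. if l = i then 1 else if l = j then -1 else 0)"
    have "(\<Sum>l\<le>d. of_rat (q l) * y ^ l) = (\<Sum>l\<in>{i,j}. of_rat (q l) * y ^ l)"
      by (rule sum.mono_neutral_right) (use ij in \<open>auto simp: q_def\<close>)
    also have "\<dots> = 0" using ij by (simp add: q_def)
    finally show ?thesis using ij by (intro exI[of _ d] exI[of _ q]) (auto simp: q_def)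
  next
    case True
    let ?S = "(\<lambda>i. y ^ i) ` {..d}"
    have "card ?S = Suc d" using True by (simp add: card_image)
    then have "\<not> vs.independent ?S"
      using vs.independent_span_bound[of B ?S] vs.finite_Basis vs.span_Basis d_def by auto
    then obtain u where u: "\<exists>v\<in>?S. u v \<noteq> 0" "(\<Sum>v\<in>?S. of_rat (u v) * v) = 0"
      using vs.dependent_finite[of ?S] by auto
    have "(\<Sum>i\<le>d. of_rat (u (y ^ i)) * y ^ i) = 0"
      using u(2) by (simp add: sum.reindex[OF True])
    then show ?thesis using u(1) by (intro exI[of _ d] exI[of _ "\<lambda>i. u (y ^ i)"]) auto
  qed
qed

section \<open>Subrings and Chevalley's construction of valuation rings\<close>

definition is_subring :: "'k::field set \<Rightarrow> bool" where
  "is_subring B \<longleftrightarrow> 1 \<in> B \<and> (\<forall>x\<in>B. \<forall>y\<in>B. x - y \<in> B \<and> x * y \<in> B)"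

lemma is_subringD:
  assumes "is_subring B"
  shows subring_one: "1 \<in> B" and subring_zero: "0 \<in> B"
    and subring_diff: "x \<in> B \<Longrightarrow> y \<in> B \<Longrightarrow> x - y \<in> B"
    and subring_mult: "x \<in> B \<Longrightarrow> y \<in> B \<Longrightarrow> x * y \<in> B"
    and subring_uminus: "x \<in> B \<Longrightarrow> - x \<in> B"
    and subring_add: "x \<in> B \<Longrightarrow> y \<in> B \<Longrightarrow> x + y \<in> B"
proof -
  show 1: "1 \<in> B" and d: "x \<in> B \<Longrightarrow> y \<in> B \<Longrightarrow> x - y \<in> B"
    and "x \<in> B \<Longrightarrow> y \<in> B \<Longrightarrow> x * y \<in> B" for x y
    using assms unfolding is_subring_def by auto
  show 0: "0 \<in> B" using d[OF 1 1] by simp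
  show u: "x \<in> B \<Longrightarrow> - x \<in> B" for x using d[OF 0, of x] by simp
  show "x \<in> B \<Longrightarrow> y \<in> B \<Longrightarrow> x + y \<in> B" for x y using d[OF _ u, of x y] by simp
qed

lemma subring_sum:
  assumes "is_subring B" "\<And>i. i \<in> I \<Longrightarrow> f i \<in> B" shows "sum f I \<in> B"
  using assms(2) by (induction I rule: infinite_finite_induct)
    (auto intro: subring_zero[OF assms(1)] subring_add[OF assms(1)])

lemma subring_power: "is_subring B \<Longrightarrow> x \<in> B \<Longrightarrow> x ^ k \<in> B"
  by (induction k) (auto intro: subring_one subring_mult)

lemma subring_of_nat: "is_subring B \<Longrightarrow> of_nat k \<in> B"
  by (induction k) (auto intro: subring_one subring_zero subring_add)

lemma subring_of_int: "is_subring B \<Longrightarrow> of_int k \<in> B"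
  by (cases k) (simp_all add: subring_of_nat subring_uminus del: of_nat_Suc)

definition adjoin :: "'k::field set \<Rightarrow> 'k \<Rightarrow> 'k set" where
  "adjoin B y = {poly p y | p. \<forall>i. Polynomial.coeff p i \<in> B}"

lemma adjoinI: "\<forall>i. Polynomial.coeff p i \<in> B \<Longrightarrow> poly p y \<in> adjoin B y"
  by (auto simp: adjoin_def)

lemma adjoin_subring:
  assumes B: "is_subring B" shows "is_subring (adjoin B y)"
  unfolding is_subring_def
proof (intro conjI ballI)
  show "1 \<in> adjoin B y"
    using adjoinI[of 1 B y] subring_one[OF B] subring_zero[OF B] by (simp add: coeff_1)
  fix a b assume "a \<in> adjoin B y" "b \<in> adjoin B y"
  then obtain p q where p: "a = poly p y" "\<forall>i. Polynomial.coeff p i \<in> B" and q: "b = poly q y" "\<forall>i. Polynomial.coeff q i \<in> B"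
    by (auto simp: adjoin_def)
  show "a - b \<in> adjoin B y"
    using adjoinI[of "p - q" B y] p q subring_diff[OF B] by simp
  show "a * b \<in> adjoin B y"
  proof -
    have "Polynomial.coeff (p * q) i \<in> B" for i
      unfolding coeff_mult using p(2) q(2) by (intro subring_sum[OF B] subring_mult[OF B]) auto
    then show ?thesis using adjoinI[of "p * q" B y] p(1) q(1) by simp
  qed
qed

lemma subset_adjoin: assumes "is_subring B" shows "B \<subseteq> adjoin B y"
proof
  fix b assume "b \<in> B"
  then show "b \<in> adjoin B y"
    using adjoinI[of "[:b:]" B y] subring_zero[OF assms] by (simp add: coeff_pCons split: nat.split)
qed

lemma mem_adjoin: assumes "is_subring B" shows "y \<in> adjoin B y"
  using adjoinI[of "[:0, 1:]" B y] subring_zero[OF assms] subring_one[OF assms]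
  by (simp add: coeff_pCons split: nat.split)

text \<open>An expression of \<open>x\<close> as an integral polynomial in \<open>inverse x\<close>
  becomes a monic integral equation for \<open>x\<close> after multiplication by a power of
  \<open>x\<close>.\<close>

lemma not_algebraic_int_inverse:
  fixes x :: "'k::field_char_0"
  assumes "\<not> algebraic_int x" shows "x \<notin> adjoin \<int> (inverse x)"
proof
  assume "x \<in> adjoin \<int> (inverse x)"
  then obtain p where p: "x = poly p (inverse x)" "\<forall>i. Polynomial.coeff p i \<in> \<int>" by (auto simp: adjoin_def)
  have x0: "x \<noteq> 0" using assms by auto
  define n where "n = degree p"
  define q where "q = Polynomial.monom 1 (Suc n) - (\<Sum>i\<le>n. Polynomial.monom (Polynomial.coeff p i) (n - i))"
  have "poly q x = x ^ Suc n - (\<Sum>i\<le>n. Polynomial.coeff p i * x ^ (n - i))"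
    by (simp add: q_def poly_monom poly_sum)
  also have "(\<Sum>i\<le>n. Polynomial.coeff p i * x ^ (n - i)) = x ^ n * poly p (inverse x)"
    unfolding poly_altdef n_def[symmetric] sum_distrib_left
  proof (rule sum.cong[OF refl])
    fix i assume "i \<in> {..n}"
    then have "x ^ n = x ^ (n - i) * x ^ i" by (simp add: power_add[symmetric])
    then show "Polynomial.coeff p i * x ^ (n - i) = x ^ n * (Polynomial.coeff p i * inverse x ^ i)"
      using x0 by (simp add: field_simps)
  qed
  finally have "poly q x = 0" using p(1) by simp
  moreover have c: "Polynomial.coeff q i \<in> \<int>" for i
    unfolding q_def by (auto simp: coeff_sum intro!: Ints_diff Ints_sum simp: p(2))
  moreover have "lead_coeff q = 1"
  proof -
    have "Polynomial.coeff (\<Sum>i\<le>n. Polynomial.monom (Polynomial.coeff p i) (n - i)) j = 0" if "j > n" for j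
      using that by (auto simp: coeff_sum intro!: sum.neutral)
    then have "Polynomial.coeff q (Suc n) = 1" "\<forall>j>Suc n. Polynomial.coeff q j = 0" by (auto simp: q_def)
    then have "degree q = Suc n" by (intro antisym degree_le le_degree) auto
    then show ?thesis using \<open>Polynomial.coeff q (Suc n) = 1\<close> by simp
  qed
  ultimately show False using assms algebraic_int.intros[of q x] by blast
qed

lemma is_subring_Ints: "is_subring (\<int> :: 'k::field_char_0 set)"
  by (auto simp: is_subring_def)

text \<open>Zorn's lemma, started at the ring generated by \<open>inverse x\<close>, which omits
  \<open>x\<close> because \<open>x\<close> is not integral.\<close>

lemma maximal_subring_avoiding:
  fixes x :: "'k::field_char_0"
  assumes "\<not> algebraic_int x"
  obtains B where "is_subring B" "inverse x \<in> B" "x \<notin> B"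
    "\<And>C. is_subring C \<Longrightarrow> B \<subseteq> C \<Longrightarrow> x \<notin> C \<Longrightarrow> C = B"
proof -
  let ?F = "{B. is_subring B \<and> inverse x \<in> B \<and> x \<notin> B}"
  have "\<exists>M\<in>?F. \<forall>X\<in>?F. M \<subseteq> X \<longrightarrow> X = M"
  proof (rule subset_Zorn_nonempty)
    show "?F \<noteq> {}"
      using adjoin_subring[OF is_subring_Ints, of "inverse x"] not_algebraic_int_inverse[OF assms]
        mem_adjoin[OF is_subring_Ints, of "inverse x"] by blast
  next
    fix \<C> assume C: "\<C> \<noteq> {}" "subset.chain ?F \<C>"
    have sub: "\<C> \<subseteq> ?F" and tot: "\<And>X Y. X \<in> \<C> \<Longrightarrow> Y \<in> \<C> \<Longrightarrow> X \<subseteq> Y \<or> Y \<subseteq> X"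
      using C(2) by (auto simp: subset.chain_def)
    have "is_subring (\<Union>\<C>)"
      unfolding is_subring_def
    proof (intro conjI ballI)
      show "1 \<in> \<Union>\<C>" using C(1) sub subring_one by blast
      fix a b assume "a \<in> \<Union>\<C>" "b \<in> \<Union>\<C>"
      then obtain X Y where "X \<in> \<C>" "a \<in> X" "Y \<in> \<C>" "b \<in> Y" by blast
      then obtain Z where Z: "Z \<in> \<C>" "a \<in> Z" "b \<in> Z" using tot by blast
      then have "is_subring Z" using sub by blast
      then show "a - b \<in> \<Union>\<C>" "a * b \<in> \<Union>\<C>" using Z subring_diff subring_mult by blast+
    qed
    then show "\<Union>\<C> \<in> ?F" using C(1) sub by blast
  qed
  then obtain M where M: "M \<in> ?F" "\<forall>X\<in>?F. M \<subseteq> X \<longrightarrow> X = M" by blast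
  show ?thesis
  proof (rule that[of M])
    fix C assume "is_subring C" "M \<subseteq> C" "x \<notin> C"
    then show "C = M" using M by blast
  qed (use M in auto)
qed

text \<open>Chevalley's argument. If neither \<open>y\<close> nor \<open>inverse y\<close> lay in
  \<open>B\<close>, maximality would make \<open>x\<close> a polynomial over \<open>B\<close> in
  each of them. With both degrees minimal, the relation of smaller degree removes the leading term
  of the other one, contradicting minimality.\<close>

lemma maximal_subring_valuation:
  fixes x :: "'k::field_char_0"
  assumes B: "is_subring B" and u: "inverse x \<in> B" and x: "x \<notin> B"
    and max: "\<And>C. is_subring C \<Longrightarrow> B \<subseteq> C \<Longrightarrow> x \<notin> C \<Longrightarrow> C = B"
    and y: "y \<noteq> 0"
  shows "y \<in> B \<or> inverse y \<in> B"
proof (rule ccontr)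
  assume neg: "\<not> (y \<in> B \<or> inverse y \<in> B)"
  have x0: "x \<noteq> 0" using x subring_zero[OF B] by blast
  have xadj: "x \<in> adjoin B z" if "z \<notin> B" for z
    using max[OF adjoin_subring[OF B] subset_adjoin[OF B], of z] mem_adjoin[OF B, of z] that by blast
  define P where "P = (\<lambda>z n. \<exists>p. (\<forall>i. Polynomial.coeff p i \<in> B) \<and> degree p \<le> n \<and> poly p z = x)"
  have P: "\<exists>n. P z n" if "z \<notin> B" for z using xadj[OF that] by (auto simp: adjoin_def P_def)
  have P0: "\<not> P z 0" for z
  proof
    assume "P z 0"
    then obtain p where "\<forall>i. Polynomial.coeff p i \<in> B" "degree p = 0" "poly p z = x" by (auto simp: P_def)
    then show False using x by (auto elim!: degree_eq_zeroE) (metis coeff_pCons_0)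
  qed
  \<comment> \<open>This says that \<open>inverse x\<close> lies in the Jacobson radical of
    \<open>B\<close>. If \<open>s = 1 - inverse x * c\<close> had no inverse in \<open>B\<close>,
    then \<open>x\<close> would be a polynomial in \<open>inverse s\<close>; multiplied by a power
    of \<open>s\<close>, which is again 1 minus a multiple of \<open>inverse x\<close>, this puts
    \<open>x\<close> itself into \<open>B\<close>.\<close>
  have unit: "inverse (1 - inverse x * c) \<in> B" if c: "c \<in> B" for c
  proof (rule ccontr)
    define s where "s = 1 - inverse x * c"
    assume "inverse (1 - inverse x * c) \<notin> B"
    then have "inverse s \<notin> B" by (simp add: s_def)
    then obtain p where p: "\<forall>i. Polynomial.coeff p i \<in> B" "x = poly p (inverse s)"
      using xadj by (auto simp: adjoin_def)
    have s0: "s \<noteq> 0" using \<open>inverse s \<notin> B\<close> subring_zero[OF B] by auto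
    have sB: "s \<in> B" unfolding s_def using B u c by (intro subring_diff subring_one subring_mult)
    have "\<exists>e\<in>B. s ^ k = 1 - inverse x * e" for k
    proof (induction k)
      case 0 show ?case using subring_zero[OF B] by (intro bexI[of _ 0]) auto
    next
      case (Suc k)
      then obtain e where e: "e \<in> B" "s ^ k = 1 - inverse x * e" by blast
      have "s ^ Suc k = s * (1 - inverse x * e)" by (simp add: e(2))
      also have "\<dots> = 1 - inverse x * (c + e - inverse x * c * e)"
        by (simp add: s_def algebra_simps)
      finally have "s ^ Suc k = 1 - inverse x * (c + e - inverse x * c * e)" .
      moreover have "c + e - inverse x * c * e \<in> B"
        using B u c e by (intro subring_diff subring_add subring_mult)
      ultimately show ?case by blast
    qed
    then obtain e where e: "e \<in> B" "s ^ degree p = 1 - inverse x * e" by blast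
    have "x * s ^ degree p = (\<Sum>i\<le>degree p. Polynomial.coeff p i * s ^ (degree p - i))"
      unfolding p(2) poly_altdef sum_distrib_right
    proof (rule sum.cong[OF refl])
      fix i assume "i \<in> {..degree p}"
      then have "s ^ degree p = s ^ (degree p - i) * s ^ i" by (simp add: power_add[symmetric])
      then show "Polynomial.coeff p i * inverse s ^ i * s ^ degree p = Polynomial.coeff p i * s ^ (degree p - i)"
        using s0 by (simp add: field_simps)
    qed
    also have "\<dots> \<in> B"
      using B sB p(1) by (intro subring_sum subring_mult subring_power) auto
    finally have "x * (1 - inverse x * e) + e \<in> B" unfolding e(2)[symmetric] using e(1) B by (intro subring_add)
    then show False using x x0 by (simp add: algebra_simps)
  qed
  have reduce: False
    if zw: "z * w = 1" "z \<notin> B" and Pz: "P z n" "\<And>k. k < n \<Longrightarrow> \<not> P z k"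
      and Pw: "P w m" "m \<le> n" for z w n m
  proof -
    obtain p where p: "\<forall>i. Polynomial.coeff p i \<in> B" "degree p \<le> n" "poly p z = x" using Pz(1) by (auto simp: P_def)
    obtain q where q: "\<forall>i. Polynomial.coeff q i \<in> B" "degree q \<le> m" "poly q w = x" using Pw(1) by (auto simp: P_def)
    have n0: "n > 0" using Pz(1) P0 by (cases n) auto
    define s where "s = 1 - inverse x * Polynomial.coeff q 0"
    have sinv: "inverse s \<in> B" using unit q(1) by (simp add: s_def)
    have s0: "s \<noteq> 0"
    proof
      assume "s = 0"
      then have "x = Polynomial.coeff q 0" using x0 by (simp add: s_def field_simps)
      then show False using x q(1) by metis
    qed
    \<comment> \<open>The relation for \<open>w\<close>, solved for
      \<open>x - coeff q 0 = x * s\<close> and multiplied by \<open>z ^ n\<close>, expresses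
      \<open>z ^ n\<close> as a polynomial in \<open>z\<close> of smaller degree;
      \<open>m \<le> n\<close> keeps the exponents \<open>n - j\<close> non-negative, and
      \<open>s\<close> is a unit.\<close>
    define r where "r = (\<Sum>j\<in>{1..m}. Polynomial.monom (inverse s * inverse x * Polynomial.coeff q j) (n - j))"
    have rB: "Polynomial.coeff r i \<in> B" for i
      unfolding r_def coeff_sum using sinv u q(1) subring_zero[OF B]
      by (intro subring_sum[OF B]) (auto intro!: subring_mult[OF B])
    have rdeg: "Polynomial.coeff r i = 0" if "i \<ge> n" for i
      unfolding r_def coeff_sum using that n0 by (intro sum.neutral) auto
    have "poly r z = z ^ n"
    proof -
      have zn: "z ^ (n - j) = z ^ n * w ^ j" if "j \<le> m" for j
      proof -
        have "z ^ n = z ^ (n - j) * z ^ j" using that Pw(2) by (simp add: power_add[symmetric])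
        then have "z ^ n * w ^ j = z ^ (n - j) * (z * w) ^ j" by (simp add: power_mult_distrib)
        then show ?thesis using zw by simp
      qed
      have "poly r z = (\<Sum>j\<in>{1..m}. inverse s * inverse x * z ^ n * (Polynomial.coeff q j * w ^ j))"
        unfolding r_def poly_sum poly_monom by (intro sum.cong refl) (simp add: zn)
      also have "\<dots> = inverse s * inverse x * z ^ n * (\<Sum>j\<in>{1..m}. Polynomial.coeff q j * w ^ j)"
        by (rule sum_distrib_left[symmetric])
      also have "(\<Sum>j\<in>{1..m}. Polynomial.coeff q j * w ^ j) = x - Polynomial.coeff q 0"
      proof -
        have "x = (\<Sum>j\<le>m. Polynomial.coeff q j * w ^ j)"
          using q(2,3) by (subst q(3)[symmetric], subst poly_altdef) (intro sum.mono_neutral_left, auto simp: coeff_eq_0)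
        also have "\<dots> = Polynomial.coeff q 0 + (\<Sum>j\<in>{1..m}. Polynomial.coeff q j * w ^ j)"
          by (simp add: atMost_atLeast0 sum.atLeast_Suc_atMost)
        finally show ?thesis by simp
      qed
      also have "inverse s * inverse x * z ^ n * (x - Polynomial.coeff q 0) = inverse s * s * z ^ n"
        using x0 by (simp add: s_def field_simps)
      finally show ?thesis using s0 by simp
    qed
    define p' where "p' = p - Polynomial.monom (Polynomial.coeff p n) n + Polynomial.smult (Polynomial.coeff p n) r"
    have "Polynomial.coeff p' i \<in> B" for i
      using p(1) rB subring_zero[OF B] unfolding p'_def
      by (auto intro!: subring_add[OF B] subring_diff[OF B] subring_mult[OF B])
    moreover have "Polynomial.coeff p' i = 0" if "i > n - 1" for i
    proof -
      have "i \<ge> n" using that n0 by simp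
      then show ?thesis using p(2) rdeg by (auto simp: p'_def coeff_eq_0)
    qed
    then have "degree p' \<le> n - 1" by (intro degree_le) auto
    moreover have "poly p' z = x" using p(3) \<open>poly r z = z ^ n\<close> by (simp add: p'_def poly_monom)
    ultimately have "P z (n - 1)" unfolding P_def by blast
    then show False using Pz(2)[of "n - 1"] n0 by simp
  qed
  define n where "n = (LEAST n. P y n)"
  define m where "m = (LEAST n. P (inverse y) n)"
  have n: "P y n" "\<And>k. k < n \<Longrightarrow> \<not> P y k"
    using P[of y] neg unfolding n_def by (auto intro: LeastI_ex dest: not_less_Least)
  have m: "P (inverse y) m" "\<And>k. k < m \<Longrightarrow> \<not> P (inverse y) k"
    using P[of "inverse y"] neg unfolding m_def by (auto intro: LeastI_ex dest: not_less_Least)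
  show False
  proof (cases "m \<le> n")
    case True
    then show False using reduce[of y "inverse y" n m] n m neg y by simp
  next
    case False
    then show False using reduce[of "inverse y" y m n] n m neg y by simp
  qed
qed


section \<open>From a valuation ring to an absolute value extending the p-adic one\<close>

definition ring_unit :: "'k::field set \<Rightarrow> 'k \<Rightarrow> bool" where
  "ring_unit B b \<longleftrightarrow> b \<noteq> 0 \<and> b \<in> B \<and> inverse b \<in> B"

lemma ring_unit_mult: "is_subring B \<Longrightarrow> ring_unit B a \<Longrightarrow> ring_unit B b \<Longrightarrow> ring_unit B (a * b)"
  by (auto simp: ring_unit_def subring_mult)

lemma ring_unit_inverse: "ring_unit B a \<Longrightarrow> ring_unit B (inverse a)"
  by (auto simp: ring_unit_def)

lemma ring_unit_one: "is_subring B \<Longrightarrow> ring_unit B 1"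
  by (auto simp: ring_unit_def subring_one)

lemma ring_unit_power: "is_subring B \<Longrightarrow> ring_unit B a \<Longrightarrow> ring_unit B (a ^ k)"
  by (induction k) (auto intro: ring_unit_one ring_unit_mult)

lemma ring_unit_uminus: "is_subring B \<Longrightarrow> ring_unit B (- a) \<longleftrightarrow> ring_unit B a"
  using subring_uminus[of B a] subring_uminus[of B "- a"]
    subring_uminus[of B "inverse a"] subring_uminus[of B "- inverse a"]
  by (auto simp: ring_unit_def)

text \<open>The prime \<open>p\<close> lies in the maximal ideal of the valuation ring
  \<open>B\<close>. Over a number field the value of every non-zero element is then a rational
  multiple of that of \<open>p\<close>, so \<open>B\<close> comes from a real-valued absolute
  value.\<close>

locale padic_valuation_ring =
  fixes B :: "'k::field_char_0 set" and p :: nat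
  assumes nf: "number_field TYPE('k)"
    and subring: "is_subring B"
    and valuation: "\<And>y. y \<noteq> 0 \<Longrightarrow> y \<in> B \<or> inverse y \<in> B"
    and prime: "prime p"
    and p_nonunit: "inverse (of_nat p) \<notin> B"
begin

lemma p_pos: "p > 0" using prime prime_gt_0_nat by blast

lemma p_gt_1: "real p > 1" using prime prime_gt_1_nat by force

lemma of_nat_p_nonzero: "(of_nat p :: 'k) \<noteq> 0" using p_pos by simp

lemma unit_power_int_p_iff: "ring_unit B (of_nat p powi e) \<longleftrightarrow> e = 0"
proof
  assume u: "ring_unit B (of_nat p powi e)"
  have no: "\<not> ring_unit B (of_nat p ^ Suc j)" for j
  proof
    assume "ring_unit B (of_nat p ^ Suc j)"
    then have "of_nat p ^ j * inverse (of_nat p ^ Suc j) \<in> B"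
      by (intro subring_mult[OF subring] subring_power[OF subring] subring_of_nat[OF subring]) (simp add: ring_unit_def)
    then show False using p_nonunit of_nat_p_nonzero by (simp add: field_simps)
  qed
  show "e = 0"
  proof (rule ccontr)
    assume "e \<noteq> 0"
    then obtain j where "e = int (Suc j) \<or> e = - int (Suc j)"
      by (metis int_cases3 Suc_pred)
    then have "ring_unit B (of_nat p ^ Suc j)"
      using u ring_unit_inverse[OF u] by (auto simp: power_int_minus simp del: of_nat_Suc power_Suc)
    then show False using no by blast
  qed
qed (simp add: ring_unit_one subring)

text \<open>In a Bezout relation between \<open>p\<close> and \<open>N\<close>, one of the quotients
  \<open>N / p\<close> and \<open>p / N\<close> lies in \<open>B\<close>. The first case would
  invert \<open>p\<close>, which is excluded; the second inverts \<open>N\<close>.\<close>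

lemma unit_of_int_coprime:
  assumes "\<not> int p dvd N" shows "ring_unit B (of_int N)"
proof (rule ccontr)
  assume nu: "\<not> ring_unit B (of_int N)"
  have N0: "N \<noteq> 0" using assms by auto
  then have inv: "inverse (of_int N) \<notin> B" using nu by (auto simp: ring_unit_def subring_of_int[OF subring])
  have "coprime (int p) N" using assms prime by (simp add: prime_imp_coprime)
  then obtain a b where ab: "a * int p + b * N = 1" by (metis bezout_int coprime_imp_gcd_eq_1)
  have ab': "of_int a * of_nat p + of_int b * of_int N = (1::'k)"
    using arg_cong[OF ab, of "of_int :: int \<Rightarrow> 'k"] by simp
  have r: "inverse w \<in> B" if w: "of_int c * w' + of_int d * w = (1::'k)" "w \<noteq> 0" "w' / w \<in> B" for c d w w'
  proof -
    have "inverse w = of_int c * (w' / w) + of_int d" using w(1,2) by (simp add: field_simps)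
    also have "\<dots> \<in> B" using w(3) by (intro subring_add[OF subring] subring_mult[OF subring] subring_of_int[OF subring])
    finally show ?thesis .
  qed
  have "of_int N / of_nat p \<in> B \<or> of_nat p / (of_int N :: 'k) \<in> B"
    using valuation[of "of_int N / of_nat p"] N0 of_nat_p_nonzero by simp
  then show False
  proof
    assume "of_int N / of_nat p \<in> B"
    then show False using r[of b "of_int N" a "of_nat p"] ab' of_nat_p_nonzero p_nonunit by (simp add: add.commute)
  next
    assume "of_nat p / (of_int N :: 'k) \<in> B"
    then show False using r[of a "of_nat p" b "of_int N"] ab' N0 inv by simp
  qed
qed

lemma unit_of_rat:
  assumes "q \<noteq> 0"
  shows "ring_unit B (of_rat q * of_nat p powi - (int (multiplicity (int p) (fst (quotient_of q)))
                        - int (multiplicity (int p) (snd (quotient_of q)))))"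
proof -
  obtain a b where ab: "quotient_of q = (a, b)" by (cases "quotient_of q")
  have q: "q = of_int a / of_int b" "b > 0" using quotient_of_div[OF ab] quotient_of_denom_pos[OF ab] by auto
  have a0: "a \<noteq> 0" using q assms by auto
  have np: "\<not> is_unit (int p)" using p_gt_1 by simp
  obtain a' where a': "a = int p ^ multiplicity (int p) a * a'" "\<not> int p dvd a'"
    using multiplicity_decompose'[OF a0 np] by blast
  obtain b' where b': "b = int p ^ multiplicity (int p) b * b'" "\<not> int p dvd b'"
    using multiplicity_decompose'[of b "int p"] q(2) np by auto
  define i j where "i = multiplicity (int p) a" and "j = multiplicity (int p) b"
  have "b' \<noteq> 0" using b' by auto
  have A: "of_int a = (of_nat p ^ i * of_int a' :: 'k)" using arg_cong[OF a'(1), of "of_int :: int \<Rightarrow> 'k"] by (simp add: i_def)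
  have Bq: "of_int b = (of_nat p ^ j * of_int b' :: 'k)" using arg_cong[OF b'(1), of "of_int :: int \<Rightarrow> 'k"] by (simp add: j_def)
  have "of_rat q * of_nat p powi - (int i - int j) = of_int a' * inverse (of_int b' :: 'k)"
    unfolding q(1) using of_nat_p_nonzero \<open>b' \<noteq> 0\<close>
    by (simp add: of_rat_divide A Bq power_int_diff field_simps)
  also have "ring_unit B \<dots>"
    using unit_of_int_coprime[OF a'(2)] unit_of_int_coprime[OF b'(2)]
    by (intro ring_unit_mult[OF subring] ring_unit_inverse)
  finally show ?thesis by (simp add: ab i_def j_def)
qed

text \<open>In a vanishing sum the least value is attained twice. Otherwise, after division by the
  term of least value, all other terms are non-units of \<open>B\<close>; non-units are closed under
  addition, but these add up to -1.\<close>

lemma unit_of_sum_zero: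
  assumes S: "finite S" "(\<Sum>i\<in>S. f i) = 0" "\<exists>i\<in>S. f i \<noteq> 0"
  shows "\<exists>i\<in>S. \<exists>j\<in>S. i \<noteq> j \<and> f i \<noteq> 0 \<and> f j \<noteq> 0 \<and> ring_unit B (f i / f j)"
proof (rule ccontr)
  assume neg: "\<not> ?thesis"
  define T where "T = {i\<in>S. f i \<noteq> 0}"
  have T: "finite T" "T \<noteq> {}" using S by (auto simp: T_def)
  have fT: "f i \<noteq> 0" if "i \<in> T" for i using that by (simp add: T_def)
  have min: "\<exists>i\<in>X. \<forall>j\<in>X. f j / f i \<in> B" if "finite X" "X \<noteq> {}" "X \<subseteq> T" for X
    using that
  proof (induction X rule: finite_ne_induct)
    case (singleton a)
    then show ?case using fT subring_one[OF subring] by simp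
  next
    case (insert a X)
    then obtain i where i: "i \<in> X" "\<forall>j\<in>X. f j / f i \<in> B" by blast
    have nz: "f i \<noteq> 0" "f a \<noteq> 0" using i insert fT by auto
    show ?case
    proof (cases "f a / f i \<in> B")
      case True
      then show ?thesis using i by blast
    next
      case False
      then have *: "f i / f a \<in> B" using valuation[of "f a / f i"] nz by simp
      have "f j / f a \<in> B" if "j \<in> X" for j
      proof -
        have "f j / f a = (f j / f i) * (f i / f a)" using nz by simp
        then show ?thesis using * i that subring_mult[OF subring] by metis
      qed
      then show ?thesis using nz subring_one[OF subring] by (intro bexI[of _ a]) auto
    qed
  qed
  from min[OF T] obtain i where i: "i \<in> T" "\<forall>j\<in>T. f j / f i \<in> B" by blast
  have sum0: "(\<Sum>j\<in>T. f j) = 0"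
  proof -
    have "(\<Sum>j\<in>T. f j) = (\<Sum>j\<in>S. f j)"
      by (rule sum.mono_neutral_left) (use S(1) in \<open>auto simp: T_def\<close>)
    then show ?thesis using S(2) by simp
  qed
  have "inverse (f j / f i) \<notin> B" if "j \<in> T" "j \<noteq> i" for j
  proof
    assume "inverse (f j / f i) \<in> B"
    then have "ring_unit B (f j / f i)" using i that fT by (auto simp: ring_unit_def)
    then show False using neg i(1) that unfolding T_def by blast
  qed
  then have nonunit: "\<not> ring_unit B (f j / f i)" if "j \<in> T" "j \<noteq> i" for j
    using that by (auto simp: ring_unit_def)
  have nu_add: "\<not> ring_unit B (a + b)" if "a \<in> B" "b \<in> B" "\<not> ring_unit B a" "\<not> ring_unit B b" for a b
  proof
    assume u: "ring_unit B (a + b)"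
    have one: "a * inverse (a + b) + b * inverse (a + b) = 1"
      using u by (simp add: ring_unit_def distrib_right[symmetric])
    have key: False if "c \<in> B" "\<not> ring_unit B c" "d / c \<in> B" "c \<noteq> 0" "c * w + d * w = 1" "w \<in> B" for c d w
    proof -
      have "inverse c = w + (d / c) * w" using that(4,5) by (simp add: field_simps)
      also have "\<dots> \<in> B" by (intro subring_add[OF subring] subring_mult[OF subring] that)
      finally have "inverse c \<in> B" .
      then show False using that by (auto simp: ring_unit_def)
    qed
    have w: "inverse (a + b) \<in> B" using u by (simp add: ring_unit_def)
    show False
    proof (cases "a = 0 \<or> b = 0")
      case True
      then show False using u that by auto
    next
      case False
      then show False
        using valuation[of "b / a"] key[of a b "inverse (a + b)"] key[of b a "inverse (a + b)"] that one w
        by (auto simp: add.commute)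
    qed
  qed
  have zero: "\<not> ring_unit B 0" by (simp add: ring_unit_def)
  have "(\<Sum>j\<in>X. f j / f i) \<in> B \<and> \<not> ring_unit B (\<Sum>j\<in>X. f j / f i)" if "finite X" "X \<subseteq> T - {i}" for X
    using that
  proof (induction X rule: finite_induct)
    case (insert a X)
    then show ?case using nu_add[of "f a / f i" "\<Sum>j\<in>X. f j / f i"] nonunit[of a] i(2)
      by (auto intro: subring_add[OF subring])
  qed (simp add: subring_zero[OF subring] zero)
  from this[of "T - {i}"] T have nu: "\<not> ring_unit B (\<Sum>j\<in>T - {i}. f j / f i)" by simp
  have "(\<Sum>j\<in>T - {i}. f j) = - f i" using sum0 i(1) T(1) by (simp add: sum.remove[of T i] eq_neg_iff_add_eq_0 add.commute)
  then have "(\<Sum>j\<in>T - {i}. f j / f i) = - 1"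
    using fT[OF i(1)] by (simp add: sum_divide_distrib[symmetric])
  then show False using nu ring_unit_one[OF subring] ring_unit_uminus[OF subring] by metis
qed

text \<open>The powers of \<open>y\<close> are linearly dependent over the rationals, so two terms of a relation have the
  same value; hence a power of \<open>y\<close> has the value of a power of \<open>p\<close>.\<close>
lemma value_exists:
  assumes "y \<noteq> 0"
  shows "\<exists>k e. k > 0 \<and> ring_unit B (y ^ k * of_nat p powi (- e))"
proof -
  obtain d q where q: "\<exists>i\<le>d. q i \<noteq> 0" "(\<Sum>i\<le>d. of_rat (q i) * y ^ i) = 0"
    using number_field_relation[OF nf, of y] by blast
  obtain i j where ij: "i \<noteq> j" "q i \<noteq> 0" "q j \<noteq> 0"
    and u: "ring_unit B ((of_rat (q i) * y ^ i) / (of_rat (q j) * y ^ j))"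
    using unit_of_sum_zero[of "{..d}" "\<lambda>i. of_rat (q i) * y ^ i"] q assms by auto
  have main: ?thesis
    if ij: "i < j" "q i \<noteq> 0" "q j \<noteq> 0" and u: "ring_unit B ((of_rat (q j) * y ^ j) / (of_rat (q i) * y ^ i))"
    for i j
  proof -
    obtain e where e: "ring_unit B (of_rat (q i / q j) * of_nat p powi - e)"
    proof -
      have "q i / q j \<noteq> 0" using ij by simp
      from that[OF unit_of_rat[OF this]] show thesis .
    qed
    have "(of_rat (q j) * y ^ j) / (of_rat (q i) * y ^ i) * (of_rat (q i / q j) * of_nat p powi - e) = y ^ (j - i) * of_nat p powi (- e)"
      using ij assms by (simp add: of_rat_divide power_diff field_simps)
    then have "ring_unit B (y ^ (j - i) * of_nat p powi (- e))"
      using ring_unit_mult[OF subring u e] by simp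
    then show ?thesis using ij by (intro exI[of _ "j - i"]) auto
  qed
  show ?thesis
  proof (cases "i < j")
    case True
    then show ?thesis using main[of i j] ij ring_unit_inverse[OF u] by (simp add: field_simps)
  next
    case False
    then show ?thesis using main[of j i] ij u by simp
  qed
qed

lemma unit_power_form:
  assumes "ring_unit B (y ^ k * of_nat p powi (- e))"
  shows "ring_unit B (y ^ (k * l) * of_nat p powi (- (e * int l)))"
proof -
  have "(y ^ k * of_nat p powi (- e)) ^ l = y ^ (k * l) * of_nat p powi (- e * int l)"
    by (simp only: power_mult_distrib power_mult power_int_mult power_int_of_nat)
  then show ?thesis using ring_unit_power[OF subring assms, of l] by simp
qed

lemma value_unique:
  assumes "k > 0" "l > 0" "ring_unit B (y ^ k * of_nat p powi (- e))" "ring_unit B (y ^ l * of_nat p powi (- f))"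
  shows "real_of_int e / real k = real_of_int f / real l"
proof -
  have y: "y \<noteq> 0" using assms(1,3) unfolding ring_unit_def by (cases k) auto
  let ?a = "y ^ (k * l) * of_nat p powi (- (e * int l))" and ?b = "y ^ (k * l) * of_nat p powi (- (f * int k))"
  have "ring_unit B ?a" "ring_unit B ?b"
    using unit_power_form[OF assms(3), of l] unit_power_form[OF assms(4), of k] by (simp_all only: mult.commute)
  then have "ring_unit B (?a * inverse ?b)"
    by (rule ring_unit_mult[OF subring _ ring_unit_inverse])
  also have "?a * inverse ?b = of_nat p powi (f * int k - e * int l)"
    using y of_nat_p_nonzero by (simp add: power_int_diff power_int_minus field_simps)
  finally have "f * int k = e * int l" using unit_power_int_p_iff by simp
  then have "real_of_int (f * int k) = real_of_int (e * int l)" by (rule arg_cong)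
  then show ?thesis using assms(1,2) by (simp add: field_simps)
qed

text \<open>The valuation normalised to 1 at \<open>p\<close>: if a unit times
  \<open>p powi e\<close> equals \<open>y ^ k\<close>, then \<open>y\<close> has value
  \<open>e / k\<close>. Existence and uniqueness of the quotient are the two preceding
  facts.\<close>

definition val :: "'k \<Rightarrow> real" where
  "val y = (THE r. \<exists>k e. k > 0 \<and> ring_unit B (y ^ k * of_nat p powi (- e)) \<and> r = real_of_int e / real k)"

lemma val_eqI:
  assumes "k > 0" "ring_unit B (y ^ k * of_nat p powi (- e))"
  shows "val y = real_of_int e / real k"
  unfolding val_def using assms value_unique by (intro the_equality) blast+

lemma val_mult:
  assumes "y \<noteq> 0" "z \<noteq> 0" shows "val (y * z) = val y + val z"
proof -
  obtain k e where k: "k > 0" "ring_unit B (y ^ k * of_nat p powi (- e))" using value_exists[OF assms(1)] by blast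
  obtain l f where l: "l > 0" "ring_unit B (z ^ l * of_nat p powi (- f))" using value_exists[OF assms(2)] by blast
  let ?a = "y ^ (k * l) * of_nat p powi (- (e * int l))" and ?b = "z ^ (k * l) * of_nat p powi (- (f * int k))"
  have "ring_unit B ?a" "ring_unit B ?b"
    using unit_power_form[OF k(2), of l] unit_power_form[OF l(2), of k] by (simp_all only: mult.commute)
  then have "ring_unit B (?a * ?b)" by (rule ring_unit_mult[OF subring])
  also have "?a * ?b = (y * z) ^ (k * l) * (of_nat p powi (- (e * int l)) * of_nat p powi (- (f * int k)))"
    by (simp only: power_mult_distrib mult_ac)
  also have "of_nat p powi (- (e * int l)) * of_nat p powi (- (f * int k)) =
      (of_nat p :: 'k) powi (- (e * int l + f * int k))"
    using of_nat_p_nonzero by (subst power_int_add[symmetric]) auto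
  finally have "val (y * z) = real_of_int (e * int l + f * int k) / real (k * l)"
    using k l by (intro val_eqI) auto
  also have "\<dots> = real_of_int e / real k + real_of_int f / real l" using k l by (simp add: field_simps)
  finally show ?thesis using val_eqI[OF k] val_eqI[OF l] by simp
qed

text \<open>From \<open>e \<ge> 0\<close> one gets \<open>y ^ k \<in> B\<close>, and a valuation
  ring contains every element with a power in it: otherwise \<open>y\<close> is \<open>y ^ k\<close>
  times a power of \<open>inverse y\<close>. For \<open>e < 0\<close> and \<open>y \<in> B\<close>,
  the inverse of \<open>p\<close> would lie in \<open>B\<close>.\<close>

lemma val_nonneg_iff:
  assumes "y \<noteq> 0" shows "val y \<ge> 0 \<longleftrightarrow> y \<in> B"
proof -
  obtain k e where k: "k > 0" "ring_unit B (y ^ k * of_nat p powi (- e))" using value_exists[OF assms(1)] by blast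
  have "val y \<ge> 0 \<longleftrightarrow> e \<ge> 0" using val_eqI[OF k] k(1) by (simp add: zero_le_divide_iff)
  also have "\<dots> \<longleftrightarrow> y \<in> B"
  proof
    assume "e \<ge> 0"
    then have pe: "of_nat p powi e \<in> B"
      by (simp add: power_int_def subring_power[OF subring] subring_of_nat[OF subring])
    have "y ^ k * of_nat p powi (- e) \<in> B" using k(2) unfolding ring_unit_def by blast
    then have "(y ^ k * of_nat p powi (- e)) * of_nat p powi e \<in> B"
      by (rule subring_mult[OF subring _ pe])
    moreover have "of_nat p powi (- e) * of_nat p powi e = (1::'k)"
      using of_nat_p_nonzero by (simp add: power_int_minus)
    ultimately have yk: "y ^ k \<in> B" by (simp only: mult.assoc mult_1_right)
    show "y \<in> B"
    proof (rule ccontr)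
      assume "y \<notin> B"
      then have "inverse y \<in> B" using valuation assms by blast
      then have "y ^ k * inverse y ^ (k - 1) \<in> B" by (intro subring_mult[OF subring yk] subring_power[OF subring])
      moreover have "y ^ k * inverse y ^ (k - 1) = y"
        using assms k(1) by (cases k) (auto simp: power_inverse)
      ultimately show False using \<open>y \<notin> B\<close> by simp
    qed
  next
    assume yB: "y \<in> B"
    show "e \<ge> 0"
    proof (rule ccontr)
      assume "\<not> e \<ge> 0"
      then obtain j where j: "e = - int (Suc j)" by (metis int_cases3 Suc_pred linorder_not_le of_nat_0_le_iff order_refl)
      have "inverse (y ^ k * of_nat p powi (- e)) \<in> B" using k(2) unfolding ring_unit_def by blast
      then have "inverse (y ^ k * of_nat p powi (- e)) * y ^ k * of_nat p ^ j \<in> B"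
        using yB by (intro subring_mult[OF subring] subring_power[OF subring] subring_of_nat[OF subring])
      moreover have "inverse (y ^ k * of_nat p powi (- e)) * y ^ k * of_nat p ^ j = inverse (of_nat p)"
        unfolding j using assms of_nat_p_nonzero by (simp add: field_simps power_int_minus del: of_nat_Suc)
      ultimately show False using p_nonunit by simp
    qed
  qed
  finally show ?thesis .
qed

definition absval :: "'k \<Rightarrow> real" where
  "absval y = (if y = 0 then 0 else real p powr (- val y))"

lemma absval_le_1_iff: "absval y \<le> 1 \<longleftrightarrow> y \<in> B"
proof (cases "y = 0")
  case False
  have "absval y \<le> 1 \<longleftrightarrow> real p powr (- val y) \<le> real p powr 0"
    using False p_pos by (simp only: absval_def if_False powr_zero_eq_one) simp
  also have "\<dots> \<longleftrightarrow> val y \<ge> 0" by (subst powr_le_cancel_iff[OF p_gt_1]) simp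
  finally show ?thesis using val_nonneg_iff[OF False] by simp
qed (simp add: absval_def subring_zero[OF subring])

lemma absval_mult: "absval (y * z) = absval y * absval z"
  by (auto simp: absval_def val_mult powr_add[symmetric])

lemma absval_nonarch: "nonarch_absolute_value absval"
proof -
  have pos: "absval y > 0" if "y \<noteq> 0" for y using that p_pos by (simp add: absval_def)
  have *: "absval (y + z) \<le> absval y" if le: "absval z \<le> absval y" for y z
  proof (cases "y = 0")
    case True
    then have "absval y = 0" by (simp add: absval_def)
    then have "z = 0" using le pos[of z] by linarith
    then show ?thesis using True by simp
  next
    case False
    have "absval (z / y) * absval y = absval z" using False absval_mult[of "z / y" y] by simp
    then have "absval (z / y) * absval y \<le> 1 * absval y" using le by simp
    then have "absval (z / y) \<le> 1" using pos[OF False] by (rule mult_right_le_imp_le)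
    then have "absval (1 + z / y) \<le> 1"
      unfolding absval_le_1_iff by (intro subring_add[OF subring] subring_one[OF subring])
    then have "absval (1 + z / y) * absval y \<le> 1 * absval y" using pos[OF False] by (intro mult_right_mono) auto
    moreover have "(1 + z / y) * y = y + z" using False by (simp add: field_simps)
    ultimately show ?thesis using absval_mult[of "1 + z / y" y] by simp
  qed
  show ?thesis
    unfolding nonarch_absolute_value_def
  proof (intro conjI allI)
    fix x y
    show "0 \<le> absval x" by (simp add: absval_def)
    show "absval x = 0 \<longleftrightarrow> x = 0" using pos[of x] by (auto simp: absval_def)
    show "absval (x * y) = absval x * absval y" by (rule absval_mult)
    show "absval (x + y) \<le> max (absval x) (absval y)"
      using *[of x y] *[of y x] by (cases "absval x \<le> absval y") (auto simp: add.commute)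
  qed
qed

lemma absval_lies_over: "lies_over absval p"
  unfolding lies_over_def
proof
  fix q
  show "absval (of_rat q) = padic_abs p q"
  proof (cases "q = 0")
    case False
    define e where "e = int (multiplicity (int p) (fst (quotient_of q))) - int (multiplicity (int p) (snd (quotient_of q)))"
    have "ring_unit B (of_rat q ^ 1 * of_nat p powi (- e))"
      using unit_of_rat[OF False] by (simp add: e_def)
    from val_eqI[OF _ this] have "val (of_rat q) = real_of_int e" by simp
    then have "absval (of_rat q) = real p powr (real_of_int (- e))" using False by (simp add: absval_def)
    also have "\<dots> = real p powi (- e)" using p_pos by (subst powr_real_of_int') auto
    finally show ?thesis using False by (simp add: padic_abs_def e_def)
  qed (simp add: absval_def padic_abs_def)
qed

end

text \<open>The valuation ring omits \<open>x\<close>, so \<open>x\<close> gets absolute value above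
  1 once some prime is found to be a non-unit. If all primes were units, \<open>B\<close> would
  contain the rationals, and a rational relation for \<open>inverse x\<close> would express
  \<open>x\<close> as a polynomial in \<open>inverse x\<close>, putting \<open>x\<close> into
  \<open>B\<close>.\<close>

theorem exists_place_gt_1:
  fixes x :: "'k::field_char_0"
  assumes nf: "number_field TYPE('k)" and x: "\<not> algebraic_int x"
  shows "\<exists>v\<in>nonarch_places. v x > 1"
proof -
  obtain B where B: "is_subring B" "inverse x \<in> B" "x \<notin> B"
    "\<And>C. is_subring C \<Longrightarrow> B \<subseteq> C \<Longrightarrow> x \<notin> C \<Longrightarrow> C = B"
    using maximal_subring_avoiding[OF x] by blast
  have val: "y \<in> B \<or> inverse y \<in> B" if "y \<noteq> 0" for y
    using maximal_subring_valuation[OF B that] .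
  have x0: "x \<noteq> 0" using B(1,3) subring_zero by blast
  have "\<exists>p. prime p \<and> inverse (of_nat p) \<notin> B"
  proof (rule ccontr)
    assume neg: "\<not> ?thesis"
    have invn: "inverse (of_nat N) \<in> B" if "N > 0" for N
      using that
    proof (induction N rule: prime_divisors_induct)
      case (factor q N)
      then show ?case using neg by (auto intro!: subring_mult[OF B(1)])
    qed (use subring_one[OF B(1)] in auto)
    have rat: "of_rat q \<in> B" for q
    proof -
      obtain a b where ab: "quotient_of q = (a, b)" by (cases "quotient_of q")
      have q: "q = of_int a / of_int b" "b > 0" using quotient_of_div[OF ab] quotient_of_denom_pos[OF ab] by auto
      have "of_rat q = (of_rat (of_int a / of_int b) :: 'k)" by (simp only: q(1))
      also have "\<dots> = of_int a / of_int b" by (simp only: of_rat_divide of_rat_of_int_eq)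
      also have "\<dots> = of_int a * inverse (of_nat (nat b))" using q(2) by (simp add: divide_inverse)
      finally have "of_rat q = of_int a * inverse (of_nat (nat b) :: 'k)" .
      then show ?thesis using invn[of "nat b"] q(2) by (auto intro!: subring_mult[OF B(1)] subring_of_int[OF B(1)])
    qed
    obtain d q where q: "\<exists>i\<le>d. q i \<noteq> 0" "(\<Sum>i\<le>d. of_rat (q i) * inverse x ^ i) = 0"
      using number_field_relation[OF nf, of "inverse x"] by blast
    \<comment> \<open>Dividing the relation by \<open>inverse x ^ i0\<close> leaves a non-zero
      rational constant plus a multiple of \<open>inverse x\<close>, which can be solved for
      \<open>x\<close>.\<close>
    define i0 where "i0 = (LEAST i. q i \<noteq> 0)"
    have i0: "q i0 \<noteq> 0" "\<And>i. i < i0 \<Longrightarrow> q i = 0" "i0 \<le> d"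
    proof -
      obtain i where i: "i \<le> d" "q i \<noteq> 0" using q(1) by blast
      show "q i0 \<noteq> 0" unfolding i0_def by (rule LeastI[of _ i]) (rule i)
      show "q j = 0" if "j < i0" for j using not_less_Least[OF that[unfolded i0_def]] by blast
      show "i0 \<le> d" using Least_le[of "\<lambda>i. q i \<noteq> 0" i] i unfolding i0_def by linarith
    qed
    have "(\<Sum>i\<le>d. of_rat (q i) * inverse x ^ i) = (\<Sum>i\<in>{i0..d}. of_rat (q i) * inverse x ^ i)"
      by (rule sum.mono_neutral_right) (use i0 in auto)
    also have "\<dots> = of_rat (q i0) * inverse x ^ i0 + (\<Sum>i\<in>{Suc i0..d}. of_rat (q i) * inverse x ^ i)"
      using i0(3) by (rule sum.atLeast_Suc_atMost)
    also have "(\<Sum>i\<in>{Suc i0..d}. of_rat (q i) * inverse x ^ i) =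
        inverse x ^ Suc i0 * (\<Sum>i\<in>{Suc i0..d}. of_rat (q i) * inverse x ^ (i - Suc i0))"
      unfolding sum_distrib_left
      by (intro sum.cong refl) (simp add: power_add[symmetric] mult.left_commute del: power_Suc)
    finally have "of_rat (q i0) + inverse x * (\<Sum>i\<in>{Suc i0..d}. of_rat (q i) * inverse x ^ (i - Suc i0)) = 0"
      (is "_ + inverse x * ?s = 0") using q(2) x0 by (simp add: mult.commute[of _ "inverse x ^ i0"] mult.assoc distrib_left[symmetric])
    moreover have "x = - (inverse c * s)" if "c + inverse x * s = 0" "c \<noteq> 0" for c s
      using that x0 by (simp add: field_simps eq_neg_iff_add_eq_0)
    ultimately have "x = - (inverse (of_rat (q i0)) * ?s)" using i0(1) by simp
    also have "inverse (of_rat (q i0)) = (of_rat (inverse (q i0)) :: 'k)" by (rule of_rat_inverse[symmetric])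
    also have "- (of_rat (inverse (q i0)) * ?s) \<in> B"
      using rat B(1,2) by (intro subring_uminus subring_mult subring_sum subring_power)
    finally show False using B(3) by blast
  qed
  then obtain p where p: "prime p" "inverse (of_nat p) \<notin> B" by blast
  interpret padic_valuation_ring B p
    by unfold_locales (use nf B(1) val p in auto)
  have "absval x > 1" using absval_le_1_iff[of x] B(3) by simp
  moreover have "absval \<in> nonarch_places"
    using absval_nonarch absval_lies_over p(1) by (auto simp: nonarch_places_def)
  ultimately show ?thesis by blast
qed


section \<open>A submultiplicative norm on a number field\<close>

lemma common_denominator:
  assumes "finite Q" shows "\<exists>D::int. D > 0 \<and> (\<forall>q\<in>Q. of_int D * (q::rat) \<in> \<int>)"
  using assms
proof (induction Q)
  case (insert q Q)
  then obtain D where D: "D > 0" "\<forall>q\<in>Q. of_int D * q \<in> \<int>" by blast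
  obtain a b where ab: "quotient_of q = (a, b)" by (cases "quotient_of q")
  have q: "q = of_int a / of_int b" "b > 0" using quotient_of_div[OF ab] quotient_of_denom_pos[OF ab] by auto
  have "of_int (D * b) * q = of_int (D * a)" using q by simp
  then have "of_int (D * b) * q \<in> \<int>" by (metis Ints_of_int)
  moreover have "of_int (D * b) * r \<in> \<int>" if "r \<in> Q" for r
  proof -
    have "of_int (D * b) * r = of_int b * (of_int D * r)" by simp
    then show ?thesis using D(2) that by (metis Ints_mult Ints_of_int)
  qed
  ultimately show ?case using D(1) q(2) by (intro exI[of _ "D * b"]) auto
qed (auto intro: exI[of _ 1])

text \<open>The powers of an algebraic integer \<open>y\<close> lie in a lattice, so they cannot tend to 0 unless
  \<open>y = 0\<close>. This replaces the product formula and avoids complex embeddings.\<close>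
theorem number_field_norm:
  assumes "number_field TYPE('k::field_char_0)"
  shows "\<exists>\<N> :: 'k \<Rightarrow> real. (\<forall>x. \<N> x \<ge> 0) \<and> (\<forall>x y. \<N> (x + y) \<le> \<N> x + \<N> y) \<and>
    (\<forall>x y. \<N> (x * y) \<le> \<N> x * \<N> y) \<and> (\<forall>q x. \<N> (of_rat q * x) = \<bar>of_rat q\<bar> * \<N> x) \<and>
    (\<forall>x. algebraic_int x \<longrightarrow> x \<noteq> 0 \<longrightarrow> \<N> x \<ge> 1)"
proof -
  obtain B :: "'k set" where B: "finite_dimensional_vector_space (\<lambda>q x. of_rat q * x) B"
    using assms by (auto simp: number_field_def)
  interpret vs: finite_dimensional_vector_space "\<lambda>q x. of_rat q * x :: 'k" B by (rule B)
  have fin: "finite B" by (rule vs.finite_Basis)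
  have ind: "vs.independent B" by (rule vs.independent_Basis)
  have spn: "x \<in> vs.span B" for x using vs.span_Basis by auto
  define rep where "rep = vs.representation B"
  have rep_add: "rep (x + y) b = rep x b + rep y b" for x y b
    unfolding rep_def using vs.representation_add[OF ind spn spn] by simp
  have rep_scale: "rep (of_rat q * x) b = q * rep x b" for q x b
    unfolding rep_def using vs.representation_scale[OF ind spn] by simp
  have rep_sum: "(\<Sum>b\<in>B. of_rat (rep x b) * b) = x" for x
    unfolding rep_def using vs.sum_representation_eq[OF ind spn fin order.refl] by simp
  define N0 where "N0 = (\<lambda>x. \<Sum>b\<in>B. \<bar>real_of_rat (rep x b)\<bar>)"
  have N0_nonneg: "N0 x \<ge> 0" for x by (simp add: N0_def sum_nonneg)
  have N0_add: "N0 (x + y) \<le> N0 x + N0 y" for x y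
    unfolding N0_def sum.distrib[symmetric] rep_add of_rat_add by (intro sum_mono abs_triangle_ineq)
  have N0_scale: "N0 (of_rat q * x) = \<bar>of_rat q\<bar> * N0 x" for q x
    unfolding N0_def rep_scale sum_distrib_left of_rat_mult abs_mult ..
  have N0_zero: "N0 0 = 0" using N0_scale[of 0 0] by simp
  have N0_sum: "N0 (sum f I) \<le> (\<Sum>i\<in>I. N0 (f i))" for f and I :: "'k set"
    by (induction I rule: infinite_finite_induct) (auto simp: N0_zero intro: order.trans[OF N0_add])
  \<comment> \<open>A bound for the coordinate norm of all products of basis elements; rescaling the
    norm by \<open>C\<close> makes it submultiplicative, and the summand 1 keeps it
    non-degenerate.\<close>
  define C where "C = 1 + (\<Sum>a\<in>B. \<Sum>b\<in>B. N0 (a * b))"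
  have C1: "C \<ge> 1" by (simp add: C_def sum_nonneg N0_nonneg)
  have N0_mult: "N0 (x * y) \<le> C * (N0 x * N0 y)" for x y
  proof -
    have le: "N0 (a * b) \<le> C" if "a \<in> B" "b \<in> B" for a b
    proof -
      have "N0 (a * b) \<le> (\<Sum>b\<in>B. N0 (a * b))"
        using fin that by (intro member_le_sum) (auto simp: N0_nonneg)
      also have "\<dots> \<le> (\<Sum>a\<in>B. \<Sum>b\<in>B. N0 (a * b))"
        using fin that member_le_sum[of a B "\<lambda>a. \<Sum>b\<in>B. N0 (a * b)"] by (auto simp: N0_nonneg sum_nonneg)
      finally show ?thesis by (simp add: C_def)
    qed
    have xy: "x * y = (\<Sum>a\<in>B. \<Sum>b\<in>B. of_rat (rep x a * rep y b) * (a * b))"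
    proof -
      have "x * y = (\<Sum>a\<in>B. of_rat (rep x a) * a) * (\<Sum>b\<in>B. of_rat (rep y b) * b)"
        by (simp only: rep_sum)
      then show ?thesis by (simp add: sum_product of_rat_mult mult_ac)
    qed
    have "N0 (x * y) \<le> (\<Sum>a\<in>B. N0 (\<Sum>b\<in>B. of_rat (rep x a * rep y b) * (a * b)))"
      by (subst xy) (rule N0_sum)
    also have "\<dots> \<le> (\<Sum>a\<in>B. \<Sum>b\<in>B. N0 (of_rat (rep x a * rep y b) * (a * b)))"
      by (intro sum_mono N0_sum)
    also have "\<dots> \<le> (\<Sum>a\<in>B. \<Sum>b\<in>B. (\<bar>real_of_rat (rep x a)\<bar> * \<bar>real_of_rat (rep y b)\<bar>) * C)"
    proof (intro sum_mono)
      fix a b assume "a \<in> B" "b \<in> B"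
      have "N0 (of_rat (rep x a * rep y b) * (a * b)) = \<bar>real_of_rat (rep x a * rep y b)\<bar> * N0 (a * b)"
        by (rule N0_scale)
      also have "\<dots> = (\<bar>real_of_rat (rep x a)\<bar> * \<bar>real_of_rat (rep y b)\<bar>) * N0 (a * b)"
        by (simp only: of_rat_mult abs_mult)
      also have "\<dots> \<le> (\<bar>real_of_rat (rep x a)\<bar> * \<bar>real_of_rat (rep y b)\<bar>) * C"
        by (rule mult_left_mono[OF le]) (use \<open>a \<in> B\<close> \<open>b \<in> B\<close> in auto)
      finally show "N0 (of_rat (rep x a * rep y b) * (a * b))
          \<le> (\<bar>real_of_rat (rep x a)\<bar> * \<bar>real_of_rat (rep y b)\<bar>) * C" .
    qed
    also have "\<dots> = C * (N0 x * N0 y)"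
    proof -
      have "N0 x * N0 y = (\<Sum>a\<in>B. \<Sum>b\<in>B. \<bar>real_of_rat (rep x a)\<bar> * \<bar>real_of_rat (rep y b)\<bar>)"
        unfolding N0_def by (rule sum_product)
      then show ?thesis by (simp only: sum_distrib_right[symmetric] mult.commute[of C])
    qed
    finally show ?thesis .
  qed
  define \<N> where "\<N> = (\<lambda>x. C * N0 x)"
  have N_mult: "\<N> (x * y) \<le> \<N> x * \<N> y" for x y
    using mult_left_mono[OF N0_mult[of x y], of C] C1 by (simp add: \<N>_def mult_ac)
  have N_nonneg: "\<N> x \<ge> 0" for x using N0_nonneg C1 by (simp add: \<N>_def)
  \<comment> \<open>Only positive exponents, because \<open>\<N> 1\<close> may exceed 1.\<close>
  have N_pow: "\<N> (x ^ Suc k) \<le> \<N> x ^ Suc k" for x k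
  proof (induction k)
    case (Suc k)
    have "\<N> (x ^ Suc (Suc k)) \<le> \<N> x * \<N> (x ^ Suc k)" using N_mult[of x "x ^ Suc k"] by simp
    also have "\<dots> \<le> \<N> x * \<N> x ^ Suc k" by (rule mult_left_mono[OF Suc N_nonneg])
    finally show ?case by simp
  qed simp
  have "\<N> y \<ge> 1" if y: "algebraic_int y" "y \<noteq> 0" for y
  proof (rule ccontr)
    assume "\<not> \<N> y \<ge> 1"
    then have lt: "\<N> y < 1" by simp
    from y(1) obtain p where p: "lead_coeff p = 1" "\<forall>i. Polynomial.coeff p i \<in> \<int>" "poly p y = 0"
      by (auto elim: algebraic_int.cases)
    define e where "e = degree p"
    have "\<exists>D::int. D > 0 \<and> (\<forall>q\<in>(\<lambda>(i,b). rep (y ^ i) b) ` ({..<e} \<times> B). of_int D * q \<in> \<int>)"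
      using fin by (intro common_denominator) auto
    then obtain D :: int where D: "D > 0" "\<And>i b. i < e \<Longrightarrow> b \<in> B \<Longrightarrow> of_int D * rep (y ^ i) b \<in> \<int>"
      by (auto simp: ball_Un image_iff)
    \<comment> \<open>\<open>D\<close> is a common denominator for the coordinates of the powers
      below the degree of the monic equation; that equation, used as a recursion with integral
      coefficients, carries it to all powers. A non-zero power then has some coordinate of size at
      least \<open>1 / D\<close>.\<close>
    have lat: "of_int D * rep (y ^ k) b \<in> \<int>" if b: "b \<in> B" for k b
    proof (induction k rule: less_induct)
      case (less k)
      show ?case
      proof (cases "k < e")
        case False
        have "0 = y ^ (k - e) * (\<Sum>i\<le>e. Polynomial.coeff p i * y ^ i)"
          using p(3) by (simp add: poly_altdef e_def)
        also have "\<dots> = (\<Sum>i\<le>e. Polynomial.coeff p i * y ^ (k - e + i))"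
          by (simp add: sum_distrib_left power_add mult_ac)
        also have "\<dots> = (\<Sum>i<e. Polynomial.coeff p i * y ^ (k - e + i)) + y ^ k"
          using False p(1) by (simp add: lessThan_Suc_atMost[symmetric] e_def)
        finally have yk: "y ^ k = - (\<Sum>i<e. Polynomial.coeff p i * y ^ (k - e + i))"
          by (simp add: eq_neg_iff_add_eq_0 add.commute)
        obtain c where c: "\<And>i. Polynomial.coeff p i = of_int (c i)" 
        proof -
          have "\<forall>i. \<exists>c. Polynomial.coeff p i = of_int c" using p(2) by (auto simp: Ints_def)
          then show thesis using that by (auto dest: choice)
        qed
        have rs: "rep (\<Sum>i\<in>I. f i) b = (\<Sum>i\<in>I. rep (f i) b)" if "finite I" for I :: "nat set" and f
          using that
        proof (induction I)
          case empty
          show ?case using rep_scale[of 0 0 b] by simp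
        qed (simp add: rep_add)
        have rm: "rep (- x) b = - rep x b" for x using rep_scale[of "-1" x b] by simp
        have ri: "rep (of_int j * x) b = of_int j * rep x b" for j x
          using rep_scale[of "of_int j" x b] by simp
        have "of_int D * rep (y ^ k) b = - (\<Sum>i<e. of_int (c i) * (of_int D * rep (y ^ (k - e + i)) b))"
          unfolding yk by (simp add: rm rs c ri sum_distrib_left mult_ac)
        also have "\<dots> \<in> \<int>"
        proof -
          have "of_int (c i) * (of_int D * rep (y ^ (k - e + i)) b) \<in> \<int>" if "i < e" for i
            by (rule Ints_mult[OF Ints_of_int less]) (use that False in simp)
          then show ?thesis by (intro Ints_minus Ints_sum) auto
        qed
        finally show ?thesis .
      qed (use D b in auto)
    qed
    have lower: "C / real_of_int D \<le> \<N> (y ^ k)" for k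
    proof -
      have "\<exists>b\<in>B. rep (y ^ k) b \<noteq> 0"
      proof (rule ccontr)
        assume "\<not> ?thesis"
        then have "y ^ k = 0" using rep_sum[of "y ^ k"] by simp
        then show False using y(2) by simp
      qed
      then obtain b where b: "b \<in> B" "rep (y ^ k) b \<noteq> 0" by blast
      obtain j where j: "of_int D * rep (y ^ k) b = of_int j" using lat[OF b(1)] by (rule Ints_cases)
      then have "j \<noteq> 0" using b(2) D(1) by auto
      have "real_of_int D * real_of_rat (rep (y ^ k) b) = real_of_int j"
        using arg_cong[OF j, of real_of_rat] by (simp add: of_rat_mult)
      then have "real_of_int D * \<bar>real_of_rat (rep (y ^ k) b)\<bar> = \<bar>real_of_int j\<bar>"
        using D(1) by (metis abs_mult abs_of_pos of_int_0_less_iff)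
      also have "\<dots> \<ge> 1" using \<open>j \<noteq> 0\<close> by linarith
      finally have "1 / real_of_int D \<le> \<bar>real_of_rat (rep (y ^ k) b)\<bar>" using D(1) by (simp add: field_simps)
      also have "\<dots> \<le> N0 (y ^ k)"
        unfolding N0_def using fin b(1) by (intro member_le_sum) auto
      finally show ?thesis using mult_left_mono[of "1 / real_of_int D" "N0 (y ^ k)" C] C1 by (simp add: \<N>_def)
    qed
    have "(\<lambda>k. \<N> y ^ Suc k) \<longlonglongrightarrow> 0"
      using LIMSEQ_Suc[OF LIMSEQ_realpow_zero[OF N_nonneg lt]] .
    moreover have "C / real_of_int D > 0" using C1 D(1) by simp
    ultimately have "eventually (\<lambda>k. \<N> y ^ Suc k < C / real_of_int D) sequentially"
      by (rule order_tendstoD(2))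
    then obtain k where "\<N> y ^ Suc k < C / real_of_int D"
      using eventually_happens'[OF sequentially_bot] by blast
    then show False using N_pow[of y k] lower[of "Suc k"] by linarith
  qed
  moreover have "\<N> (x + y) \<le> \<N> x + \<N> y" for x y
    using mult_left_mono[OF N0_add[of x y], of C] C1 by (simp add: \<N>_def distrib_left)
  moreover have "\<N> (of_rat q * x) = \<bar>of_rat q\<bar> * \<N> x" for q x
    by (simp add: \<N>_def N0_scale)
  ultimately show ?thesis using N_mult N_nonneg by (intro exI[of _ \<N>]) blast
qed


section \<open>Arithmetic of the completion\<close>

locale nonarch_abs =
  fixes v :: "'k::field_char_0 \<Rightarrow> real"
  assumes nonarch: "nonarch_absolute_value v"
begin

lemma v_nonneg: "v x \<ge> 0" and v_eq_0: "v x = 0 \<longleftrightarrow> x = 0"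
  and v_mult: "v (x * y) = v x * v y" and v_add: "v (x + y) \<le> max (v x) (v y)"
  using nonarch by (auto simp: nonarch_absolute_value_def)

lemma v_zero: "v 0 = 0" by (simp add: v_eq_0)

lemma v_one: "v 1 = 1"
  using v_mult[of 1 1] v_eq_0[of 1] by simp

lemma v_uminus: "v (- x) = v x"
proof -
  have "v (- 1) * v (- 1) = 1" using v_mult[of "- 1" "- 1"] v_one by simp
  then have "v (- 1) = 1" using v_nonneg[of "- 1"] by (metis abs_of_nonneg abs_mult_self_eq power2_eq_square power2_eq_1_iff abs_minus_cancel abs_one)
  then show ?thesis using v_mult[of "- 1" x] by simp
qed

lemma v_diff: "v (x - y) \<le> max (v x) (v y)"
  using v_add[of x "- y"] v_uminus[of y] by simp

lemma v_minus_commute: "v (x - y) = v (y - x)"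
  using v_uminus[of "x - y"] by simp

lemma v_power: "v (x ^ n) = v x ^ n"
  by (induction n) (auto simp: v_one v_mult)

lemma v_sum_le: "c \<ge> 0 \<Longrightarrow> (\<And>i. i \<in> I \<Longrightarrow> v (f i) \<le> c) \<Longrightarrow> v (sum f I) \<le> c"
  by (induction I rule: infinite_finite_induct)
    (auto simp: v_zero intro: order.trans[OF v_add])

lemma v_of_nat_le_1: "v (of_nat n) \<le> 1"
  by (induction n) (auto simp: v_zero v_one intro: order.trans[OF v_add])

lemma v_of_int_le_1: "v (of_int n) \<le> 1"
  by (cases n) (auto simp: v_of_nat_le_1 v_uminus simp del: of_nat_Suc)

text \<open>If \<open>v x > 1\<close>, the leading term of a monic integral equation would strictly
  dominate all the others.\<close>

lemma v_algebraic_int_le_1: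
  assumes "algebraic_int x" shows "v x \<le> 1"
proof (rule ccontr)
  assume "\<not> v x \<le> 1"
  then have gt: "v x > 1" by simp
  from assms obtain p where p: "lead_coeff p = 1" "\<forall>i. Polynomial.coeff p i \<in> \<int>" "poly p x = 0"
    by (auto elim: algebraic_int.cases)
  define n where "n = degree p"
  have "0 = (\<Sum>i<n. Polynomial.coeff p i * x ^ i) + x ^ n"
    using p(1,3) by (simp add: poly_altdef lessThan_Suc_atMost[symmetric] n_def)
  then have eq: "x ^ n = - (\<Sum>i<n. Polynomial.coeff p i * x ^ i)"
    by (simp add: eq_neg_iff_add_eq_0 add.commute)
  show False
  proof (cases n)
    case 0
    then show False using eq by simp
  next
    case (Suc k)
    have "v (\<Sum>i<n. Polynomial.coeff p i * x ^ i) \<le> v x ^ k"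
    proof (rule v_sum_le)
      fix i assume i: "i \<in> {..<n}"
      obtain c where c: "Polynomial.coeff p i = of_int c" using p(2)[rule_format] by (rule Ints_cases)
      have "v (Polynomial.coeff p i * x ^ i) \<le> 1 * v x ^ i"
        unfolding v_mult v_power c by (intro mult_right_mono v_of_int_le_1) (simp add: v_nonneg)
      also have "\<dots> \<le> v x ^ k" using gt i Suc by (simp add: power_increasing)
      finally show "v (Polynomial.coeff p i * x ^ i) \<le> v x ^ k" .
    qed (simp add: v_nonneg)
    then have "v x ^ n \<le> v x ^ k" using eq v_uminus v_power by metis
    then show False using gt Suc by simp
  qed
qed

lemma cauchyD: "x \<in> cauchy_seqs v \<Longrightarrow> e > 0 \<Longrightarrow> \<exists>N. \<forall>i\<ge>N. \<forall>j\<ge>N. v (x i - x j) < e"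
  by (simp add: cauchy_seqs_def)

lemma cauchyI: "(\<And>e. e > 0 \<Longrightarrow> \<exists>N. \<forall>i\<ge>N. \<forall>j\<ge>N. v (x i - x j) < e) \<Longrightarrow> x \<in> cauchy_seqs v"
  by (simp add: cauchy_seqs_def)

lemma null_iff: "x \<in> null_seqs v \<longleftrightarrow> (\<forall>e>0. \<exists>N. \<forall>i\<ge>N. v (x i) < e)"
  by (simp add: null_seqs_def LIMSEQ_iff v_nonneg)

lemma null_add:
  assumes "x \<in> null_seqs v" "y \<in> null_seqs v" shows "(\<lambda>i. x i + y i) \<in> null_seqs v"
  unfolding null_iff
proof (intro allI impI)
  fix e :: real assume "e > 0"
  then obtain N M where "\<forall>i\<ge>N. v (x i) < e" "\<forall>i\<ge>M. v (y i) < e" using assms unfolding null_iff by blast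
  then show "\<exists>N. \<forall>i\<ge>N. v (x i + y i) < e"
    by (intro exI[of _ "max N M"]) (auto intro: le_less_trans[OF v_add])
qed

lemma null_uminus: "x \<in> null_seqs v \<Longrightarrow> (\<lambda>i. - x i) \<in> null_seqs v"
  by (simp add: null_iff v_uminus)

lemma null_zero: "(\<lambda>i. 0) \<in> null_seqs v"
  by (auto simp: null_iff v_zero)

lemma null_imp_cauchy: assumes "x \<in> null_seqs v" shows "x \<in> cauchy_seqs v"
proof (rule cauchyI)
  fix e :: real assume "e > 0"
  then obtain N where "\<forall>i\<ge>N. v (x i) < e" using assms unfolding null_iff by blast
  then show "\<exists>N. \<forall>i\<ge>N. \<forall>j\<ge>N. v (x i - x j) < e"
    by (intro exI[of _ N]) (auto intro: le_less_trans[OF v_diff])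
qed

lemma cauchy_const: "(\<lambda>i. a) \<in> cauchy_seqs v"
  by (auto intro!: cauchyI simp: v_zero)

lemma cauchy_add:
  assumes "x \<in> cauchy_seqs v" "y \<in> cauchy_seqs v" shows "(\<lambda>i. x i + y i) \<in> cauchy_seqs v"
proof (rule cauchyI)
  fix e :: real assume "e > 0"
  then obtain N M where "\<forall>i\<ge>N. \<forall>j\<ge>N. v (x i - x j) < e" "\<forall>i\<ge>M. \<forall>j\<ge>M. v (y i - y j) < e"
    using assms cauchyD by meson
  then show "\<exists>N. \<forall>i\<ge>N. \<forall>j\<ge>N. v (x i + y i - (x j + y j)) < e"
    by (intro exI[of _ "max N M"]) (auto simp: add_diff_add intro!: le_less_trans[OF v_add])
qed

lemma cauchy_uminus: "x \<in> cauchy_seqs v \<Longrightarrow> (\<lambda>i. - x i) \<in> cauchy_seqs v"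
  unfolding cauchy_seqs_def by (simp add: v_minus_commute)

lemma cauchy_diff:
  "x \<in> cauchy_seqs v \<Longrightarrow> y \<in> cauchy_seqs v \<Longrightarrow> (\<lambda>i. x i - y i) \<in> cauchy_seqs v"
  using cauchy_add[OF _ cauchy_uminus, of x y] by simp

lemma cauchy_bounded:
  assumes "x \<in> cauchy_seqs v" shows "\<exists>M>0. \<forall>i. v (x i) \<le> M"
proof -
  obtain N where N: "\<forall>i\<ge>N. \<forall>j\<ge>N. v (x i - x j) < 1" using cauchyD[OF assms, of 1] by auto
  define M where "M = 1 + (\<Sum>i\<le>N. v (x i))"
  have le: "v (x i) \<le> M - 1" if "i \<le> N" for i
    using member_le_sum[of i "{..N}" "\<lambda>i. v (x i)"] that by (simp add: M_def v_nonneg)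
  have M1: "M \<ge> 1" by (simp add: M_def sum_nonneg v_nonneg)
  have "v (x i) \<le> M" for i
  proof (cases "i \<le> N")
    case False
    have "v (x i) = v ((x i - x N) + x N)" by simp
    also have "\<dots> \<le> max (v (x i - x N)) (v (x N))" by (rule v_add)
    also have "\<dots> \<le> M" using N[rule_format, of i N] False le[of N] M1 by simp
    finally show ?thesis .
  qed (use le[of i] in simp)
  then show ?thesis using M1 by (intro exI[of _ M]) auto
qed

lemma null_mult:
  assumes "x \<in> null_seqs v" "y \<in> cauchy_seqs v" shows "(\<lambda>i. x i * y i) \<in> null_seqs v"
  unfolding null_iff
proof (intro allI impI)
  fix e :: real assume "e > 0"
  obtain M where M: "M > 0" "\<forall>i. v (y i) \<le> M" using cauchy_bounded[OF assms(2)] by blast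
  then obtain N where N: "\<forall>i\<ge>N. v (x i) < e / M" using assms(1) \<open>e > 0\<close> unfolding null_iff by (meson divide_pos_pos)
  show "\<exists>N. \<forall>i\<ge>N. v (x i * y i) < e"
  proof (intro exI[of _ N] allI impI)
    fix i assume "i \<ge> N"
    have "v (x i * y i) \<le> v (x i) * M" unfolding v_mult using M(2) v_nonneg by (simp add: mult_left_mono)
    also have "\<dots> < e" using N \<open>i \<ge> N\<close> M(1) by (simp add: field_simps)
    finally show "v (x i * y i) < e" .
  qed
qed

lemma cauchy_mult:
  assumes x: "x \<in> cauchy_seqs v" and y: "y \<in> cauchy_seqs v" shows "(\<lambda>i. x i * y i) \<in> cauchy_seqs v"
proof (rule cauchyI)
  fix e :: real assume "e > 0"
  obtain M where M: "M > 0" "\<forall>i. v (y i) \<le> M" using cauchy_bounded[OF y] by blast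
  obtain L where L: "L > 0" "\<forall>i. v (x i) \<le> L" using cauchy_bounded[OF x] by blast
  obtain N where N: "\<forall>i\<ge>N. \<forall>j\<ge>N. v (x i - x j) < e / M" using cauchyD[OF x, of "e / M"] M(1) \<open>e > 0\<close> by auto
  obtain N' where N': "\<forall>i\<ge>N'. \<forall>j\<ge>N'. v (y i - y j) < e / L" using cauchyD[OF y, of "e / L"] L(1) \<open>e > 0\<close> by auto
  show "\<exists>N. \<forall>i\<ge>N. \<forall>j\<ge>N. v (x i * y i - x j * y j) < e"
  proof (intro exI[of _ "max N N'"] allI impI)
    fix i j assume ij: "i \<ge> max N N'" "j \<ge> max N N'"
    have "v ((x i - x j) * y i) \<le> v (x i - x j) * M" unfolding v_mult using M(2) v_nonneg by (simp add: mult_left_mono)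
    also have "\<dots> < e" using N ij M(1) by (simp add: field_simps)
    finally have 1: "v ((x i - x j) * y i) < e" .
    have "v (x j * (y i - y j)) \<le> L * v (y i - y j)" unfolding v_mult using L(2) v_nonneg by (simp add: mult_right_mono)
    also have "\<dots> < e" using N' ij L(1) by (simp add: field_simps)
    finally have 2: "v (x j * (y i - y j)) < e" .
    have "x i * y i - x j * y j = (x i - x j) * y i + x j * (y i - y j)" by (simp add: algebra_simps)
    then show "v (x i * y i - x j * y j) < e" using 1 2 v_add[of "(x i - x j) * y i" "x j * (y i - y j)"] by simp
  qed
qed

lemma cauchy_ring_simps [simp]:
  "carrier (cauchy_ring v) = cauchy_seqs v"
  "mult (cauchy_ring v) = (\<lambda>x y i. x i * y i)"
  "one (cauchy_ring v) = (\<lambda>i. 1)"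
  "zero (cauchy_ring v) = (\<lambda>i. 0)"
  "add (cauchy_ring v) = (\<lambda>x y i. x i + y i)"
  by (simp_all add: cauchy_ring_def)

definition seq_class :: "(nat \<Rightarrow> 'k) \<Rightarrow> (nat \<Rightarrow> 'k) set" where
  "seq_class x = a_r_coset (cauchy_ring v) (null_seqs v) x"

lemma cring_cauchy_ring: "cring (cauchy_ring v)"
proof (rule cringI)
  show "abelian_group (cauchy_ring v)"
  proof (rule abelian_groupI)
    fix x assume "x \<in> carrier (cauchy_ring v)"
    then show "\<exists>y\<in>carrier (cauchy_ring v). y \<oplus>\<^bsub>cauchy_ring v\<^esub> x = \<zero>\<^bsub>cauchy_ring v\<^esub>"
      by (intro bexI[of _ "\<lambda>i. - x i"]) (auto simp: cauchy_uminus)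
  qed (auto simp: cauchy_add cauchy_const add_ac)
  show "comm_monoid (cauchy_ring v)"
    by (rule comm_monoidI) (auto simp: cauchy_mult cauchy_const mult_ac)
qed (auto simp: distrib_right)

sublocale R: cring "cauchy_ring v" by (rule cring_cauchy_ring)

lemma a_inv_cauchy: "x \<in> cauchy_seqs v \<Longrightarrow> \<ominus>\<^bsub>cauchy_ring v\<^esub> x = (\<lambda>i. - x i)"
  by (rule R.minus_equality) (auto simp: cauchy_uminus)

lemma ideal_null: "ideal (null_seqs v) (cauchy_ring v)"
proof (rule idealI)
  show "ring (cauchy_ring v)" by (rule R.ring_axioms)
  show "subgroup (null_seqs v) (add_monoid (cauchy_ring v))"
  proof (rule group.subgroupI)
    show "group (add_monoid (cauchy_ring v))" by (rule R.a_group)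
    fix x y assume x: "x \<in> null_seqs v" and y: "y \<in> null_seqs v"
    show "inv\<^bsub>add_monoid (cauchy_ring v)\<^esub> x \<in> null_seqs v"
      using a_inv_cauchy[OF null_imp_cauchy[OF x]] null_uminus[OF x] by (simp add: a_inv_def)
    show "x \<otimes>\<^bsub>add_monoid (cauchy_ring v)\<^esub> y \<in> null_seqs v" using null_add[OF x y] by simp
  qed (use null_imp_cauchy null_zero in auto)
  fix a x assume "a \<in> null_seqs v" "x \<in> carrier (cauchy_ring v)"
  then have "(\<lambda>i. a i * x i) \<in> null_seqs v" by (intro null_mult) auto
  then show "x \<otimes>\<^bsub>cauchy_ring v\<^esub> a \<in> null_seqs v" "a \<otimes>\<^bsub>cauchy_ring v\<^esub> x \<in> null_seqs v"
    by (simp_all add: mult.commute)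
qed

sublocale I: ideal "null_seqs v" "cauchy_ring v" by (rule ideal_null)

lemma seq_class_altdef: "seq_class x = {(\<lambda>i. a i + x i) | a. a \<in> null_seqs v}"
  unfolding seq_class_def a_r_coset_def' by auto

lemma seq_class_eq_iff:
  "seq_class x = seq_class y \<longleftrightarrow> (\<lambda>i. x i - y i) \<in> null_seqs v"
proof
  assume "seq_class x = seq_class y"
  moreover have "x \<in> seq_class x" using null_zero by (force simp: seq_class_altdef)
  ultimately obtain a where "a \<in> null_seqs v" "x = (\<lambda>i. a i + y i)" by (auto simp: seq_class_altdef)
  then show "(\<lambda>i. x i - y i) \<in> null_seqs v" by simp
next
  have *: "seq_class x \<subseteq> seq_class y" if "(\<lambda>i. x i - y i) \<in> null_seqs v" for x y
  proof
    fix z assume "z \<in> seq_class x"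
    then obtain a where a: "a \<in> null_seqs v" "z = (\<lambda>i. a i + x i)" by (auto simp: seq_class_altdef)
    then have "(\<lambda>i. a i + (x i - y i)) \<in> null_seqs v" using null_add that by blast
    moreover have "z = (\<lambda>i. (a i + (x i - y i)) + y i)" using a(2) by auto
    ultimately show "z \<in> seq_class y"
      by (auto simp: seq_class_altdef intro!: exI[of _ "\<lambda>i. a i + (x i - y i)"])
  qed
  assume n: "(\<lambda>i. x i - y i) \<in> null_seqs v"
  then show "seq_class x = seq_class y" using *[OF n] *[of y x] null_uminus[OF n] by auto
qed

lemma to_completion_class: "to_completion v a = seq_class (\<lambda>i. a)"
  by (simp add: to_completion_def seq_class_def)

lemma ring_completion: "ring (completion v)"
  unfolding completion_def by (rule I.quotient_is_ring)

lemma seq_class_hom: "seq_class \<in> ring_hom (cauchy_ring v) (completion v)"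
proof -
  have "seq_class = a_r_coset (cauchy_ring v) (null_seqs v)" by (auto simp: seq_class_def)
  then show ?thesis unfolding completion_def using I.rcos_ring_hom by simp
qed

sublocale S: ring "completion v" by (rule ring_completion)

lemma seq_class_closed: "x \<in> cauchy_seqs v \<Longrightarrow> seq_class x \<in> carrier (completion v)"
  using ring_hom_closed[OF seq_class_hom, of x] by simp

lemma seq_class_add: "x \<in> cauchy_seqs v \<Longrightarrow> y \<in> cauchy_seqs v \<Longrightarrow>
    seq_class x \<oplus>\<^bsub>completion v\<^esub> seq_class y = seq_class (\<lambda>i. x i + y i)"
  using ring_hom_add[OF seq_class_hom, of x y] by simp

lemma seq_class_mult: "x \<in> cauchy_seqs v \<Longrightarrow> y \<in> cauchy_seqs v \<Longrightarrow>
    seq_class x \<otimes>\<^bsub>completion v\<^esub> seq_class y = seq_class (\<lambda>i. x i * y i)"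
  using ring_hom_mult[OF seq_class_hom, of x y] by simp

lemma seq_class_zero: "\<zero>\<^bsub>completion v\<^esub> = seq_class (\<lambda>i. 0)"
  by (auto simp: completion_def FactRing_def seq_class_altdef)

lemma seq_class_surj: "X \<in> carrier (completion v) \<Longrightarrow> \<exists>x\<in>cauchy_seqs v. X = seq_class x"
  by (auto simp: completion_def FactRing_def A_RCOSETS_def' seq_class_def)

lemma seq_class_diff:
  assumes "x \<in> cauchy_seqs v" "y \<in> cauchy_seqs v"
  shows "seq_class x \<ominus>\<^bsub>completion v\<^esub> seq_class y = seq_class (\<lambda>i. x i - y i)"
proof -
  have "\<ominus>\<^bsub>completion v\<^esub> seq_class y = seq_class (\<lambda>i. - y i)"
    by (rule S.minus_equality)
      (use assms cauchy_uminus in \<open>simp_all add: seq_class_add seq_class_zero seq_class_closed\<close>)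
  then show ?thesis using assms cauchy_uminus by (simp add: a_minus_def seq_class_add)
qed

lemma cauchy_sum:
  "(\<And>k. k \<in> A \<Longrightarrow> f k \<in> cauchy_seqs v) \<Longrightarrow> (\<lambda>i. \<Sum>k\<in>A. f k i) \<in> cauchy_seqs v"
  by (induction A rule: infinite_finite_induct) (auto simp: cauchy_const intro: cauchy_add)

lemma seq_class_finsum:
  assumes "finite A" "\<And>k. k \<in> A \<Longrightarrow> f k \<in> cauchy_seqs v"
  shows "(\<Oplus>\<^bsub>completion v\<^esub>k\<in>A. seq_class (f k)) = seq_class (\<lambda>i. \<Sum>k\<in>A. f k i)"
  using assms
proof (induction A)
  case (insert a A)
  then have "(\<Oplus>\<^bsub>completion v\<^esub>k\<in>insert a A. seq_class (f k)) = seq_class (f a) \<oplus>\<^bsub>completion v\<^esub> (\<Oplus>\<^bsub>completion v\<^esub>k\<in>A. seq_class (f k))"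
    by (intro S.finsum_insert) (auto intro: seq_class_closed)
  then show ?case using insert by (simp add: seq_class_add cauchy_sum)
qed (simp add: seq_class_zero)

lemma v_cauchy_convergent:
  assumes "x \<in> cauchy_seqs v" shows "convergent (\<lambda>i. v (x i))"
proof (rule Cauchy_convergent, rule metric_CauchyI)
  fix e :: real assume "e > 0"
  then obtain N where N: "\<forall>i\<ge>N. \<forall>j\<ge>N. v (x i - x j) < e" using cauchyD[OF assms] by blast
  have le: "v a - v b \<le> v (a - b)" for a b
  proof -
    have "v a \<le> max (v (a - b)) (v b)" using v_add[of "a - b" b] by simp
    also have "\<dots> \<le> v (a - b) + v b" using v_nonneg[of b] v_nonneg[of "a - b"] by simp
    finally show ?thesis by simp
  qed
  have dist: "\<bar>v (x i) - v (x j)\<bar> \<le> v (x i - x j)" for i j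
    using le[of "x i" "x j"] le[of "x j" "x i"] v_minus_commute[of "x i" "x j"] by simp
  show "\<exists>M. \<forall>m\<ge>M. \<forall>n\<ge>M. dist (v (x m)) (v (x n)) < e"
    using N unfolding dist_real_def by (intro exI[of _ N] allI impI) (rule le_less_trans[OF dist], blast)
qed

lemma completion_abs_class:
  assumes "(\<lambda>i. v (x i)) \<longlonglongrightarrow> l" shows "completion_abs v (seq_class x) = l"
  unfolding completion_abs_def
proof (rule the_equality)
  show "\<forall>y\<in>seq_class x. (\<lambda>i. v (y i)) \<longlonglongrightarrow> l"
  proof
    fix y assume "y \<in> seq_class x"
    then obtain a where a: "a \<in> null_seqs v" "y = (\<lambda>i. a i + x i)" by (auto simp: seq_class_altdef)
    have le: "\<bar>v (b + c) - v c\<bar> \<le> v b" for b c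
    proof -
      have "v (b + c) \<le> v b + v c" using v_add[of b c] v_nonneg[of b] v_nonneg[of c] by linarith
      moreover have "v c \<le> v (b + c) + v b"
        using v_diff[of "b + c" b] v_nonneg[of b] v_nonneg[of "b + c"] by simp
      ultimately show ?thesis by linarith
    qed
    have "(\<lambda>i. v (a i + x i) - v (x i)) \<longlonglongrightarrow> 0"
    proof (rule tendsto_0_le)
      show "eventually (\<lambda>i. norm (v (a i + x i) - v (x i)) \<le> norm (v (a i)) * 1) sequentially"
        using le v_nonneg by simp
      show "(\<lambda>i. v (a i)) \<longlonglongrightarrow> 0" using a(1) by (simp add: null_seqs_def)
    qed
    from tendsto_add[OF this assms] show "(\<lambda>i. v (y i)) \<longlonglongrightarrow> l" using a(2) by simp
  qed
  fix l' assume "\<forall>y\<in>seq_class x. (\<lambda>i. v (y i)) \<longlonglongrightarrow> l'"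
  moreover have "x \<in> seq_class x" using null_zero by (force simp: seq_class_altdef)
  ultimately show "l' = l" using assms LIMSEQ_unique by blast
qed

text \<open>The distance of the \<open>N\<close>-th partial sum from the limit is itself the limit
  of \<open>v (s N - t i)\<close> over \<open>i\<close>; for Cauchy sequences it tends to 0 exactly
  if the diagonal \<open>s i - t i\<close> does. A series with terms from the field is thus
  represented by its own sequence of partial sums.\<close>

lemma completion_sums_class_iff:
  assumes f: "\<And>N. (\<lambda>i. s N) \<in> cauchy_seqs v" and s: "s \<in> cauchy_seqs v"
    and partial: "\<And>N. (\<Oplus>\<^bsub>completion v\<^esub>k\<in>{..<N}. f k) = seq_class (\<lambda>i. s N)"
    and t: "t \<in> cauchy_seqs v"
  shows "completion_sums v f (seq_class t) \<longleftrightarrow> (\<lambda>i. s i - t i) \<in> null_seqs v"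
proof -
  define l where "l = (\<lambda>N. lim (\<lambda>i. v (s N - t i)))"
  have l: "(\<lambda>i. v (s N - t i)) \<longlonglongrightarrow> l N" for N
    using v_cauchy_convergent[OF cauchy_diff[OF cauchy_const[of "s N"] t]]
    by (simp add: l_def convergent_LIMSEQ_iff)
  have "completion_abs v ((\<Oplus>\<^bsub>completion v\<^esub>k\<in>{..<N}. f k) \<ominus>\<^bsub>completion v\<^esub> seq_class t) = l N" for N
    unfolding partial seq_class_diff[OF cauchy_const t] by (rule completion_abs_class[OF l])
  then have iff: "completion_sums v f (seq_class t) \<longleftrightarrow> l \<longlonglongrightarrow> 0"
    using t by (simp add: completion_sums_def seq_class_closed)
  have l0: "l N \<ge> 0" for N using l v_nonneg by (intro LIMSEQ_le_const[OF l]) auto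
  show ?thesis
    unfolding iff
  proof
    assume lim: "l \<longlonglongrightarrow> 0"
    show "(\<lambda>i. s i - t i) \<in> null_seqs v"
      unfolding null_iff
    proof (intro allI impI)
      fix e :: real assume e: "e > 0"
      obtain N1 where N1: "\<forall>i\<ge>N1. \<forall>j\<ge>N1. v (s i - s j) < e" using cauchyD[OF s e] by blast
      have "eventually (\<lambda>N. l N < e) sequentially" using order_tendstoD(2)[OF lim e] .
      then obtain N2 where N2: "\<And>N. N \<ge> N2 \<Longrightarrow> l N < e" by (auto simp: eventually_sequentially)
      define N where "N = max N1 N2"
      have "eventually (\<lambda>i. v (s N - t i) < e) sequentially"
        by (rule order_tendstoD(2)[OF l]) (simp add: N2 N_def)
      then obtain N3 where N3: "\<And>i. i \<ge> N3 \<Longrightarrow> v (s N - t i) < e" by (auto simp: eventually_sequentially)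
      have "v (s i - t i) < e" if "i \<ge> max N N3" for i
      proof -
        have "s i - t i = (s i - s N) + (s N - t i)" by simp
        then have "v (s i - t i) \<le> max (v (s i - s N)) (v (s N - t i))" using v_add by metis
        also have "\<dots> < e" using N1 N3 that by (simp add: N_def)
        finally show ?thesis .
      qed
      then show "\<exists>N. \<forall>i\<ge>N. v (s i - t i) < e" by blast
    qed
  next
    assume null: "(\<lambda>i. s i - t i) \<in> null_seqs v"
    show "l \<longlonglongrightarrow> 0"
      unfolding LIMSEQ_iff
    proof (intro allI impI)
      fix e :: real assume e: "e > 0"
      then have e2: "e / 2 > 0" by simp
      obtain N1 where N1: "\<forall>i\<ge>N1. \<forall>j\<ge>N1. v (s i - s j) < e / 2" using cauchyD[OF s e2] by blast
      obtain N2 where N2: "\<forall>i\<ge>N2. v (s i - t i) < e / 2" using null e2 unfolding null_iff by blast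
      have "l N \<le> e / 2" if "N \<ge> N1" for N
      proof (rule LIMSEQ_le_const2[OF l], intro exI[of _ "max N1 N2"] allI impI)
        fix i assume i: "i \<ge> max N1 N2"
        have "s N - t i = (s N - s i) + (s i - t i)" by simp
        then have "v (s N - t i) \<le> max (v (s N - s i)) (v (s i - t i))" using v_add by metis
        also have "\<dots> \<le> e / 2" using N1[rule_format, of N i] N2[rule_format, of i] i that by simp
        finally show "v (s N - t i) \<le> e / 2" .
      qed
      moreover have "e / 2 < e" using e by simp
      ultimately have "norm (l N - 0) < e" if "N \<ge> N1" for N
        using that l0[of N] by (metis abs_of_nonneg diff_zero le_less_trans real_norm_def)
      then show "\<exists>no. \<forall>n\<ge>no. norm (l n - 0) < e" by blast
    qed
  qed
qed

end

section \<open>Factorials at a p-adic place\<close>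

lemma power_dvd_fact: "p > 0 \<Longrightarrow> p ^ (k div p) dvd (fact k :: nat)"
proof -
  assume p: "p > 0"
  have "p ^ j dvd (fact (j * p) :: nat)" for j
  proof (induction j)
    case (Suc j)
    have "p * p ^ j dvd fact p * (fact (j * p) :: nat)"
      using Suc p by (intro mult_dvd_mono) (auto intro: dvd_fact)
    also have "\<dots> dvd fact (p + j * p)" by (rule fact_fact_dvd_fact)
    finally show ?case by simp
  qed simp
  then have "p ^ (k div p) dvd (fact (k div p * p) :: nat)" .
  also have "\<dots> dvd fact k" by (rule fact_dvd) simp
  finally show ?thesis .
qed

lemma lies_over_of_nat_p:
  fixes v :: "'k::field_char_0 \<Rightarrow> real"
  assumes "lies_over v p" "prime p" shows "v (of_nat p) = 1 / real p"
proof -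
  have "v (of_nat p) = padic_abs p (of_nat p)" using assms(1) unfolding lies_over_def by (metis of_rat_of_nat_eq)
  also have "quotient_of (of_nat p) = (int p, 1)" by (simp add: of_nat_rat quotient_of_Fract Rat.normalize_def)
  then have "padic_abs p (of_nat p) = real p powi (- 1)"
    using assms(2) prime_gt_0_nat[OF assms(2)] by (simp add: padic_abs_def)
  finally show ?thesis by (simp add: power_int_minus divide_inverse)
qed

locale padic_place = nonarch_abs v for v :: "'k::field_char_0 \<Rightarrow> real" +
  fixes p :: nat
  assumes prime: "prime p" and over: "lies_over v p"
begin

lemma v_p: "v (of_nat p) = 1 / real p"
  using lies_over_of_nat_p[OF over prime] .

lemma v_fact_null: "(\<lambda>k. v (fact k)) \<longlonglongrightarrow> 0"
proof (rule tendsto_0_le)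
  have p2: "p \<ge> 2" using prime prime_ge_2_nat by blast
  have "v (fact k) \<le> (1 / 2) ^ (k div p)" for k
  proof -
    obtain c where c: "fact k = p ^ (k div p) * c" using power_dvd_fact[of p k] p2 by (auto elim: dvdE)
    have "(fact k :: 'k) = of_nat (p ^ (k div p) * c)" using c by (metis of_nat_fact)
    then have "v (fact k) = (1 / real p) ^ (k div p) * v (of_nat c)"
      by (simp only: of_nat_mult of_nat_power v_mult v_power v_p)
    also have "\<dots> \<le> (1 / 2) ^ (k div p) * 1"
      using p2 by (intro mult_mono power_mono v_of_nat_le_1) (auto simp: v_nonneg field_simps)
    finally show ?thesis by simp
  qed
  then show "eventually (\<lambda>k. norm (v (fact k)) \<le> norm ((1 / 2) ^ (k div p) :: real) * 1) sequentially"
    by (simp add: v_nonneg)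
  have "filterlim (\<lambda>k. k div p) sequentially sequentially"
    unfolding filterlim_at_top
  proof
    fix Z show "eventually (\<lambda>k. Z \<le> k div p) sequentially"
      using eventually_ge_at_top[of "Z * p"] by eventually_elim (use p2 in \<open>simp add: less_eq_div_iff_mult_less_eq\<close>)
  qed
  moreover have "(\<lambda>j. (1 / 2) ^ j :: real) \<longlonglongrightarrow> 0" by (rule LIMSEQ_realpow_zero) auto
  ultimately show "(\<lambda>k. (1 / 2) ^ (k div p) :: real) \<longlonglongrightarrow> 0"
    by (rule filterlim_compose[rotated])
qed

end


section \<open>Pade approximations\<close>

lemma sum_coeff_times_upto:
  fixes p :: "'a::comm_ring_1 poly"
  assumes "degree p \<le> N"
  shows "(\<Sum>i\<le>degree p. Polynomial.coeff p i * f i) = (\<Sum>i\<le>N. Polynomial.coeff p i * f i)"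
  by (rule sum.mono_neutral_left) (use assms in \<open>auto simp: coeff_eq_0\<close>)

lemma pderiv_sum_poly: "pderiv (sum f A) = (\<Sum>i\<in>A. pderiv (f i))"
  by (induction A rule: infinite_finite_induct) (auto simp: pderiv_add)

lemma prod_linear_dvd:
  fixes a :: "'i \<Rightarrow> 'a::field"
  assumes "finite J" "inj_on a J" "\<And>j. j \<in> J \<Longrightarrow> poly p (a j) = 0"
  shows "(\<Prod>j\<in>J. [:- a j, 1:]) dvd p"
  using assms
proof (induction J)
  case (insert j J)
  then obtain q where q: "p = (\<Prod>j\<in>J. [:- a j, 1:]) * q"
    unfolding dvd_def by auto
  have "poly (\<Prod>i\<in>J. [:- a i, 1:]) (a j) \<noteq> 0"
    using insert by (auto simp: poly_prod)
  then have "poly q (a j) = 0" using insert(5)[of j] q by simp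
  then have "[:- a j, 1:] dvd q" by (simp only: poly_eq_0_iff_dvd)
  then obtain r where "q = [:- a j, 1:] * r" unfolding dvd_def by blast
  then have "p = (\<Prod>i\<in>insert j J. [:- a i, 1:]) * r"
    unfolding q prod.insert[OF insert(1,2)] by (simp only: mult_ac)
  then show ?case by (rule dvdI)
qed simp

lemma higher_pderiv_root:
  fixes f :: "'a::field_char_0 poly"
  assumes "[:- a, 1:] ^ l dvd f" "u < l"
  shows "poly ((pderiv ^^ u) f) a = 0"
proof -
  define L where "L = [:- a, 1:]"
  have pL: "pderiv L = 1" by (simp add: L_def pderiv_pCons one_pCons)
  have step: "L ^ k dvd pderiv g" if dvd: "L ^ Suc k dvd g" for k and g :: "'a poly"
  proof -
    obtain q where q: "g = L ^ Suc k * q" using dvd unfolding dvd_def by blast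
    have "pderiv g = L ^ k * (L * pderiv q + Polynomial.smult (of_nat (Suc k)) q)"
      unfolding q pderiv_mult pderiv_power_Suc pL by (simp add: algebra_simps del: of_nat_Suc)
    then show ?thesis by (rule dvdI)
  qed
  have "L ^ (l - u) dvd (pderiv ^^ u) f" if "u \<le> l" for u
    using that
  proof (induction u)
    case (Suc u)
    then have "L ^ (l - u) dvd (pderiv ^^ u) f" "l - u = Suc (l - Suc u)" by simp_all
    then show ?case using step[of "l - Suc u" "(pderiv ^^ u) f"] by simp
  qed (use assms in \<open>simp add: L_def\<close>)
  from this[of u] have "L ^ (l - u) dvd (pderiv ^^ u) f" using assms(2) by simp
  moreover have "L dvd L ^ (l - u)" using assms(2) by (intro dvd_power) simp
  ultimately show ?thesis unfolding poly_eq_0_iff_dvd L_def[symmetric] by (rule dvd_trans[rotated])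
qed

text \<open>The sum is the \<open>u\<close>-th derivative at \<open>a\<close> of \<open>C\<close>
  times the \<open>u\<close>-th power of the variable, and this product keeps the zero of order
  \<open>l > u\<close>.\<close>

lemma sum_coeff_fact_ratio_eq_0:
  fixes C :: "'a::field_char_0 poly"
  assumes "[:- a, 1:] ^ l dvd C" "u < l" "degree C \<le> M"
  shows "(\<Sum>i\<le>M. Polynomial.coeff C i * (fact (i + u) / fact i) * a ^ i) = 0"
proof -
  let ?f = "Polynomial.monom 1 u * C"
  have "[:- a, 1:] ^ l dvd ?f" using assms(1) by (rule dvd_mult)
  then have 0: "poly ((pderiv ^^ u) ?f) a = 0" using higher_pderiv_root assms(2) by blast
  have c: "Polynomial.coeff ((pderiv ^^ u) ?f) i = Polynomial.coeff C i * (fact (i + u) / fact i)" for i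
  proof -
    have "pochhammer (of_nat (Suc i)) u = (fact (i + u) / fact i :: 'a)"
    proof -
      have "(fact (i + u) :: 'a) = fact i * pochhammer (of_nat (Suc i)) u"
        by (induction u) (simp_all add: pochhammer_Suc algebra_simps)
      then show ?thesis by simp
    qed
    then show ?thesis by (simp add: coeff_higher_pderiv coeff_monom_mult)
  qed
  have "degree ((pderiv ^^ u) ?f) \<le> M"
  proof (rule degree_le, intro allI impI)
    fix i assume "i > M"
    then show "Polynomial.coeff ((pderiv ^^ u) ?f) i = 0" unfolding c using assms(3) by (simp add: coeff_eq_0)
  qed
  then have "poly ((pderiv ^^ u) ?f) a = (\<Sum>i\<le>M. Polynomial.coeff ((pderiv ^^ u) ?f) i * a ^ i)"
    unfolding poly_altdef by (rule sum_coeff_times_upto)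
  then show ?thesis using 0 by (simp add: c)
qed

locale factorial_series_form =
  fixes m :: nat and lam al :: "nat \<Rightarrow> 'k::field_char_0"
  assumes al_nonzero: "\<And>j. j \<in> {1..m} \<Longrightarrow> al j \<noteq> 0" and al_inj: "inj_on al {1..m}"
begin

definition partial_form :: "nat \<Rightarrow> 'k" where
  "partial_form N = lam 0 + (\<Sum>j=1..m. lam j * (\<Sum>h<N. fact h * al j ^ h))"

definition functional :: "'k poly \<Rightarrow> 'k" where
  "functional p = (\<Sum>i\<le>degree p. Polynomial.coeff p i * (partial_form i / fact i))"

definition node_poly :: "'k poly" where
  "node_poly = (\<Prod>j\<in>{1..m}. [:- al j, 1:])"

text \<open>Lagrange basis polynomials without normalisation, hence the divisions by their value at
  the node later on.\<close>

definition lagrange_poly :: "nat \<Rightarrow> 'k poly" where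
  "lagrange_poly j = (\<Prod>i\<in>{1..m} - {j}. [:- al i, 1:])"

lemma functional_upto:
  "degree p \<le> N \<Longrightarrow> functional p = (\<Sum>i\<le>N. Polynomial.coeff p i * (partial_form i / fact i))"
  unfolding functional_def by (rule sum_coeff_times_upto)

lemma functional_add: "functional (p + q) = functional p + functional q"
proof -
  define N where "N = max (degree p) (degree q)"
  have "degree (p + q) \<le> N" "degree p \<le> N" "degree q \<le> N"
    unfolding N_def using degree_add_le_max by auto
  then show ?thesis by (simp only: functional_upto[of _ N] coeff_add distrib_right sum.distrib)
qed

lemma functional_smult: "functional (Polynomial.smult c p) = c * functional p"
proof -
  have "functional (Polynomial.smult c p) =
      (\<Sum>i\<le>degree p. Polynomial.coeff (Polynomial.smult c p) i * (partial_form i / fact i))"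
    by (rule functional_upto) (rule degree_smult_le)
  also have "\<dots> = c * functional p"
    unfolding functional_def sum_distrib_left coeff_smult by (simp only: mult.assoc)
  finally show ?thesis .
qed

lemma functional_minus: "functional (p - q) = functional p - functional q"
proof -
  have "p - q = p + Polynomial.smult (-1) q" by simp
  then show ?thesis by (simp only: functional_add functional_smult) simp
qed

lemma functional_zero: "functional 0 = 0"
  by (simp add: functional_def)

lemma functional_sum: "functional (sum f A) = (\<Sum>i\<in>A. functional (f i))"
  by (induction A rule: infinite_finite_induct) (auto simp: functional_add functional_zero)

lemma functional_monom: "functional (Polynomial.monom c i) = c * (partial_form i / fact i)"
proof -
  have "functional (Polynomial.monom c i) = (\<Sum>k\<le>i. Polynomial.coeff (Polynomial.monom c i) k * (partial_form k / fact k))"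
    by (rule functional_upto) (rule degree_monom_le)
  also have "\<dots> = (\<Sum>k\<le>i. if k = i then c * (partial_form i / fact i) else 0)"
    by (rule sum.cong) auto
  finally show ?thesis by simp
qed

text \<open>Formally, the functional is a sum of integrals against \<open>exp (- 1 / w)\<close>; this is integration by parts.\<close>
lemma functional_by_parts:
  "functional (Polynomial.monom 1 2 * pderiv p + [:-1, 1:] * p) = (\<Sum>j=1..m. lam j * poly p (al j))"
proof -
  \<comment> \<open>On a monomial of degree \<open>i\<close> the operator gives degrees
    \<open>i + 1\<close> and \<open>i\<close> with coefficients \<open>(i + 1) * c\<close> and
    \<open>- c\<close>. The functional turns these into
    \<open>c * (S\<^sub>i\<^sub>+\<^sub>1 - S\<^sub>i) / i!\<close>, and the difference of partial
    forms is the single term of index \<open>i\<close>, whose \<open>i!\<close> cancels.\<close>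
  have mono: "functional (Polynomial.monom 1 2 * pderiv (Polynomial.monom c i) + [:-1, 1:] * Polynomial.monom c i) =
      (\<Sum>j=1..m. lam j * poly (Polynomial.monom c i) (al j))" for c i
  proof -
    have eq: "Polynomial.monom 1 2 * pderiv (Polynomial.monom c i) + [:-1, 1:] * Polynomial.monom c i =
        Polynomial.monom (of_nat (Suc i) * c) (Suc i) - Polynomial.monom c i"
    proof -
      have "Polynomial.monom 1 2 * pderiv (Polynomial.monom c i) = Polynomial.monom (of_nat i * c) (Suc i)"
        by (cases i) (simp_all add: pderiv_monom mult_monom)
      moreover have "[:-1, 1:] * Polynomial.monom c i = Polynomial.monom c (Suc i) - Polynomial.monom c i"
        by (simp add: monom_Suc)
      ultimately show ?thesis by (simp add: add_monom[symmetric] algebra_simps)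
    qed
    have "functional (Polynomial.monom 1 2 * pderiv (Polynomial.monom c i) + [:-1, 1:] * Polynomial.monom c i) =
        c * ((partial_form (Suc i) - partial_form i) / fact i)"
    proof -
      have "of_nat (Suc i) * c * (x / fact (Suc i)) = c * (x / fact i)" for x :: 'k
        by (simp add: fact_Suc del: of_nat_Suc)
      then show ?thesis unfolding eq
        by (simp only: functional_minus functional_monom diff_divide_distrib right_diff_distrib)
    qed
    also have "partial_form (Suc i) - partial_form i = (\<Sum>j=1..m. lam j * (fact i * al j ^ i))"
      unfolding partial_form_def by (simp add: sum_subtractf[symmetric] algebra_simps)
    also have "c * ((\<Sum>j=1..m. lam j * (fact i * al j ^ i)) / fact i) = (\<Sum>j=1..m. lam j * poly (Polynomial.monom c i) (al j))"
      by (simp add: sum_divide_distrib sum_distrib_left poly_monom mult_ac)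
    finally show ?thesis .
  qed
  define q where "q = (\<lambda>i. Polynomial.monom (Polynomial.coeff p i) i)"
  have p: "p = (\<Sum>i\<le>degree p. q i)" unfolding q_def by (rule poly_as_sum_of_monoms[symmetric])
  have "Polynomial.monom 1 2 * pderiv p + [:-1, 1:] * p =
      (\<Sum>i\<le>degree p. Polynomial.monom 1 2 * pderiv (q i) + [:-1, 1:] * q i)"
    by (subst (1 2) p) (simp only: pderiv_sum_poly sum_distrib_left sum.distrib)
  then have "functional (Polynomial.monom 1 2 * pderiv p + [:-1, 1:] * p) =
      (\<Sum>i\<le>degree p. \<Sum>j=1..m. lam j * poly (q i) (al j))"
    by (simp only: functional_sum q_def mono)
  also have "\<dots> = (\<Sum>j=1..m. lam j * poly (\<Sum>i\<le>degree p. q i) (al j))"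
    by (subst sum.swap) (simp add: poly_sum sum_distrib_left)
  finally show ?thesis by (simp only: p[symmetric])
qed

lemma node_poly_split: "j \<in> {1..m} \<Longrightarrow> node_poly = [:- al j, 1:] * lagrange_poly j"
  unfolding node_poly_def lagrange_poly_def
  using prod.remove[of "{1..m}" j "\<lambda>i. [:- al i, 1:]"] by blast

lemma poly_node_poly: "j \<in> {1..m} \<Longrightarrow> poly node_poly (al j) = 0"
  unfolding node_poly_split poly_mult by simp

lemma poly_lagrange_poly: "i \<in> {1..m} \<Longrightarrow> i \<noteq> j \<Longrightarrow> poly (lagrange_poly j) (al i) = 0"
  unfolding lagrange_poly_def poly_prod by (intro prod_zero) (auto intro!: bexI[of _ i])

lemma poly_lagrange_poly_nonzero: "j \<in> {1..m} \<Longrightarrow> poly (lagrange_poly j) (al j) \<noteq> 0"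
proof -
  assume j: "j \<in> {1..m}"
  have "poly [:- al i, 1:] (al j) \<noteq> 0" if "i \<in> {1..m} - {j}" for i
    using that j inj_onD[OF al_inj, of i j] by auto
  then show ?thesis unfolding lagrange_poly_def poly_prod by (simp only: prod_zero_iff finite_Diff finite_atLeastAtMost) blast
qed

lemma pderiv_node_poly: "j \<in> {1..m} \<Longrightarrow> poly (pderiv node_poly) (al j) = poly (lagrange_poly j) (al j)"
proof -
  assume j: "j \<in> {1..m}"
  have "poly (pderiv ([:- al j, 1:] * q)) (al j) = poly q (al j)" for q
    unfolding pderiv_mult poly_add poly_mult by (simp add: pderiv_pCons)
  then show ?thesis by (simp only: node_poly_split[OF j])
qed

lemma degree_prod_linear: "finite J \<Longrightarrow> degree (\<Prod>i\<in>J. [:- al i, 1:]) = card J"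
proof (induction J rule: finite_induct)
  case (insert a J)
  have "(\<Prod>i\<in>J. [:- al i, 1:]) \<noteq> 0" using insert(1) by (simp only: prod_zero_iff) simp
  then have "degree ([:- al a, 1:] * (\<Prod>i\<in>J. [:- al i, 1:])) = degree [:- al a, 1:] + degree (\<Prod>i\<in>J. [:- al i, 1:])"
    by (intro degree_mult_eq) simp_all
  then show ?case using insert by (simp only: prod.insert card_insert_disjoint) simp
qed simp

lemma degree_node_poly: "degree node_poly = m"
  unfolding node_poly_def using degree_prod_linear[of "{1..m}"] by simp

lemma degree_lagrange_poly: "j \<in> {1..m} \<Longrightarrow> degree (lagrange_poly j) = m - 1"
  unfolding lagrange_poly_def using degree_prod_linear[of "{1..m} - {j}"] by simp

lemma node_poly_nonzero: "node_poly \<noteq> 0"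
  unfolding node_poly_def by (simp only: prod_zero_iff finite_atLeastAtMost) simp

text \<open>Since \<open>w\<^sup>2 G'\<close> does not vanish at the nodes, \<open>Q\<close> is congruent modulo \<open>G\<close> to a multiple of \<open>w\<^sup>2 G'\<close>;
  integration by parts applied to \<open>G\<^bsup>l+1\<^esup> P\<close> then removes one factor \<open>G\<close>.\<close>
lemma functional_descent:
  assumes van: "\<And>P. degree P \<le> m \<Longrightarrow> functional (node_poly ^ Suc l * P) = 0"
    and Q: "degree Q \<le> m"
  shows "functional (node_poly ^ l * Q) = 0"
proof (cases "m = 0")
  case True
  have "node_poly = 1" using True unfolding node_poly_def by simp
  then show ?thesis using van[OF Q] by simp
next
  case False
  define G where "G = node_poly"
  \<comment> \<open>Interpolation: \<open>P\<close> is chosen such that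
    \<open>Suc l * w\<^sup>2 G' P\<close> takes the values of \<open>Q\<close> at the nodes. The
    denominators are non-zero since the nodes are non-zero and distinct.\<close>
  define P where "P = (\<Sum>j\<in>{1..m}. Polynomial.smult (poly Q (al j) / (of_nat (Suc l) * al j ^ 2 * poly (pderiv G) (al j) * poly (lagrange_poly j) (al j))) (lagrange_poly j))"
  have Pj: "of_nat (Suc l) * al j ^ 2 * poly (pderiv G) (al j) * poly P (al j) = poly Q (al j)" if j: "j \<in> {1..m}" for j
  proof -
    have "poly P (al j) = (\<Sum>i\<in>{1..m}. if i = j then poly Q (al j) / (of_nat (Suc l) * al j ^ 2 * poly (pderiv G) (al j)) else 0)"
      unfolding P_def poly_sum poly_smult
    proof (rule sum.cong[OF refl])
      fix i assume i: "i \<in> {1..m}"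
      show "poly Q (al i) / (of_nat (Suc l) * al i ^ 2 * poly (pderiv G) (al i) * poly (lagrange_poly i) (al i)) * poly (lagrange_poly i) (al j) =
          (if i = j then poly Q (al j) / (of_nat (Suc l) * al j ^ 2 * poly (pderiv G) (al j)) else 0)"
        using poly_lagrange_poly[OF j, of i] poly_lagrange_poly_nonzero[OF j]
        by (cases "i = j") (simp_all del: of_nat_Suc)
    qed
    also have "\<dots> = poly Q (al j) / (of_nat (Suc l) * al j ^ 2 * poly (pderiv G) (al j))" using j by simp
    finally show ?thesis
      using al_nonzero[OF j] pderiv_node_poly[OF j] poly_lagrange_poly_nonzero[OF j] by (simp add: G_def del: of_nat_Suc)
  qed
  have degP: "degree P \<le> m - 1"
    unfolding P_def by (intro degree_sum_le) (auto intro: order.trans[OF degree_smult_le] simp: degree_lagrange_poly)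
  define E where "E = Polynomial.smult (of_nat (Suc l)) (Polynomial.monom 1 2 * pderiv G * P)"
  have "poly (E - Q) (al j) = 0" if "j \<in> {1..m}" for j
    using Pj[OF that] by (simp add: E_def poly_monom mult.assoc del: of_nat_Suc)
  then have "G dvd E - Q" unfolding G_def node_poly_def using al_inj by (intro prod_linear_dvd) auto
  then obtain T where T: "E - Q = G * T" by (auto elim: dvdE)
  \<comment> \<open>The degrees are balanced here: \<open>E\<close> has degree at most
    \<open>2 + (m - 1) + (m - 1) = 2 * m\<close>, and division by \<open>G\<close> brings this back
    to \<open>m\<close>, the bound under which vanishing is assumed.\<close>
  have "degree T \<le> m"
  proof (cases "T = 0")
    case nz: False
    have "degree (Polynomial.monom 1 2 * pderiv G * P) \<le> degree (Polynomial.monom (1::'k) 2 * pderiv G) + degree P"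
      by (rule degree_mult_le)
    also have "degree (Polynomial.monom (1::'k) 2 * pderiv G) \<le> degree (Polynomial.monom (1::'k) 2) + degree (pderiv G)"
      by (rule degree_mult_le)
    finally have "degree (Polynomial.monom 1 2 * pderiv G * P) \<le> 2 + (m - 1) + (m - 1)"
      using degP degree_pderiv[of G] by (simp add: degree_monom_eq G_def degree_node_poly)
    then have "degree E \<le> 2 * m"
      unfolding E_def using False by (intro order.trans[OF degree_smult_le]) simp
    then have "degree (E - Q) \<le> 2 * m" using Q by (intro degree_diff_le) auto
    then have "degree (G * T) \<le> 2 * m" using T by simp
    then show ?thesis using nz node_poly_nonzero by (simp add: degree_mult_eq G_def degree_node_poly)
  qed simp
  then have fT: "functional (G ^ Suc l * T) = 0" using van by (simp add: G_def)
  define U where "U = Polynomial.monom 1 2 * pderiv P + [:-1, 1:] * P"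
  have "degree U \<le> m"
  proof -
    have "degree (Polynomial.monom 1 2 * pderiv P) \<le> m"
    proof (cases "degree P = 0")
      case True
      then show ?thesis by (simp add: pderiv_eq_0_iff[THEN iffD2])
    next
      case nz: False
      have "degree (Polynomial.monom 1 2 * pderiv P) \<le> 2 + degree (pderiv P)"
        using degree_mult_le[of "Polynomial.monom (1::'k) 2" "pderiv P"] by (simp add: degree_monom_eq)
      also have "\<dots> \<le> m" using degP degree_pderiv[of P] nz by simp
      finally show ?thesis .
    qed
    moreover have "degree ([:-1, 1:] * P) \<le> m"
      using degree_mult_le[of "[:-1, 1:]" P] degP False by simp
    ultimately show ?thesis unfolding U_def by (intro degree_add_le)
  qed
  then have fU: "functional (G ^ Suc l * U) = 0" using van by (simp add: G_def)
  have parts: "Polynomial.monom 1 2 * pderiv (G ^ Suc l * P) + [:-1, 1:] * (G ^ Suc l * P) = G ^ l * E + G ^ Suc l * U"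
  proof -
    have "X2 * pderiv (G ^ Suc l * P) + X1 * (G ^ Suc l * P) =
        G ^ l * Polynomial.smult (of_nat (Suc l)) (X2 * pderiv G * P) + G ^ Suc l * (X2 * pderiv P + X1 * P)" for X1 X2
      unfolding pderiv_mult pderiv_power_Suc by (simp add: algebra_simps del: of_nat_Suc)
    then show ?thesis unfolding E_def U_def .
  qed
  have "functional (G ^ l * E + G ^ Suc l * U) = (\<Sum>j=1..m. lam j * poly (G ^ Suc l * P) (al j))"
    unfolding parts[symmetric] by (rule functional_by_parts)
  \<comment> \<open>The boundary values vanish since \<open>G ^ Suc l * P\<close> still has a factor
    \<open>G\<close>.\<close>
  also have "\<dots> = 0" by (rule sum.neutral) (simp add: G_def poly_node_poly)
  finally have "functional (G ^ l * E) = 0" using fU by (simp only: functional_add add_0_right)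
  moreover have "G ^ l * Q = G ^ l * E - G ^ Suc l * T" using T by (simp add: algebra_simps)
  ultimately show ?thesis using fT unfolding G_def[symmetric] by (simp only: functional_minus diff_0_right)
qed

text \<open>If all these values vanished, the descent would reach \<open>l = 0\<close>, so the
  functional would kill all polynomials of degree at most \<open>m\<close>. Then
  \<open>lam 0 = S\<^sub>0\<close> is 0, and integration by parts, applied to the Lagrange
  polynomials, isolates each further \<open>lam j\<close> and shows it to be 0.\<close>

lemma functional_nonvanishing:
  assumes "\<exists>j\<in>{0..m}. lam j \<noteq> 0"
  shows "\<exists>\<mu>\<le>m. functional (node_poly ^ l * Polynomial.monom 1 \<mu>) \<noteq> 0"
proof (rule ccontr)
  assume "\<not> ?thesis"
  then have mu: "functional (node_poly ^ l * Polynomial.monom 1 \<mu>) = 0" if "\<mu> \<le> m" for \<mu> using that by blast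
  have "functional (node_poly ^ l * P) = 0" if "degree P \<le> m" for P
  proof -
    have "node_poly ^ l * P = (\<Sum>i\<le>degree P. Polynomial.smult (Polynomial.coeff P i) (node_poly ^ l * Polynomial.monom 1 i))"
      by (subst poly_as_sum_of_monoms[of P, symmetric]) (simp add: sum_distrib_left smult_monom flip: mult_smult_right)
    then show ?thesis using that by (simp add: functional_sum functional_smult mu)
  qed
  then have 0: "functional P = 0" if "degree P \<le> m" for P
    using that
  proof (induction l arbitrary: P)
    case (Suc l)
    then show ?case using functional_descent[of l] by blast
  qed simp
  have pf: "partial_form i = 0" if "i \<le> m" for i
    using 0[of "Polynomial.monom 1 i"] that by (simp add: degree_monom_eq functional_monom)
  have lam0: "lam 0 = 0" using pf[of 0] by (simp add: partial_form_def)
  have "lam j = 0" if j: "j \<in> {1..m}" for j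
  proof -
    let ?p = "lagrange_poly j"
    have "degree (Polynomial.monom 1 2 * pderiv ?p + [:-1, 1:] * ?p) \<le> m"
    proof (rule degree_add_le)
      show "degree ([:-1, 1:] * ?p) \<le> m"
        using degree_mult_le[of "[:-1, 1:]" ?p] degree_lagrange_poly[OF j] j by simp
      show "degree (Polynomial.monom 1 2 * pderiv ?p) \<le> m"
      proof (cases "degree ?p = 0")
        case True
        then show ?thesis by (simp add: pderiv_eq_0_iff[THEN iffD2])
      next
        case nz: False
        have "degree (Polynomial.monom 1 2 * pderiv ?p) \<le> 2 + degree (pderiv ?p)"
          using degree_mult_le[of "Polynomial.monom (1::'k) 2" "pderiv ?p"] by (simp add: degree_monom_eq)
        also have "\<dots> \<le> m" using degree_lagrange_poly[OF j] degree_pderiv[of ?p] nz by simp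
        finally show ?thesis .
      qed
    qed
    then have "(\<Sum>i=1..m. lam i * poly ?p (al i)) = 0"
      unfolding functional_by_parts[symmetric] by (rule 0)
    also have "(\<Sum>i=1..m. lam i * poly ?p (al i)) = (\<Sum>i=1..m. if i = j then lam j * poly ?p (al j) else 0)"
      by (rule sum.cong) (auto simp: poly_lagrange_poly)
    also have "\<dots> = lam j * poly ?p (al j)" using j by simp
    finally show ?thesis using poly_lagrange_poly_nonzero[OF j] by simp
  qed
  then show False using assms lam0 by (metis One_nat_def Suc_leI atLeastAtMost_iff not_gr_zero)
qed

end


section \<open>Divisibility of the approximations at a non-Archimedean place\<close>

lemma coeff_mult_in_subring:
  assumes "is_subring B" "\<And>i. Polynomial.coeff p i \<in> B" "\<And>i. Polynomial.coeff q i \<in> B"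
  shows "Polynomial.coeff (p * q) i \<in> B"
  unfolding coeff_mult using assms by (intro subring_sum subring_mult)

lemma coeff_prod_in_subring:
  assumes "is_subring B" "\<And>j i. j \<in> J \<Longrightarrow> Polynomial.coeff (f j) i \<in> B"
  shows "Polynomial.coeff (prod f J) i \<in> B"
  using assms(2)
proof (induction J arbitrary: i rule: infinite_finite_induct)
  case (insert j J)
  then show ?case by (simp add: coeff_mult_in_subring[OF assms(1)])
qed (simp_all add: subring_one[OF assms(1)] subring_zero[OF assms(1)])

lemma coeff_power_in_subring:
  assumes "is_subring B" "\<And>i. Polynomial.coeff p i \<in> B"
  shows "Polynomial.coeff (p ^ k) i \<in> B"
  using coeff_prod_in_subring[OF assms(1), of "{..<k}" "\<lambda>_. p" i] assms(2) by simp

lemma fact_quotient_of_nat: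
  "i \<le> M \<Longrightarrow> (fact M / fact i :: 'a::field_char_0) = of_nat (fact M div fact i)"
proof -
  assume "i \<le> M"
  then obtain k where k: "(fact M :: nat) = fact i * k" using fact_dvd[of i M] unfolding dvd_def by blast
  have "(fact M :: 'a) = of_nat (fact i * k)" using k by (metis of_nat_fact)
  then show ?thesis using k by simp
qed

context nonarch_abs
begin

lemma valuation_ring_subring: "is_subring {x. v x \<le> 1}"
  unfolding is_subring_def
proof (intro conjI ballI)
  show "1 \<in> {x. v x \<le> 1}" by (simp add: v_one)
  fix x y assume "x \<in> {x. v x \<le> 1}" "y \<in> {x. v x \<le> 1}"
  then show "x - y \<in> {x. v x \<le> 1}" "x * y \<in> {x. v x \<le> 1}"
    using v_diff[of x y] by (auto simp: v_mult v_nonneg intro: mult_le_one)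
qed

lemma v_fact_le_1: "v (fact k) \<le> 1"
  using v_of_nat_le_1[of "fact k"] by simp

lemma v_mult_le: "v x \<le> a \<Longrightarrow> v y \<le> b \<Longrightarrow> v (x * y) \<le> a * b"
proof -
  assume *: "v x \<le> a" "v y \<le> b"
  then have "0 \<le> a" using v_nonneg[of x] by linarith
  then show ?thesis unfolding v_mult by (intro mult_mono * v_nonneg)
qed

end

context factorial_series_form
begin

text \<open>The \<open>\<Lambda>\<close> of the overview; the factorial of
  \<open>M = m * l + \<mu>\<close> clears the denominators \<open>i!\<close> of the functional,
  since the polynomial has degree at most \<open>M\<close>.\<close>

definition approx :: "nat \<Rightarrow> nat \<Rightarrow> 'k" where
  "approx l \<mu> = fact (m * l + \<mu>) * functional (node_poly ^ l * Polynomial.monom 1 \<mu>)"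

lemma degree_approx_poly: "degree (node_poly ^ l * Polynomial.monom 1 \<mu>) \<le> m * l + \<mu>"
proof -
  have "degree (node_poly ^ l * Polynomial.monom 1 \<mu>) \<le> degree (node_poly ^ l) + degree (Polynomial.monom (1::'k) \<mu>)"
    by (rule degree_mult_le)
  also have "\<dots> \<le> m * l + \<mu>"
    using degree_power_le[of node_poly l] by (simp add: degree_node_poly degree_monom_eq mult.commute)
  finally show ?thesis .
qed

lemma approx_altdef:
  "approx l \<mu> = (\<Sum>i\<le>m * l + \<mu>. Polynomial.coeff (node_poly ^ l * Polynomial.monom 1 \<mu>) i *
     ((fact (m * l + \<mu>) / fact i) * partial_form i))"
  unfolding approx_def functional_upto[OF degree_approx_poly] sum_distrib_left
  by (intro sum.cong refl) (simp add: mult_ac)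

lemma node_dvd: "j \<in> {1..m} \<Longrightarrow> [:- al j, 1:] ^ l dvd node_poly ^ l * Polynomial.monom 1 \<mu>"
  unfolding node_poly_split power_mult_distrib mult.assoc by (rule dvd_triv_left)

end

locale factorial_series_form_at = factorial_series_form m lam al + nonarch_abs v
  for m :: nat and lam al :: "nat \<Rightarrow> 'k::field_char_0" and v :: "'k \<Rightarrow> real" +
  assumes v_lam: "\<And>j. j \<in> {0..m} \<Longrightarrow> v (lam j) \<le> 1" and v_al: "\<And>j. j \<in> {1..m} \<Longrightarrow> v (al j) \<le> 1"
begin

lemma v_coeff_approx_poly: "v (Polynomial.coeff (node_poly ^ l * Polynomial.monom 1 \<mu>) i) \<le> 1"
proof -
  let ?B = "{x. v x \<le> 1}"
  have lin: "Polynomial.coeff [:- al j, 1:] i \<in> ?B" if "j \<in> {1..m}" for j i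
    using v_al[OF that] by (auto simp: coeff_pCons v_uminus v_one v_zero split: nat.split)
  have "Polynomial.coeff node_poly i \<in> ?B" for i
    unfolding node_poly_def by (rule coeff_prod_in_subring[OF valuation_ring_subring lin])
  then have "Polynomial.coeff (node_poly ^ l) i \<in> ?B" for i
    by (rule coeff_power_in_subring[OF valuation_ring_subring])
  moreover have "Polynomial.coeff (Polynomial.monom 1 \<mu>) i \<in> ?B" for i
    by (simp add: v_one v_zero)
  ultimately have "Polynomial.coeff (node_poly ^ l * Polynomial.monom 1 \<mu>) i \<in> ?B"
    by (intro coeff_mult_in_subring[OF valuation_ring_subring])
  then show ?thesis by blast
qed

lemma v_al_power: "j \<in> {1..m} \<Longrightarrow> v (al j ^ h) \<le> 1"
  unfolding v_power using v_al v_nonneg by (intro power_le_one) auto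

lemma v_partial_form: "v (partial_form i) \<le> 1"
proof -
  have "v (\<Sum>j=1..m. lam j * (\<Sum>h<i. fact h * al j ^ h)) \<le> 1"
  proof (rule v_sum_le)
    fix j assume j: "j \<in> {1..m}"
    have "v (\<Sum>h<i. fact h * al j ^ h) \<le> 1"
      by (rule v_sum_le) (use v_mult_le[OF v_fact_le_1 v_al_power[OF j]] in auto)
    then show "v (lam j * (\<Sum>h<i. fact h * al j ^ h)) \<le> 1"
      using v_mult_le[OF v_lam[of j]] j by fastforce
  qed simp
  then show ?thesis unfolding partial_form_def using v_lam[of 0]
    by (intro order.trans[OF v_add]) simp
qed

lemma v_approx_le_1: "v (approx l \<mu>) \<le> 1"
  unfolding approx_altdef
proof (rule v_sum_le)
  fix i assume i: "i \<in> {..m * l + \<mu>}"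
  have "v (fact (m * l + \<mu>) / fact i) \<le> 1"
    using i by (simp only: fact_quotient_of_nat atMost_iff v_of_nat_le_1)
  from v_mult_le[OF this v_partial_form[of i]]
  have "v ((fact (m * l + \<mu>) / fact i) * partial_form i) \<le> 1" by simp
  from v_mult_le[OF v_coeff_approx_poly this]
  show "v (Polynomial.coeff (node_poly ^ l * Polynomial.monom 1 \<mu>) i * ((fact (m * l + \<mu>) / fact i) * partial_form i)) \<le> 1"
    by simp
qed simp

text \<open>With \<open>h = i + u\<close> and the sums exchanged, the part belonging to
  \<open>u < l\<close> vanishes by the zero of order \<open>l\<close> at \<open>al j\<close>. For
  \<open>u \<ge> l\<close> every single term is a multiple of \<open>M! l!\<close> by integral
  factors, because \<open>i! l!\<close> divides \<open>(i + u)!\<close>.\<close>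

lemma v_approx_tail:
  fixes l \<mu> N :: nat
  defines "M \<equiv> m * l + \<mu>"
  defines "c \<equiv> Polynomial.coeff (node_poly ^ l * Polynomial.monom 1 \<mu>)"
  assumes j: "j \<in> {1..m}" and N: "M + l \<le> N"
  shows "v (\<Sum>i\<le>M. c i * ((fact M / fact i) * (\<Sum>h\<in>{i..<N}. fact h * al j ^ h))) \<le> v (fact M * fact l)"
proof -
  \<comment> \<open>The cut \<open>i + u < N\<close> records the truncation. Since
    \<open>M + l \<le> N\<close>, it never interferes when \<open>u < l\<close>, so there the sum
    over \<open>i\<close> is complete.\<close>
  define g where "g = (\<lambda>u i. if i + u < N then c i * ((fact M / fact i) * (fact (i + u) * al j ^ (i + u))) else 0)"
  have inner: "(\<Sum>h\<in>{i..<N}. fact h * al j ^ h) = (\<Sum>u<N. if i + u < N then fact (i + u) * al j ^ (i + u) else 0)"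
    for i
  proof -
    have "(\<Sum>u<N. if i + u < N then fact (i + u) * al j ^ (i + u) else 0) =
        (\<Sum>u\<in>{u\<in>{..<N}. i + u < N}. fact (i + u) * al j ^ (i + u))"
      by (rule sum.inter_filter[symmetric]) simp
    also have "\<dots> = (\<Sum>h\<in>{i..<N}. fact h * al j ^ h)"
      by (rule sum.reindex_bij_witness[where i="\<lambda>h. h - i" and j="\<lambda>u. i + u"]) auto
    finally show ?thesis by simp
  qed
  have "(\<Sum>i\<le>M. c i * ((fact M / fact i) * (\<Sum>h\<in>{i..<N}. fact h * al j ^ h))) = (\<Sum>i\<le>M. \<Sum>u<N. g u i)"
    unfolding inner sum_distrib_left g_def by (intro sum.cong refl) simp
  also have "\<dots> = (\<Sum>u<N. \<Sum>i\<le>M. g u i)" by (rule sum.swap)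
  also have "v \<dots> \<le> v (fact M * fact l)"
  proof (rule v_sum_le[OF v_nonneg])
    fix u assume "u \<in> {..<N}"
    show "v (\<Sum>i\<le>M. g u i) \<le> v (fact M * fact l)"
    proof (cases "u < l")
      case True
      have "(\<Sum>i\<le>M. g u i) = (\<Sum>i\<le>M. fact M * al j ^ u * (c i * (fact (i + u) / fact i) * al j ^ i))"
        by (rule sum.cong[OF refl]) (use N True in \<open>simp add: g_def power_add mult_ac\<close>)
      also have "\<dots> = fact M * al j ^ u * (\<Sum>i\<le>M. c i * (fact (i + u) / fact i) * al j ^ i)"
        by (rule sum_distrib_left[symmetric])
      also have "(\<Sum>i\<le>M. c i * (fact (i + u) / fact i) * al j ^ i) = 0"
        unfolding c_def M_def by (rule sum_coeff_fact_ratio_eq_0[OF node_dvd[OF j] True degree_approx_poly])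
      finally show ?thesis by (simp add: v_zero v_nonneg)
    next
      case False
      show ?thesis
      proof (rule v_sum_le[OF v_nonneg])
        fix i assume "i \<in> {..M}"
        show "v (g u i) \<le> v (fact M * fact l)"
        proof (cases "i + u < N")
          case lt: True
          have "fact i * fact l dvd fact i * (fact u :: nat)"
            using False by (intro mult_dvd_mono fact_dvd) auto
          also have "\<dots> dvd fact (i + u)" by (rule fact_fact_dvd_fact)
          finally obtain k where k: "fact (i + u) = fact i * fact l * (k :: nat)" unfolding dvd_def by blast
          have "(fact (i + u) :: 'k) = of_nat (fact i * fact l * k)" using k by (metis of_nat_fact)
          then have e: "(fact (i + u) / fact i :: 'k) = fact l * of_nat k" by simp
          have "g u i = (fact M * fact l) * ((c i * of_nat k) * al j ^ (i + u))"
            using lt e by (simp add: g_def field_simps)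
          also have "v \<dots> \<le> v (fact M * fact l) * ((1 * 1) * 1)"
            unfolding c_def by (intro v_mult_le order.refl v_coeff_approx_poly v_of_nat_le_1 v_al_power j)
          finally show ?thesis by simp
        qed (simp add: g_def v_zero v_nonneg)
      qed
    qed
  qed
  finally show ?thesis .
qed

text \<open>The partial forms tend to 0, so some \<open>S\<^sub>N\<close> is already as small as the
  target \<open>M! l!\<close>; every \<open>S\<^sub>i\<close> is \<open>S\<^sub>N\<close> minus a
  finite tail. Hence the estimate stays within the field and needs no series in the
  completion.\<close>

lemma v_approx_le_fact:
  assumes null: "partial_form \<in> null_seqs v"
  shows "v (approx l \<mu>) \<le> v (fact (m * l + \<mu>) * fact l)"
proof -
  define M where "M = m * l + \<mu>"
  define c where "c = Polynomial.coeff (node_poly ^ l * Polynomial.monom 1 \<mu>)"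
  let ?e = "v (fact M * fact l)"
  have "?e > 0" using v_nonneg[of "fact M * fact l"] v_eq_0[of "fact M * fact l"] by (simp add: less_le)
  then obtain N0 where N0: "\<forall>i\<ge>N0. v (partial_form i) < ?e" using null unfolding null_iff by blast
  define N where "N = max N0 (M + l)"
  have SN: "v (partial_form N) \<le> ?e" using N0 by (simp add: N_def less_imp_le)
  have diff: "partial_form i = partial_form N - (\<Sum>j=1..m. lam j * (\<Sum>h\<in>{i..<N}. fact h * al j ^ h))" if "i \<le> M" for i
  proof -
    have "(\<Sum>h<N. f h) = (\<Sum>h<i. f h) + (\<Sum>h\<in>{i..<N}. f h)" for f :: "nat \<Rightarrow> 'k"
      using that sum.atLeastLessThan_concat[of 0 i N f] by (simp add: N_def atLeast0LessThan)
    then show ?thesis unfolding partial_form_def by (simp add: distrib_left sum.distrib)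
  qed
  have "approx l \<mu> = (\<Sum>i\<le>M. c i * ((fact M / fact i) * partial_form i))"
    unfolding approx_altdef M_def c_def ..
  also have "\<dots> = (\<Sum>i\<le>M. c i * (fact M / fact i) * partial_form N
      - (\<Sum>j=1..m. lam j * (c i * ((fact M / fact i) * (\<Sum>h\<in>{i..<N}. fact h * al j ^ h)))))"
  proof (rule sum.cong[OF refl])
    fix i assume "i \<in> {..M}"
    then have "c i * ((fact M / fact i) * partial_form i) =
      c i * ((fact M / fact i) * (partial_form N - (\<Sum>j=1..m. lam j * (\<Sum>h\<in>{i..<N}. fact h * al j ^ h))))"
      using diff[of i] by simp
    also have "\<dots> = c i * (fact M / fact i) * partial_form N
      - (\<Sum>j=1..m. lam j * (c i * ((fact M / fact i) * (\<Sum>h\<in>{i..<N}. fact h * al j ^ h))))"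
      unfolding right_diff_distrib sum_distrib_left by (simp only: mult_ac)
    finally show "c i * ((fact M / fact i) * partial_form i) = c i * (fact M / fact i) * partial_form N
      - (\<Sum>j=1..m. lam j * (c i * ((fact M / fact i) * (\<Sum>h\<in>{i..<N}. fact h * al j ^ h))))" .
  qed
  also have "\<dots> = (\<Sum>i\<le>M. c i * (fact M / fact i) * partial_form N)
      - (\<Sum>j=1..m. lam j * (\<Sum>i\<le>M. c i * ((fact M / fact i) * (\<Sum>h\<in>{i..<N}. fact h * al j ^ h))))"
    unfolding sum_subtractf by (subst sum.swap) (simp only: sum_distrib_left)
  also have "v \<dots> \<le> max ?e ?e"
  proof (rule order.trans[OF v_diff], rule max.mono)
    show "v (\<Sum>i\<le>M. c i * (fact M / fact i) * partial_form N) \<le> ?e"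
    proof (rule v_sum_le[OF v_nonneg])
      fix i assume "i \<in> {..M}"
      then have "v (fact M / fact i) \<le> 1" by (simp only: fact_quotient_of_nat atMost_iff v_of_nat_le_1)
      then have "v (c i * (fact M / fact i) * partial_form N) \<le> 1 * 1 * ?e"
        unfolding c_def by (intro v_mult_le v_coeff_approx_poly SN)
      then show "v (c i * (fact M / fact i) * partial_form N) \<le> ?e" by simp
    qed
    show "v (\<Sum>j=1..m. lam j * (\<Sum>i\<le>M. c i * ((fact M / fact i) * (\<Sum>h\<in>{i..<N}. fact h * al j ^ h)))) \<le> ?e"
    proof (rule v_sum_le[OF v_nonneg])
      fix j assume j: "j \<in> {1..m}"
      have "v (\<Sum>i\<le>M. c i * ((fact M / fact i) * (\<Sum>h\<in>{i..<N}. fact h * al j ^ h))) \<le> ?e"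
        unfolding c_def M_def by (rule v_approx_tail[OF j]) (simp add: N_def M_def)
      from v_mult_le[OF v_lam this, of j] j
      show "v (lam j * (\<Sum>i\<le>M. c i * ((fact M / fact i) * (\<Sum>h\<in>{i..<N}. fact h * al j ^ h)))) \<le> ?e" by simp
    qed
  qed
  finally show ?thesis by (simp add: M_def)
qed

end

section \<open>Archimedean size of the approximations\<close>

locale submult_norm =
  fixes \<N> :: "'k::field_char_0 \<Rightarrow> real"
  assumes N_nonneg: "\<And>x. \<N> x \<ge> 0" and N_add: "\<And>x y. \<N> (x + y) \<le> \<N> x + \<N> y"
    and N_mult: "\<And>x y. \<N> (x * y) \<le> \<N> x * \<N> y"
    and N_scale: "\<And>q x. \<N> (of_rat q * x) = \<bar>of_rat q\<bar> * \<N> x"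
begin

lemma N_zero: "\<N> 0 = 0"
  using N_scale[of 0 0] by simp

lemma N_sum: "\<N> (sum f A) \<le> (\<Sum>i\<in>A. \<N> (f i))"
  by (induction A rule: infinite_finite_induct) (auto simp: N_zero intro: order.trans[OF N_add])

text \<open>The sum of the norms of the coefficients, written as a value at 1 so that
  submultiplicativity follows from real polynomial multiplication.\<close>

definition poly_norm :: "'k poly \<Rightarrow> real" where
  "poly_norm p = poly (map_poly \<N> p) 1"

lemma coeff_map_N: "Polynomial.coeff (map_poly \<N> p) i = \<N> (Polynomial.coeff p i)"
  by (rule coeff_map_poly[of \<N>, OF N_zero])

lemma poly_norm_upto: assumes "degree p \<le> D" shows "poly_norm p = (\<Sum>i\<le>D. \<N> (Polynomial.coeff p i))"
proof -
  have "degree (map_poly \<N> p) \<le> D" using map_poly_degree_leq[of \<N> p] assms by (simp add: N_zero)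
  from sum_coeff_times_upto[OF this, of "\<lambda>_. 1"]
  show ?thesis unfolding poly_norm_def poly_altdef by (simp add: coeff_map_N)
qed

lemma poly_norm_nonneg: "poly_norm p \<ge> 0"
  unfolding poly_norm_upto[OF order.refl] by (intro sum_nonneg N_nonneg)

lemma poly_norm_mult: "poly_norm (p * q) \<le> poly_norm p * poly_norm q"
proof -
  let ?P = "map_poly \<N> p" and ?Q = "map_poly \<N> q"
  define D where "D = max (degree (p * q)) (degree (?P * ?Q))"
  have "poly_norm (p * q) = (\<Sum>i\<le>D. \<N> (Polynomial.coeff (p * q) i))"
    by (rule poly_norm_upto) (simp add: D_def)
  also have "\<dots> \<le> (\<Sum>i\<le>D. Polynomial.coeff (?P * ?Q) i)"
  proof (rule sum_mono)
    fix i
    have "\<N> (Polynomial.coeff (p * q) i) \<le> (\<Sum>k\<le>i. \<N> (Polynomial.coeff p k * Polynomial.coeff q (i - k)))"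
      unfolding coeff_mult by (rule N_sum)
    also have "\<dots> \<le> (\<Sum>k\<le>i. \<N> (Polynomial.coeff p k) * \<N> (Polynomial.coeff q (i - k)))"
      by (intro sum_mono N_mult)
    finally show "\<N> (Polynomial.coeff (p * q) i) \<le> Polynomial.coeff (?P * ?Q) i"
      unfolding coeff_mult coeff_map_N .
  qed
  also have "\<dots> = poly (?P * ?Q) 1"
    using sum_coeff_times_upto[of "?P * ?Q" D "\<lambda>_. 1"] by (simp add: D_def poly_altdef)
  finally show ?thesis by (simp add: poly_norm_def)
qed

lemma poly_norm_monom: "poly_norm (Polynomial.monom 1 k) = \<N> 1"
proof -
  have "poly_norm (Polynomial.monom 1 k) = (\<Sum>i\<le>k. if i = k then \<N> 1 else 0)"
    unfolding poly_norm_upto[OF degree_monom_le] by (rule sum.cong) (auto simp: N_zero)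
  then show ?thesis by simp
qed

text \<open>The factor \<open>\<N> 1\<close> accounts for the power 0, as the norm of 1 need not be
  1.\<close>

lemma poly_norm_power: "poly_norm (p ^ l) \<le> \<N> 1 * poly_norm p ^ l"
proof (induction l)
  case 0
  show ?case using poly_norm_monom[of 0] by simp
next
  case (Suc l)
  have "poly_norm (p ^ Suc l) \<le> poly_norm p * poly_norm (p ^ l)" using poly_norm_mult[of p "p ^ l"] by simp
  also have "\<dots> \<le> poly_norm p * (\<N> 1 * poly_norm p ^ l)" by (rule mult_left_mono[OF Suc poly_norm_nonneg])
  finally show ?case by (simp add: mult_ac)
qed

end

locale factorial_series_form_norm = factorial_series_form m lam al + submult_norm \<N>
  for m :: nat and lam al :: "nat \<Rightarrow> 'k::field_char_0" and \<N> :: "'k \<Rightarrow> real"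
begin

text \<open>The partial form \<open>S\<^sub>i\<close> has size \<open>i!\<close> up to an
  exponential factor, so the \<open>i!\<close> cancels against \<open>M! / i!\<close> and one
  \<open>M!\<close> remains. The coefficients of the power of \<open>node_poly\<close> are
  exponentially bounded in \<open>l\<close>.\<close>

lemma norm_approx_bound:
  "\<exists>c1>0. \<exists>c2>0. \<forall>l. \<forall>\<mu>\<le>m. \<N> (approx l \<mu>) \<le> c1 * c2 ^ l * fact (m * l + \<mu>)"
proof -
  define A where "A = 1 + \<N> 1 + (\<Sum>j=1..m. \<N> (al j))"
  have A1: "A \<ge> 1" by (simp add: A_def N_nonneg sum_nonneg)
  have alA: "\<N> (al j) \<le> A" if "j \<in> {1..m}" for j
  proof -
    have "\<N> (al j) \<le> (\<Sum>j=1..m. \<N> (al j))" by (rule member_le_sum) (use that N_nonneg in auto)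
    then show ?thesis unfolding A_def using N_nonneg[of 1] by linarith
  qed
  have pow: "\<N> (al j ^ h) \<le> A ^ Suc h" if "j \<in> {1..m}" for j h
  proof (induction h)
    case 0
    have "0 \<le> (\<Sum>j=1..m. \<N> (al j))" by (intro sum_nonneg N_nonneg)
    then show ?case by (simp add: A_def)
  next
    case (Suc h)
    have "\<N> (al j ^ Suc h) \<le> \<N> (al j) * \<N> (al j ^ h)" using N_mult[of "al j" "al j ^ h"] by simp
    also have "\<dots> \<le> A * A ^ Suc h" using alA[OF that] Suc A1 N_nonneg by (intro mult_mono) auto
    finally show ?case by simp
  qed
  define \<Lambda> where "\<Lambda> = (\<Sum>j\<le>m. \<N> (lam j))"
  have L0: "\<Lambda> \<ge> 0" by (simp add: \<Lambda>_def sum_nonneg N_nonneg)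
  have fact_scale: "\<N> (fact k * x) = fact k * \<N> x" for k x
    using N_scale[of "fact k" x] by (simp add: of_rat_of_nat_eq[of "fact k", simplified])
  have form: "\<N> (partial_form i) \<le> \<Lambda> * (2 ^ M * fact i * A ^ M)" if iM: "i \<le> M" for i M
  proof -
    let ?K = "real (Suc M) * fact i * A ^ M"
    have inner: "\<N> (\<Sum>h<i. fact h * al j ^ h) \<le> ?K" if j: "j \<in> {1..m}" for j
    proof -
      have "\<N> (\<Sum>h<i. fact h * al j ^ h) \<le> (\<Sum>h<i. \<N> (fact h * al j ^ h))" by (rule N_sum)
      also have "\<dots> \<le> (\<Sum>h<i. fact i * A ^ M)"
      proof (rule sum_mono)
        fix h assume h: "h \<in> {..<i}"
        have "A ^ Suc h \<le> A ^ M" by (rule power_increasing) (use h iM A1 in auto)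
        then have "\<N> (al j ^ h) \<le> A ^ M" using pow[OF j, of h] by linarith
        moreover have "(fact h :: real) \<le> fact i" using h by (intro fact_mono) simp
        ultimately show "\<N> (fact h * al j ^ h) \<le> fact i * A ^ M"
          unfolding fact_scale by (intro mult_mono) (auto simp: N_nonneg)
      qed
      also have "\<dots> = real i * (fact i * A ^ M)" by simp
      also have "\<dots> \<le> real (Suc M) * (fact i * A ^ M)" using iM A1 by (intro mult_right_mono) auto
      finally show ?thesis by (simp add: mult.assoc)
    qed
    have one: "1 \<le> ?K"
    proof -
      have "1 * 1 * 1 \<le> ?K"
        by (intro mult_mono) (use A1 in \<open>auto simp: fact_ge_1 one_le_power\<close>)
      then show ?thesis by simp
    qed
    have "\<N> (partial_form i) \<le> \<N> (lam 0) + (\<Sum>j=1..m. \<N> (lam j * (\<Sum>h<i. fact h * al j ^ h)))"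
      unfolding partial_form_def by (rule order.trans[OF N_add add_left_mono[OF N_sum]])
    also have "\<dots> \<le> \<N> (lam 0) * ?K + (\<Sum>j=1..m. \<N> (lam j) * ?K)"
    proof (rule add_mono)
      show "\<N> (lam 0) \<le> \<N> (lam 0) * ?K" using mult_left_mono[OF one N_nonneg[of "lam 0"]] by simp
      show "(\<Sum>j=1..m. \<N> (lam j * (\<Sum>h<i. fact h * al j ^ h))) \<le> (\<Sum>j=1..m. \<N> (lam j) * ?K)"
        by (intro sum_mono order.trans[OF N_mult] mult_left_mono inner N_nonneg)
    qed
    also have "\<dots> = \<Lambda> * ?K"
      unfolding \<Lambda>_def sum_distrib_right by (simp add: atMost_atLeast0 sum.atLeast_Suc_atMost)
    also have "\<dots> \<le> \<Lambda> * (2 ^ M * fact i * A ^ M)"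
    proof -
      have "Suc M \<le> 2 ^ M" by (rule Suc_leI) (rule less_exp)
      then have "real (Suc M) \<le> 2 ^ M" by (metis of_nat_le_iff of_nat_numeral of_nat_power)
      then show ?thesis using L0 A1 by (intro mult_left_mono mult_right_mono) auto
    qed
    finally show ?thesis .
  qed
  \<comment> \<open>Since \<open>M \<le> m * Suc l\<close>, the exponential factor
    \<open>(2 * A) ^ M\<close> is at most \<open>E * E ^ l\<close>. The summands 1 in the next two
    constants keep them positive, so that logarithms can be taken.\<close>
  define E where "E = (2 * A) ^ m"
  define c1 where "c1 = 1 + \<N> 1 * \<N> 1 * \<Lambda> * E"
  define c2 where "c2 = (1 + poly_norm node_poly) * E"
  have E1: "E \<ge> 1" unfolding E_def using A1 by (intro one_le_power) simp
  have "\<N> (approx l \<mu>) \<le> c1 * c2 ^ l * fact (m * l + \<mu>)" if mu: "\<mu> \<le> m" for l \<mu>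
  proof -
    define M where "M = m * l + \<mu>"
    define C where "C = node_poly ^ l * Polynomial.monom 1 \<mu>"
    have degC: "degree C \<le> M" unfolding C_def M_def by (rule degree_approx_poly)
    have "\<N> (approx l \<mu>) \<le> (\<Sum>i\<le>M. \<N> (Polynomial.coeff C i * ((fact M / fact i) * partial_form i)))"
      unfolding approx_altdef M_def C_def by (rule N_sum)
    also have "\<dots> \<le> (\<Sum>i\<le>M. \<N> (Polynomial.coeff C i) * (\<Lambda> * fact M * (2 * A) ^ M))"
    proof (rule sum_mono)
      fix i assume i: "i \<in> {..M}"
      have "\<N> ((fact M / fact i) * partial_form i) = (fact M / fact i) * \<N> (partial_form i)"
      proof -
        have "(fact M / fact i :: 'k) = of_rat (fact M / fact i)"
          by (simp add: of_rat_divide of_rat_of_nat_eq[of "fact _", simplified])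
        moreover have "(of_rat (fact M / fact i) :: real) = fact M / fact i"
          by (simp add: of_rat_divide of_rat_of_nat_eq[of "fact _", simplified])
        ultimately show ?thesis using N_scale[of "fact M / fact i" "partial_form i"] by simp
      qed
      also have "\<dots> \<le> (fact M / fact i) * (\<Lambda> * (2 ^ M * fact i * A ^ M))"
        using form[of i M] i by (intro mult_left_mono) auto
      also have "\<dots> = \<Lambda> * fact M * (2 * A) ^ M" by (simp add: power_mult_distrib)
      finally show "\<N> (Polynomial.coeff C i * ((fact M / fact i) * partial_form i))
          \<le> \<N> (Polynomial.coeff C i) * (\<Lambda> * fact M * (2 * A) ^ M)"
        by (rule order.trans[OF N_mult mult_left_mono[OF _ N_nonneg]])
    qed
    also have "\<dots> = poly_norm C * (\<Lambda> * fact M * (2 * A) ^ M)"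
      unfolding poly_norm_upto[OF degC] by (rule sum_distrib_right[symmetric])
    also have "\<dots> \<le> (\<N> 1 * \<N> 1 * (1 + poly_norm node_poly) ^ l) * (\<Lambda> * fact M * (E * E ^ l))"
    proof (rule mult_mono)
      have "poly_norm C \<le> poly_norm (node_poly ^ l) * \<N> 1"
        using poly_norm_mult[of "node_poly ^ l" "Polynomial.monom 1 \<mu>"] by (simp add: C_def poly_norm_monom)
      also have "\<dots> \<le> (\<N> 1 * poly_norm node_poly ^ l) * \<N> 1"
        by (rule mult_right_mono[OF poly_norm_power N_nonneg])
      also have "\<dots> \<le> (\<N> 1 * (1 + poly_norm node_poly) ^ l) * \<N> 1"
        by (intro mult_right_mono mult_left_mono power_mono N_nonneg) (auto simp: poly_norm_nonneg)
      finally show "poly_norm C \<le> \<N> 1 * \<N> 1 * (1 + poly_norm node_poly) ^ l" by (simp add: mult_ac)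
      have "(2 * A) ^ M \<le> (2 * A) ^ (m * Suc l)" by (rule power_increasing) (use mu A1 in \<open>auto simp: M_def\<close>)
      also have "\<dots> = E * E ^ l" by (simp add: E_def power_mult power_add)
      finally show "\<Lambda> * fact M * (2 * A) ^ M \<le> \<Lambda> * fact M * (E * E ^ l)"
        using L0 by (intro mult_left_mono) auto
    qed (use L0 A1 N_nonneg poly_norm_nonneg[of node_poly] in auto)
    also have "\<dots> = (\<N> 1 * \<N> 1 * \<Lambda> * E) * c2 ^ l * fact M"
      by (simp add: c2_def power_mult_distrib mult_ac)
    also have "\<dots> \<le> c1 * c2 ^ l * fact M"
      unfolding c1_def c2_def using E1 poly_norm_nonneg[of node_poly] by (intro mult_right_mono) auto
    finally show ?thesis by (simp add: M_def)
  qed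
  moreover have "c1 > 0" unfolding c1_def using L0 E1 N_nonneg[of 1] by (intro add_pos_nonneg mult_nonneg_nonneg) auto
  moreover have "c2 > 0" unfolding c2_def using E1 poly_norm_nonneg[of node_poly] by (intro mult_pos_pos) auto
  ultimately show ?thesis by blast
qed

end


section \<open>The linear form at a place and the factorial part\<close>

context padic_place
begin

text \<open>The terms are bounded by \<open>v (fact h)\<close>, which tends to 0, so by the
  ultrametric inequality the partial sums are Cauchy; their class is the only element to which the
  series converges.\<close>

lemma euler_F_eq:
  assumes a: "v \<alpha> \<le> 1"
  shows "(\<lambda>N. \<Sum>h<N. fact h * \<alpha> ^ h) \<in> cauchy_seqs v"
    and "euler_F v \<alpha> = seq_class (\<lambda>N. \<Sum>h<N. fact h * \<alpha> ^ h)"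
proof -
  define s where "s = (\<lambda>N. \<Sum>h<N. fact h * \<alpha> ^ h)"
  have term_le: "v (fact h * \<alpha> ^ h) \<le> v (fact h)" for h
  proof -
    have "v \<alpha> ^ h \<le> 1" by (intro power_le_one v_nonneg a)
    then have "v (fact h) * v \<alpha> ^ h \<le> v (fact h) * 1" by (intro mult_left_mono v_nonneg)
    then show ?thesis by (simp add: v_mult v_power)
  qed
  show s: "(\<lambda>N. \<Sum>h<N. fact h * \<alpha> ^ h) \<in> cauchy_seqs v"
  proof (rule cauchyI)
    fix e :: real assume e: "e > 0"
    then have e2: "0 < e / 2" by simp
    have "eventually (\<lambda>k. v (fact k) < e / 2) sequentially"
      by (rule order_tendstoD(2)[OF v_fact_null e2])
    then obtain N where N: "\<And>k. k \<ge> N \<Longrightarrow> v (fact k) < e / 2" by (auto simp: eventually_sequentially)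
    have "v (s j - s i) \<le> e / 2" if "N \<le> i" "i \<le> j" for i j
    proof -
      have "s j - s i = (\<Sum>h\<in>{i..<j}. fact h * \<alpha> ^ h)"
        unfolding s_def using that sum.atLeastLessThan_concat[of 0 i j "\<lambda>h. fact h * \<alpha> ^ h"]
        by (simp add: atLeast0LessThan algebra_simps)
      also have "v \<dots> \<le> e / 2"
      proof (rule v_sum_le)
        fix h assume "h \<in> {i..<j}"
        then have "v (fact h) < e / 2" using that by (intro N) simp
        then show "v (fact h * \<alpha> ^ h) \<le> e / 2" using term_le[of h] by linarith
      qed (use e2 in simp)
      finally show ?thesis .
    qed
    note tail = this
    have "v (s i - s j) < e" if "N \<le> i" "N \<le> j" for i j
    proof (cases "i \<le> j")
      case True
      then show ?thesis using tail[OF that(1) True] v_minus_commute[of "s i" "s j"] e by linarith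
    next
      case False
      then show ?thesis using tail[OF that(2), of i] e by linarith
    qed
    then show "\<exists>N. \<forall>i\<ge>N. \<forall>j\<ge>N. v ((\<Sum>h<i. fact h * \<alpha> ^ h) - (\<Sum>h<j. fact h * \<alpha> ^ h)) < e"
      unfolding s_def by blast
  qed
  let ?f = "\<lambda>k. to_completion v (fact k * \<alpha> ^ k)"
  have partial: "(\<Oplus>\<^bsub>completion v\<^esub>k\<in>{..<N}. ?f k) = seq_class (\<lambda>i. s N)" for N
    unfolding to_completion_class s_def by (rule seq_class_finsum) (auto intro: cauchy_const)
  have iff: "completion_sums v ?f (seq_class t) \<longleftrightarrow> (\<lambda>i. s i - t i) \<in> null_seqs v" if "t \<in> cauchy_seqs v" for t
    by (rule completion_sums_class_iff[OF cauchy_const s[folded s_def] partial that])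
  have "euler_F v \<alpha> = seq_class s"
    unfolding euler_F_def
  proof (rule the_equality)
    show "completion_sums v ?f (seq_class s)"
      using iff[OF s[folded s_def]] null_zero by simp
    fix X assume X: "completion_sums v ?f X"
    then have "X \<in> carrier (completion v)" by (simp add: completion_sums_def)
    then obtain t where t: "t \<in> cauchy_seqs v" "X = seq_class t" using seq_class_surj by blast
    then have "(\<lambda>i. s i - t i) \<in> null_seqs v" using X iff by blast
    then show "X = seq_class s" using seq_class_eq_iff[of s t] t(2) by simp
  qed
  then show "euler_F v \<alpha> = seq_class (\<lambda>N. \<Sum>h<N. fact h * \<alpha> ^ h)" by (simp add: s_def)
qed

text \<open>Translates an equation in the completion into the statement about sequences in the field
  on which the divisibility estimate rests.\<close>

lemma linear_form_zero_imp_null: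
  assumes form: "factorial_series_form m al" and a: "\<And>j. j \<in> {1..m} \<Longrightarrow> v (al j) \<le> 1"
    and zero: "to_completion v (lam 0) \<oplus>\<^bsub>completion v\<^esub>
      (\<Oplus>\<^bsub>completion v\<^esub>j\<in>{1..m}. to_completion v (lam j) \<otimes>\<^bsub>completion v\<^esub> euler_F v (al j))
      = \<zero>\<^bsub>completion v\<^esub>"
  shows "factorial_series_form.partial_form m lam al \<in> null_seqs v"
proof -
  interpret F: factorial_series_form m lam al by (rule form)
  define s where "s = (\<lambda>j N. lam j * (\<Sum>h<N. fact h * al j ^ h))"
  have s: "s j \<in> cauchy_seqs v" if "j \<in> {1..m}" for j
    unfolding s_def by (rule cauchy_mult[OF cauchy_const euler_F_eq(1)[OF a[OF that]]])
  have prod: "to_completion v (lam j) \<otimes>\<^bsub>completion v\<^esub> euler_F v (al j) = seq_class (s j)" if "j \<in> {1..m}" for j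
    unfolding to_completion_class euler_F_eq(2)[OF a[OF that]] s_def
    by (rule seq_class_mult[OF cauchy_const euler_F_eq(1)[OF a[OF that]]])
  have "(\<Oplus>\<^bsub>completion v\<^esub>j\<in>{1..m}. to_completion v (lam j) \<otimes>\<^bsub>completion v\<^esub> euler_F v (al j)) =
      (\<Oplus>\<^bsub>completion v\<^esub>j\<in>{1..m}. seq_class (s j))"
    by (rule S.finsum_cong'[OF refl _ prod]) (use seq_class_closed s in blast)+
  also have "\<dots> = seq_class (\<lambda>i. \<Sum>j=1..m. s j i)"
    by (rule seq_class_finsum[OF _ s]) simp_all
  finally have "seq_class (\<lambda>i. lam 0 + (\<Sum>j=1..m. s j i)) = seq_class (\<lambda>i. 0)"
    using zero seq_class_add[OF cauchy_const cauchy_sum[of "{1..m}" s, OF s], of "lam 0"]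
    by (simp only: to_completion_class seq_class_zero)
  then have "(\<lambda>i. lam 0 + (\<Sum>j=1..m. s j i)) \<in> null_seqs v"
    unfolding seq_class_eq_iff by simp
  moreover have "F.partial_form = (\<lambda>i. lam 0 + (\<Sum>j=1..m. s j i))"
    by (auto simp: F.partial_form_def s_def)
  ultimately show ?thesis by simp
qed

end

section \<open>The part of the factorials made of primes in the chosen classes\<close>

lemma lies_over_other_prime:
  fixes v :: "'k::field_char_0 \<Rightarrow> real"
  assumes "lies_over v q" "prime q" "prime p" "p \<noteq> q" shows "v (of_nat p) = 1"
proof -
  have "v (of_nat p) = padic_abs q (of_nat p)" using assms(1) unfolding lies_over_def by (metis of_rat_of_nat_eq)
  also have "quotient_of (of_nat p) = (int p, 1)" by (simp add: of_nat_rat quotient_of_Fract Rat.normalize_def)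
  then have "padic_abs q (of_nat p) = real q powi (- int (multiplicity (int q) (int p)))"
    using prime_gt_0_nat[OF assms(3)] by (simp add: padic_abs_def)
  also have "multiplicity (int q) (int p) = 0"
    using assms(2,3,4) primes_dvd_imp_eq[of q p] by (intro not_dvd_imp_multiplicity_0) auto
  finally show ?thesis by simp
qed

lemma prod_prime_powers_dvd:
  assumes "finite P" "\<And>p. p \<in> P \<Longrightarrow> prime p" "\<And>p. p \<in> P \<Longrightarrow> p ^ e p dvd (x::nat)"
  shows "(\<Prod>p\<in>P. p ^ e p) dvd x"
  using assms
proof (induction P)
  case (insert q P)
  have "coprime (q ^ e q) (\<Prod>p\<in>P. p ^ e p)"
  proof (rule prod_coprime_right)
    fix p assume "p \<in> P"
    then have "coprime q p" using insert by (intro primes_coprime) auto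
    then show "coprime (q ^ e q) (p ^ e p)" by simp
  qed
  then show ?case using insert by (simp add: divides_mult)
qed simp

lemma sum_ln_primes_le:
  assumes "\<And>p. p \<in> P \<Longrightarrow> prime p \<and> p \<le> l" shows "(\<Sum>p\<in>P. ln (real p)) \<le> 6 * real l"
proof -
  have "(\<Sum>p\<in>P. ln (real p)) = (\<Sum>p\<in>P. mangoldt p)" by (rule sum.cong) (use assms in auto)
  also have "\<dots> \<le> (\<Sum>d=1..l. mangoldt d)"
    by (rule sum_mono2) (use assms prime_gt_0_nat in \<open>auto simp: mangoldt_nonneg Suc_le_eq\<close>)
  also have "\<dots> \<le> 6 * real l" by (rule chebyshev_psi_le)
  finally show ?thesis .
qed

text \<open>A divisor of the \<open>R\<close>-part of \<open>M! l!\<close> that is easier to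
  estimate: only primes up to \<open>l\<close> occur, and each multiple of \<open>p\<close> is
  counted once. For \<open>M\<close> of order \<open>l\<close> the loss in the logarithm is of order
  \<open>l\<close>.\<close>

definition class_factorial_part :: "nat \<Rightarrow> nat set \<Rightarrow> nat \<Rightarrow> nat \<Rightarrow> nat" where
  "class_factorial_part n A M l =
     (\<Prod>p | prime p \<and> p \<le> l \<and> p mod n \<in> A. p ^ (M div p + l div p))"

lemma class_factorial_part_dvd: "class_factorial_part n A M l dvd fact M * fact l"
  unfolding class_factorial_part_def
proof (rule prod_prime_powers_dvd)
  show "finite {p. prime p \<and> p \<le> l \<and> p mod n \<in> A}" by (rule finite_subset[of _ "{..l}"]) auto
  fix p assume "p \<in> {p. prime p \<and> p \<le> l \<and> p mod n \<in> A}"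
  then show "p ^ (M div p + l div p) dvd fact M * fact l"
    unfolding power_add using power_dvd_fact[of p M] power_dvd_fact[of p l] prime_gt_0_nat by (intro mult_dvd_mono) auto
qed auto

text \<open>Rounding down the two quotients costs at most 2 in the exponent of each prime, in total
  \<open>2 * 6 * l\<close> by Chebyshev's bound. What remains is \<open>(m + 1) * l\<close> times
  the sum of \<open>ln p / p\<close>, to which Mertens' theorem in residue classes applies.\<close>

lemma ln_class_factorial_part_ge:
  assumes n: "n > 1" and A: "A \<subseteq> totatives n"
  shows "\<exists>C. \<forall>l>0. \<forall>M\<ge>m * l. ln (real (class_factorial_part n A M l))
    \<ge> real (Suc m) * (real (card A) / real (totient n)) * (real l * ln (real l)) - C * real l"
proof -
  obtain C where C: "\<And>N. N > 0 \<Longrightarrow> (\<Sum>p | prime p \<and> p \<le> N \<and> p mod n \<in> A. ln (real p) / real p)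
    \<ge> real (card A) / real (totient n) * ln (real N) - C"
    using mertens_residue_classes[OF n A] by blast
  have "ln (real (class_factorial_part n A M l))
    \<ge> real (Suc m) * (real (card A) / real (totient n)) * (real l * ln (real l)) - (real (Suc m) * C + 12) * real l"
    if l: "l > 0" and M: "M \<ge> m * l" for l M
  proof -
    define P where "P = {p. prime p \<and> p \<le> l \<and> p mod n \<in> A}"
    have fin: "finite P" unfolding P_def by (rule finite_subset[of _ "{..l}"]) auto
    have pP: "prime p" "p \<le> l" "p > 0" if "p \<in> P" for p using that prime_gt_0_nat by (auto simp: P_def)
    have "real (class_factorial_part n A M l) = (\<Prod>p\<in>P. real p ^ (M div p + l div p))"
      unfolding class_factorial_part_def P_def by (simp add: of_nat_prod)
    also have "ln \<dots> = (\<Sum>p\<in>P. ln (real p ^ (M div p + l div p)))"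
      using fin pP(3) by (intro ln_prod) force+
    also have "\<dots> = (\<Sum>p\<in>P. real (M div p + l div p) * ln (real p))"
      by (rule sum.cong) (use pP(3) in \<open>auto simp: ln_realpow\<close>)
    also have "\<dots> \<ge> (\<Sum>p\<in>P. (real (Suc m) * real l / real p - 2) * ln (real p))"
    proof (rule sum_mono, rule mult_right_mono)
      fix p assume p: "p \<in> P"
      have fl: "real x / real p - 1 \<le> real (x div p)" for x
      proof -
        have "x < p * Suc (x div p)" using dividend_less_times_div[OF pP(3)[OF p], of x] by simp
        then have "real x \<le> real p * (real (x div p) + 1)" by (metis less_imp_le of_nat_le_iff of_nat_mult of_nat_Suc add.commute)
        then show ?thesis using pP(3)[OF p] by (simp add: field_simps)
      qed
      have "real (m * l) / real p \<le> real M / real p" using M by (intro divide_right_mono) (simp_all only: of_nat_le_iff of_nat_0_le_iff)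
      then have "real m * real l / real p - 1 \<le> real (M div p)" using fl[of M] by simp
      moreover have "real (Suc m) * real l / real p = real m * real l / real p + real l / real p"
        by (simp add: add_divide_distrib algebra_simps)
      ultimately show "real (Suc m) * real l / real p - 2 \<le> real (M div p + l div p)" using fl[of l] by simp
      show "0 \<le> ln (real p)" using pP(3)[OF p] by simp
    qed
    also have "(\<Sum>p\<in>P. (real (Suc m) * real l / real p - 2) * ln (real p)) =
        real (Suc m) * real l * (\<Sum>p\<in>P. ln (real p) / real p) - 2 * (\<Sum>p\<in>P. ln (real p))"
      unfolding left_diff_distrib sum_subtractf sum_distrib_left by (simp add: mult_ac)
    also have "\<dots> \<ge> real (Suc m) * real l * (real (card A) / real (totient n) * ln (real l) - C) - 2 * (6 * real l)"
      by (intro diff_mono mult_left_mono sum_ln_primes_le C[OF l, folded P_def]) (use pP in auto)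
    finally show ?thesis by (simp add: algebra_simps)
  qed
  then show ?thesis by blast
qed

text \<open>Here \<open>M \<le> m * Suc l \<le> 2 * m * l\<close>, so \<open>ln M\<close> exceeds
  \<open>ln l\<close> by a constant at most, and the shift by \<open>\<mu>\<close> contributes only
  a multiple of \<open>ln l\<close>.\<close>

lemma ln_fact_linear_bound:
  assumes "m \<ge> 1"
  shows "\<exists>C. \<forall>l>0. \<forall>\<mu>\<le>m. ln (fact (m * l + \<mu>) :: real) \<le> real m * (real l * ln (real l)) + C * real l"
proof -
  have "ln (fact (m * l + \<mu>) :: real) \<le> real m * (real l * ln (real l)) + (real m + 2 * real m * ln (2 * real m)) * real l"
    if l: "l > 0" and mu: "\<mu> \<le> m" for l \<mu>
  proof -
    have le: "m * l + \<mu> \<le> m * Suc l" using mu by simp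
    have "(fact (m * l + \<mu>) :: real) \<le> fact (m * Suc l)" by (rule fact_mono[OF le])
    then have "ln (fact (m * l + \<mu>) :: real) \<le> ln (fact (m * Suc l))" by simp
    also have "\<dots> \<le> real (m * Suc l) * ln (real (m * Suc l))" by (rule ln_fact_le)
    also have "\<dots> \<le> real (m * Suc l) * (ln (2 * real m) + ln (real l))"
    proof (rule mult_left_mono)
      have "real (m * Suc l) \<le> (2 * real m) * real l" using l assms by (simp add: algebra_simps)
      moreover have "0 < real (m * Suc l)" "0 < (2 * real m) * real l"
        using assms l by (simp_all only: of_nat_0_less_iff) simp_all
      ultimately have "ln (real (m * Suc l)) \<le> ln ((2 * real m) * real l)"
        using ln_le_cancel_iff by blast
      also have "\<dots> = ln (2 * real m) + ln (real l)" using assms l by (intro ln_mult_pos) auto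
      finally show "ln (real (m * Suc l)) \<le> ln (2 * real m) + ln (real l)" .
    qed simp
    also have "\<dots> = real m * (real l * ln (real l)) + real m * ln (real l) + real (m * Suc l) * ln (2 * real m)"
      by (simp add: algebra_simps)
    also have "\<dots> \<le> real m * (real l * ln (real l)) + real m * real l + (2 * real m * real l) * ln (2 * real m)"
    proof (intro add_mono order.refl mult_left_mono mult_right_mono)
      show "ln (real l) \<le> real l" using l ln_le_minus_one[of "real l"] by simp
      show "real (m * Suc l) \<le> 2 * real m * real l" using l assms by (simp add: algebra_simps)
      show "0 \<le> ln (2 * real m)" using assms by simp
    qed simp
    finally show ?thesis by (simp add: algebra_simps)
  qed
  then show ?thesis by blast
qed


lemma class_factorial_part_pos: "class_factorial_part n A M l > 0"
  unfolding class_factorial_part_def by (rule prod_pos) (auto dest: prime_gt_0_nat)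

text \<open>The quotient of the approximation by the class part is integral, as seen place by place:
  above a prime of the classes the vanishing form makes the approximation small enough, and at all
  other places the class part is a unit while the approximation has absolute value at most 1. A
  non-zero algebraic integer has norm at least 1.\<close>

lemma class_factorial_part_le_norm:
  fixes lam al :: "nat \<Rightarrow> 'k::field_char_0"
  assumes nf: "number_field TYPE('k)" and form: "factorial_series_form m al"
    and norm: "submult_norm \<N>" and N_ge_1: "\<And>x. algebraic_int x \<Longrightarrow> x \<noteq> 0 \<Longrightarrow> \<N> x \<ge> 1"
    and lam: "\<And>j. j \<in> {0..m} \<Longrightarrow> algebraic_int (lam j)" and al: "\<And>j. j \<in> {1..m} \<Longrightarrow> algebraic_int (al j)"
    and zero: "\<And>v p. v \<in> nonarch_places \<Longrightarrow> prime p \<Longrightarrow> p mod n \<in> A \<Longrightarrow> lies_over v p \<Longrightarrow>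
      to_completion v (lam 0) \<oplus>\<^bsub>completion v\<^esub>
        (\<Oplus>\<^bsub>completion v\<^esub>j\<in>{1..m}. to_completion v (lam j) \<otimes>\<^bsub>completion v\<^esub> euler_F v (al j))
      = \<zero>\<^bsub>completion v\<^esub>"
    and nz: "factorial_series_form.approx m lam al l \<mu> \<noteq> 0"
  shows "real (class_factorial_part n A (m * l + \<mu>) l) \<le> \<N> (factorial_series_form.approx m lam al l \<mu>)"
proof -
  interpret F: factorial_series_form m lam al by (rule form)
  interpret N: submult_norm \<N> by (rule norm)
  define M where "M = m * l + \<mu>"
  define D where "D = class_factorial_part n A M l"
  define \<Lambda> where "\<Lambda> = F.approx l \<mu>"
  obtain k where k: "fact M * fact l = D * k"
    using class_factorial_part_dvd[of n A M l] unfolding D_def dvd_def by blast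
  have D0: "D > 0" unfolding D_def by (rule class_factorial_part_pos)
  have "algebraic_int (\<Lambda> / of_nat D)"
  proof (rule ccontr)
    assume "\<not> algebraic_int (\<Lambda> / of_nat D)"
    then obtain v where v: "v \<in> nonarch_places" "v (\<Lambda> / of_nat D) > 1"
      using exists_place_gt_1[OF nf] by blast
    then obtain q where q: "prime q" "lies_over v q" and na: "nonarch_absolute_value v"
      by (auto simp: nonarch_places_def)
    have abs: "nonarch_abs v" using na by (rule nonarch_abs.intro)
    have place: "padic_place v q" by (rule padic_place.intro[OF abs padic_place_axioms.intro[OF q]])
    note v_mult = nonarch_abs.v_mult[OF abs] and v_nonneg = nonarch_abs.v_nonneg[OF abs]
      and v_eq_0 = nonarch_abs.v_eq_0[OF abs] and v_of_nat_le_1 = nonarch_abs.v_of_nat_le_1[OF abs]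
    have v_one: "v 1 = 1" and v_power: "v (x ^ i) = v x ^ i" for x i
      by (fact nonarch_abs.v_one[OF abs] nonarch_abs.v_power[OF abs])+
    have vl: "v (lam j) \<le> 1" if "j \<in> {0..m}" for j using nonarch_abs.v_algebraic_int_le_1[OF abs lam[OF that]] .
    have va: "v (al j) \<le> 1" if "j \<in> {1..m}" for j using nonarch_abs.v_algebraic_int_le_1[OF abs al[OF that]] .
    have FA: "factorial_series_form_at m lam al v"
      by (rule factorial_series_form_at.intro[OF form abs], rule factorial_series_form_at_axioms.intro)
        (erule vl, erule va)
    have vD0: "v (of_nat D) > 0"
    proof -
      have "v (of_nat D) \<noteq> 0" using D0 by (simp add: v_eq_0)
      then show ?thesis using v_nonneg[of "of_nat D"] by linarith
    qed
    have "v \<Lambda> \<le> v (of_nat D)"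
    proof (cases "q mod n \<in> A")
      case True
      have "F.partial_form \<in> null_seqs v"
        by (rule padic_place.linear_form_zero_imp_null[OF place form va zero[OF v(1) q(1) True q(2)]])
      from factorial_series_form_at.v_approx_le_fact[OF FA this] have "v \<Lambda> \<le> v (fact M * fact l)" by (simp add: \<Lambda>_def M_def)
      also have "(fact M * fact l :: 'k) = of_nat D * of_nat k"
        using arg_cong[OF k, of "of_nat :: nat \<Rightarrow> 'k"] by simp
      also have "v \<dots> \<le> v (of_nat D) * 1" unfolding v_mult by (intro mult_left_mono v_of_nat_le_1 v_nonneg)
      finally show ?thesis by simp
    next
      case False
      \<comment> \<open>The place lies above \<open>q\<close>, and \<open>q\<close> is not among the
        primes composing \<open>D\<close>.\<close>
      have prod_one: "v (of_nat (\<Prod>p\<in>P. p ^ e p)) = 1" if "\<And>p. p \<in> P \<Longrightarrow> prime p \<and> p \<noteq> q" for P :: "nat set" and e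
        using that
      proof (induction P rule: infinite_finite_induct)
        case (insert p P)
        then have "v (of_nat p) = 1" using lies_over_other_prime[OF q(2,1), of p] by simp
        then show ?case using insert by (simp add: v_mult v_power)
      qed (simp_all add: v_one)
      have "v (of_nat D) = 1"
        unfolding D_def class_factorial_part_def by (rule prod_one) (use False in auto)
      then show ?thesis using factorial_series_form_at.v_approx_le_1[OF FA, of l \<mu>] by (simp add: \<Lambda>_def)
    qed
    moreover have "v (\<Lambda> / of_nat D) * v (of_nat D) = v \<Lambda>"
      using D0 unfolding v_mult[symmetric] by simp
    ultimately have "v (\<Lambda> / of_nat D) * v (of_nat D) \<le> 1 * v (of_nat D)" by simp
    then show False using v(2) vD0 by (simp add: mult_le_cancel_right_pos)
  qed
  then have "1 \<le> \<N> (\<Lambda> / of_nat D)" using N_ge_1 nz D0 by (simp add: \<Lambda>_def)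
  also have "\<Lambda> / of_nat D = of_rat (1 / of_nat D) * \<Lambda>" by (simp add: of_rat_divide)
  also have "\<N> (of_rat (1 / of_nat D) * \<Lambda>) = \<N> \<Lambda> / real D"
    unfolding N.N_scale by (simp add: of_rat_divide)
  finally show ?thesis using D0 by (simp add: field_simps D_def M_def \<Lambda>_def)
qed

theorem theorem4:
  fixes m n r :: nat
    and lam al :: "nat \<Rightarrow> 'k::field_char_0"
    and A R :: "nat set"
    and V :: "('k \<Rightarrow> real) set"
  assumes "number_field TYPE('k)"
    and "m \<ge> 1"
    and "\<forall>j\<in>{0..m}. lam j \<in> ring_of_integers"
    and "\<exists>j\<in>{0..m}. lam j \<noteq> 0"
    and "\<forall>j\<in>{1..m}. al j \<in> ring_of_integers - {0}"
    and "inj_on al {1..m}"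
    and "n \<ge> 3"
    and "A \<subseteq> totatives n" and "card A = r"
    and "real r > real m * real (totient n) / (real m + 1)"
    and "R = {p. prime p \<and> p mod n \<in> A}"
    and "V = {v \<in> nonarch_places. \<exists>p\<in>R. lies_over v p}"
  shows "\<exists>v\<in>V.
    to_completion v (lam 0) \<oplus>\<^bsub>completion v\<^esub>
      (\<Oplus>\<^bsub>completion v\<^esub>j\<in>{1..m}. to_completion v (lam j) \<otimes>\<^bsub>completion v\<^esub> euler_F v (al j))
    \<noteq> \<zero>\<^bsub>completion v\<^esub>"
proof (rule ccontr)
  assume neg: "\<not> ?thesis"
  have n1: "n > 1" using assms(7) by simp
  have phi: "totient n > 0" using n1 by simp
  have form: "factorial_series_form m al"
    by unfold_locales (use assms(5,6) in auto)
  interpret F: factorial_series_form m lam al by (rule form)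
  obtain \<N> :: "'k \<Rightarrow> real" where N: "submult_norm \<N>" "\<And>x. algebraic_int x \<Longrightarrow> x \<noteq> 0 \<Longrightarrow> \<N> x \<ge> 1"
    using number_field_norm[OF assms(1)] unfolding submult_norm_def by blast
  interpret FN: factorial_series_form_norm m lam al \<N>
    by (intro factorial_series_form_norm.intro form N(1))
  obtain c1 c2 where c: "c1 > 0" "c2 > 0"
    "\<And>l \<mu>. \<mu> \<le> m \<Longrightarrow> \<N> (F.approx l \<mu>) \<le> c1 * c2 ^ l * fact (m * l + \<mu>)"
    using FN.norm_approx_bound by blast
  obtain C1 where C1: "\<And>l M. l > 0 \<Longrightarrow> M \<ge> m * l \<Longrightarrow> ln (real (class_factorial_part n A M l))
      \<ge> real (Suc m) * (real (card A) / real (totient n)) * (real l * ln (real l)) - C1 * real l"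
    using ln_class_factorial_part_ge[OF n1 assms(8), of m] by blast
  obtain C2 where C2: "\<And>l \<mu>. l > 0 \<Longrightarrow> \<mu> \<le> m \<Longrightarrow>
      ln (fact (m * l + \<mu>) :: real) \<le> real m * (real l * ln (real l)) + C2 * real l"
    using ln_fact_linear_bound[OF assms(2)] by blast
  \<comment> \<open>The surplus in the coefficient of \<open>l * ln l\<close>; its positivity is
    precisely the hypothesis on \<open>r\<close>.\<close>
  define \<delta> where "\<delta> = real (Suc m) * (real r / real (totient n)) - real m"
  have \<delta>: "\<delta> > 0"
    using assms(10) phi by (simp add: \<delta>_def field_simps)
  define K where "K = C1 + C2 + \<bar>ln c1\<bar> + ln c2"
  have bound: "\<delta> * ln (real l) \<le> K" if l: "l > 0" for l
  proof -
    \<comment> \<open>The exponent \<open>\<mu>\<close> may vary with \<open>l\<close>, but all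
      constants are uniform in \<open>\<mu> \<le> m\<close>, so the resulting bound on
      \<open>ln l\<close> does not depend on \<open>l\<close>.\<close>
    obtain \<mu> where mu: "\<mu> \<le> m" "F.functional (F.node_poly ^ l * Polynomial.monom 1 \<mu>) \<noteq> 0"
      using F.functional_nonvanishing[OF assms(4)] by blast
    define D where "D = real (class_factorial_part n A (m * l + \<mu>) l)"
    have "D > 0" unfolding D_def using class_factorial_part_pos by simp
    have "D \<le> \<N> (F.approx l \<mu>)"
      unfolding D_def
    proof (rule class_factorial_part_le_norm[OF assms(1) form N])
      fix v :: "'k \<Rightarrow> real" and p assume "v \<in> nonarch_places" "prime p" "p mod n \<in> A" "lies_over v p"
      then have "v \<in> V" unfolding assms(11,12) by blast
      then show "to_completion v (lam 0) \<oplus>\<^bsub>completion v\<^esub>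
          (\<Oplus>\<^bsub>completion v\<^esub>j\<in>{1..m}. to_completion v (lam j) \<otimes>\<^bsub>completion v\<^esub> euler_F v (al j))
        = \<zero>\<^bsub>completion v\<^esub>"
        using neg by blast
    qed (use assms(3,5) mu(2) in \<open>auto simp: ring_of_integers_def F.approx_def\<close>)
    also have "\<dots> \<le> c1 * c2 ^ l * fact (m * l + \<mu>)" by (rule c(3)[OF mu(1)])
    finally have "ln D \<le> ln (c1 * c2 ^ l * fact (m * l + \<mu>))" using \<open>D > 0\<close> by simp
    also have "\<dots> = ln c1 + real l * ln c2 + ln (fact (m * l + \<mu>))"
      using c(1,2) by (simp add: ln_mult_pos ln_realpow)
    also have "\<dots> \<le> \<bar>ln c1\<bar> * real l + real l * ln c2 + (real m * (real l * ln (real l)) + C2 * real l)"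
    proof (intro add_mono order.refl C2 l mu(1))
      have "\<bar>ln c1\<bar> * 1 \<le> \<bar>ln c1\<bar> * real l" using l by (intro mult_left_mono) auto
      then show "ln c1 \<le> \<bar>ln c1\<bar> * real l" by linarith
    qed
    finally have "real (Suc m) * (real r / real (totient n)) * (real l * ln (real l)) - C1 * real l
        \<le> \<bar>ln c1\<bar> * real l + real l * ln c2 + (real m * (real l * ln (real l)) + C2 * real l)"
      using C1[OF l, of "m * l + \<mu>"] assms(9) by (simp add: D_def)
    then have "real l * (\<delta> * ln (real l)) \<le> real l * K"
      by (simp add: \<delta>_def K_def algebra_simps)
    then show ?thesis using l by simp
  qed
  have "filterlim (\<lambda>l::nat. ln (real l)) at_top at_top" by real_asymp
  then have "eventually (\<lambda>l::nat. ln (real l) > K / \<delta>) at_top"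
    by (simp add: filterlim_at_top_dense)
  then obtain l :: nat where "l > 0" "ln (real l) > K / \<delta>"
    using eventually_happens'[OF sequentially_bot eventually_conj[OF eventually_gt_at_top[of 0]]] by blast
  then show False using bound[of l] \<delta> by (simp add: field_simps)
qed

end
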